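(* Let $(A,H,\Sigma)$ be a pseudo-ASL over a field $R$ with a pseudo-ASL term order $\preceq$ and an algebra of leading terms $A_{lt}$, and let $I\subseteq A$ be an ideal. Then there is a unique reduced pseudo-ASL Gröbner basis for $I$ with respect to $(\preceq,A_{lt})$. Furthermore, there is an algorithm that takes as input a (finite) pseudo-ASL Gröbner basis $G$ and produces as output a reduced pseudo-ASL Gröbner basis (of the ideal generated by $G$).
   Context: All algebras are commutative, associative and unital; $R$ is a field; $\mathbb W=\{0,1,2,\dots\}$. For a finite set $H$, $\mathbb W^H$ is the monoid of monomials on $H$ (exponent vectors, written multiplicatively); a subset $\Sigma\subseteq \mathbb W^H$ is an ideal if $mm'\in\Sigma$ for all $m\in\Sigma$, $m'\in\mathbb W^H$. Pseudo-ASL: a triple $(A,H,\Sigma)$ where $A$ is an $R$-algebra, $H\subseteq A$ is a finite generating set, $\Sigma\subseteq\mathbb W^H$ is an ideal with $H\cap\Sigma=\emptyset$, and the elements $\prod_{h\in H}h^{m(h)}\in A$ for $m\in\mathbb W^H\setminus\Sigma$ form an $R$-basis of $A$. These basis elements are the standard monomials; an $R$-multiple of a standard monomial is a standard term. Given a total order $\preceq$ on standard monomials, for $f\neq 0$ let $LM(f)$ be the largest standard monomial occurring (with nonzero coefficient) in $f$, $LC(f)$ its coefficient, $LT(f)=LC(f)LM(f)$; put $LT(0)=0$. Pseudo-ASL term order: a total order $\preceq$ on the standard monomials of $A$ such that (1) $1\preceq m$ for all standard monomials $m$; (2) for all standard monomials $f,g,h,k$ with $f\prec g$, $h\preceq k$,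 $fh\ne0$, $gk\neq 0$, one has $LM(fh)\prec LM(gk)$. Algebra of leading terms for $(A,H,\Sigma,\preceq)$: a pseudo-ASL $A_{lt}$ over $R$ with the same $(H,\Sigma)$ such that, with $\pi_{lt}:A\to A_{lt}$ the $R$-linear bijection that is the identity on standard monomials, for all standard monomials $m,m'\in A$ one has $\pi_{lt}(m)\pi_{lt}(m')=0$ or $\pi_{lt}(m)\pi_{lt}(m')=\pi_{lt}(LT(mm'))$. For $f,g\in A$ write $f\mid_{lt}g$ if $\pi_{lt}(f)$ divides $\pi_{lt}(g)$ in $A_{lt}$. A subset $G\subseteq I$ is a pseudo-ASL Gröbner basis of $I$ with respect to $(\preceq,A_{lt})$ if $\langle \pi_{lt}(LT(f)) : f\in I\rangle=\langle\pi_{lt}(LT(g)) : g\in G\rangle$ as ideals of $A_{lt}$. It is reduced if $LC(g)=1$ for all $g\in G$ and, for every $g\in G$ and every standard monomial $m$ occurring in $g$, there is no $g'\in G$, $g'\neq g$, with $LT(g')\mid_{lt}m$. Computational conventions (for the algorithm): field operations of $R$ are computable; one is given $H$, a finite generating set of $\Sigma$, an algorithm multiplying standard monomials in $A$ (output as an $R$-linear combination of standard monomials), an algorithm deciding $\preceq$, an algorithm for multiplication in $A_{lt}$, and a finite generating set of $\ker(R[H]\to A_{lt})$ consisting of polynomials with at most two terms. Elements of $A$ are given as lists of standard monomials with coefficients. *)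

theory Defs
  imports "HOL-Algebra.Algebra"
begin

section \<open>Pseudo-ASLs\<close>

text \<open>The monoid of exponent vectors on \<open>H\<close>; its operation is pointwise addition.\<close>

definition exponents :: "'a set \<Rightarrow> ('a \<Rightarrow> nat) set"
  where "exponents H = {m. \<forall>x. x \<notin> H \<longrightarrow> m x = 0}"

definition exp_add :: "('a \<Rightarrow> nat) \<Rightarrow> ('a \<Rightarrow> nat) \<Rightarrow> ('a \<Rightarrow> nat)"
  where "exp_add m m' = (\<lambda>x. m x + m' x)"

definition exp_ideal :: "'a set \<Rightarrow> ('a \<Rightarrow> nat) set \<Rightarrow> bool"
  where "exp_ideal H \<Sigma> \<longleftrightarrow>
    \<Sigma> \<subseteq> exponents H \<and> (\<forall>m\<in>\<Sigma>. \<forall>m'\<in>exponents H. exp_add m m' \<in> \<Sigma>)"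

definition exp_genideal :: "'a set \<Rightarrow> ('a \<Rightarrow> nat) set \<Rightarrow> ('a \<Rightarrow> nat) set"
  where "exp_genideal H S = \<Inter>{J. exp_ideal H J \<and> S \<subseteq> J}"

definition finite_coeffs :: "('r, 'm) ring_scheme \<Rightarrow> 'i set \<Rightarrow> ('i \<Rightarrow> 'r) set"
  where "finite_coeffs R S =
    {c. (\<forall>i\<in>S. c i \<in> carrier R) \<and> (\<forall>i. i \<notin> S \<longrightarrow> c i = \<zero>\<^bsub>R\<^esub>) \<and> finite {i. c i \<noteq> \<zero>\<^bsub>R\<^esub>}}"

definition lin_comb ::
    "('r, 'm) ring_scheme \<Rightarrow> ('r, 'a) module \<Rightarrow> ('i \<Rightarrow> 'a) \<Rightarrow> ('i \<Rightarrow> 'r) \<Rightarrow> 'a"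
  where "lin_comb R M b c = (\<Oplus>\<^bsub>M\<^esub>i\<in>{i. c i \<noteq> \<zero>\<^bsub>R\<^esub>}. c i \<odot>\<^bsub>M\<^esub> b i)"

text \<open>A family \<open>b\<close> indexed by \<open>S\<close> is a basis if every element is a linear combination of it in
  exactly one way. In particular \<open>b\<close> is then injective on \<open>S\<close> when \<open>R\<close> is nonzero.\<close>

definition family_basis ::
    "('r, 'm) ring_scheme \<Rightarrow> ('r, 'a) module \<Rightarrow> ('i \<Rightarrow> 'a) \<Rightarrow> 'i set \<Rightarrow> bool"
  where "family_basis R M b S \<longleftrightarrow>
    (\<forall>i\<in>S. b i \<in> carrier M) \<and>
    (\<forall>f\<in>carrier M. \<exists>!c. c \<in> finite_coeffs R S \<and> f = lin_comb R M b c)"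

definition generates_algebra :: "('r, 'm) ring_scheme \<Rightarrow> ('r, 'a) module \<Rightarrow> 'a set \<Rightarrow> bool"
  where "generates_algebra R A H \<longleftrightarrow> H \<subseteq> carrier A \<and>
    (\<forall>B. subring B A \<and> (\<forall>a\<in>carrier R. \<forall>x\<in>B. a \<odot>\<^bsub>A\<^esub> x \<in> B) \<and> H \<subseteq> B \<longrightarrow> B = carrier A)"

definition monom_val :: "('r, 'a) module \<Rightarrow> 'a set \<Rightarrow> ('a \<Rightarrow> nat) \<Rightarrow> 'a"
  where "monom_val A H m = (\<Otimes>\<^bsub>A\<^esub>h\<in>H. h [^]\<^bsub>A\<^esub> m h)"

definition pseudo_asl ::
    "('r, 'm) ring_scheme \<Rightarrow> ('r, 'a) module \<Rightarrow> 'a set \<Rightarrow> ('a \<Rightarrow> nat) set \<Rightarrow> bool"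
  where "pseudo_asl R A H \<Sigma> \<longleftrightarrow>
    field R \<and> algebra R A \<and> finite H \<and> generates_algebra R A H \<and>
    exp_ideal H \<Sigma> \<and> (\<forall>h\<in>H. (\<lambda>x. if x = h then 1 else 0) \<notin> \<Sigma>) \<and>
    family_basis R A (monom_val A H) (exponents H - \<Sigma>)"


section \<open>Term orders and leading terms\<close>

text \<open>Throughout, a standard monomial is represented by its exponent vector, an element of
  \<open>exponents H - \<Sigma>\<close>; the corresponding element of \<open>A\<close> is \<open>monom_val A H m\<close>. For a pseudo-ASL
  this correspondence is bijective.\<close>

definition coords ::
    "('r, 'm) ring_scheme \<Rightarrow> ('r, 'a) module \<Rightarrow> 'a set \<Rightarrow> ('a \<Rightarrow> nat) set \<Rightarrow> 'a \<Rightarrow> (('a \<Rightarrow> nat) \<Rightarrow> 'r)"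
  where "coords R A H \<Sigma> f =
    (THE c. c \<in> finite_coeffs R (exponents H - \<Sigma>) \<and> f = lin_comb R A (monom_val A H) c)"

definition occurring ::
    "('r, 'm) ring_scheme \<Rightarrow> ('r, 'a) module \<Rightarrow> 'a set \<Rightarrow> ('a \<Rightarrow> nat) set \<Rightarrow> 'a \<Rightarrow> ('a \<Rightarrow> nat) set"
  where "occurring R A H \<Sigma> f = {m. coords R A H \<Sigma> f m \<noteq> \<zero>\<^bsub>R\<^esub>}"

text \<open>\<open>LM f\<close> is meaningful only for \<open>f \<noteq> 0\<close>; \<open>LC 0\<close> and \<open>LT 0\<close> are zero. Orders are sets of pairs
  \<open>(m, m')\<close> with \<open>m \<preceq> m'\<close>.\<close>

definition LM ::
    "('r, 'm) ring_scheme \<Rightarrow> ('r, 'a) module \<Rightarrow> 'a set \<Rightarrow> ('a \<Rightarrow> nat) set \<Rightarrow> ('a \<Rightarrow> nat) rel \<Rightarrow> 'a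
      \<Rightarrow> ('a \<Rightarrow> nat)"
  where "LM R A H \<Sigma> ord f =
    (THE m. m \<in> occurring R A H \<Sigma> f \<and> (\<forall>m'\<in>occurring R A H \<Sigma> f. (m', m) \<in> ord))"

definition LC ::
    "('r, 'm) ring_scheme \<Rightarrow> ('r, 'a) module \<Rightarrow> 'a set \<Rightarrow> ('a \<Rightarrow> nat) set \<Rightarrow> ('a \<Rightarrow> nat) rel \<Rightarrow> 'a \<Rightarrow> 'r"
  where "LC R A H \<Sigma> ord f =
    (if f = \<zero>\<^bsub>A\<^esub> then \<zero>\<^bsub>R\<^esub> else coords R A H \<Sigma> f (LM R A H \<Sigma> ord f))"

definition LT ::
    "('r, 'm) ring_scheme \<Rightarrow> ('r, 'a) module \<Rightarrow> 'a set \<Rightarrow> ('a \<Rightarrow> nat) set \<Rightarrow> ('a \<Rightarrow> nat) rel \<Rightarrow> 'a \<Rightarrow> 'a"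
  where "LT R A H \<Sigma> ord f =
    (if f = \<zero>\<^bsub>A\<^esub> then \<zero>\<^bsub>A\<^esub>
     else LC R A H \<Sigma> ord f \<odot>\<^bsub>A\<^esub> monom_val A H (LM R A H \<Sigma> ord f))"

definition term_order ::
    "('r, 'm) ring_scheme \<Rightarrow> ('r, 'a) module \<Rightarrow> 'a set \<Rightarrow> ('a \<Rightarrow> nat) set \<Rightarrow> ('a \<Rightarrow> nat) rel \<Rightarrow> bool"
  where "term_order R A H \<Sigma> ord \<longleftrightarrow>
    (let S = exponents H - \<Sigma>; val = monom_val A H in
      linear_order_on S ord \<and>
      (\<forall>m\<in>S. ((\<lambda>_. 0), m) \<in> ord) \<and>
      (\<forall>f\<in>S. \<forall>g\<in>S. \<forall>h\<in>S. \<forall>k\<in>S.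
        (f, g) \<in> ord \<and> f \<noteq> g \<and> (h, k) \<in> ord \<and>
        val f \<otimes>\<^bsub>A\<^esub> val h \<noteq> \<zero>\<^bsub>A\<^esub> \<and> val g \<otimes>\<^bsub>A\<^esub> val k \<noteq> \<zero>\<^bsub>A\<^esub> \<longrightarrow>
          (LM R A H \<Sigma> ord (val f \<otimes>\<^bsub>A\<^esub> val h), LM R A H \<Sigma> ord (val g \<otimes>\<^bsub>A\<^esub> val k)) \<in> ord \<and>
          LM R A H \<Sigma> ord (val f \<otimes>\<^bsub>A\<^esub> val h) \<noteq> LM R A H \<Sigma> ord (val g \<otimes>\<^bsub>A\<^esub> val k)))"


section \<open>Algebras of leading terms and Groebner bases\<close>

text \<open>The linear bijection from \<open>A\<close> to \<open>L\<close> that sends each standard monomial of \<open>A\<close> to the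
  standard monomial of \<open>L\<close> with the same exponent vector.\<close>

definition pi_lt ::
    "('r, 'm) ring_scheme \<Rightarrow> ('r, 'a) module \<Rightarrow> 'a set \<Rightarrow> ('a \<Rightarrow> nat) set \<Rightarrow> ('r, 'a) module \<Rightarrow> 'a \<Rightarrow> 'a"
  where "pi_lt R A H \<Sigma> L f = lin_comb R L (monom_val L H) (coords R A H \<Sigma> f)"

definition leading_term_algebra ::
    "('r, 'm) ring_scheme \<Rightarrow> ('r, 'a) module \<Rightarrow> 'a set \<Rightarrow> ('a \<Rightarrow> nat) set \<Rightarrow> ('a \<Rightarrow> nat) rel
      \<Rightarrow> ('r, 'a) module \<Rightarrow> bool"
  where "leading_term_algebra R A H \<Sigma> ord L \<longleftrightarrow>
    pseudo_asl R L H \<Sigma> \<and>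
    (let val = monom_val A H; \<pi> = pi_lt R A H \<Sigma> L in
      \<forall>m\<in>exponents H - \<Sigma>. \<forall>m'\<in>exponents H - \<Sigma>.
        \<pi> (val m) \<otimes>\<^bsub>L\<^esub> \<pi> (val m') = \<zero>\<^bsub>L\<^esub> \<or>
        \<pi> (val m) \<otimes>\<^bsub>L\<^esub> \<pi> (val m') = \<pi> (LT R A H \<Sigma> ord (val m \<otimes>\<^bsub>A\<^esub> val m')))"

definition divides_lt ::
    "('r, 'm) ring_scheme \<Rightarrow> ('r, 'a) module \<Rightarrow> 'a set \<Rightarrow> ('a \<Rightarrow> nat) set \<Rightarrow> ('r, 'a) module
      \<Rightarrow> 'a \<Rightarrow> 'a \<Rightarrow> bool"
  where "divides_lt R A H \<Sigma> L f g \<longleftrightarrow> pi_lt R A H \<Sigma> L f divides\<^bsub>L\<^esub> pi_lt R A H \<Sigma> L g"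

definition groebner_basis ::
    "('r, 'm) ring_scheme \<Rightarrow> ('r, 'a) module \<Rightarrow> 'a set \<Rightarrow> ('a \<Rightarrow> nat) set \<Rightarrow> ('a \<Rightarrow> nat) rel
      \<Rightarrow> ('r, 'a) module \<Rightarrow> 'a set \<Rightarrow> 'a set \<Rightarrow> bool"
  where "groebner_basis R A H \<Sigma> ord L I G \<longleftrightarrow>
    G \<subseteq> I \<and>
    Idl\<^bsub>L\<^esub> ((\<lambda>f. pi_lt R A H \<Sigma> L (LT R A H \<Sigma> ord f)) ` I) =
    Idl\<^bsub>L\<^esub> ((\<lambda>g. pi_lt R A H \<Sigma> L (LT R A H \<Sigma> ord g)) ` G)"

definition reduced_groebner_basis ::
    "('r, 'm) ring_scheme \<Rightarrow> ('r, 'a) module \<Rightarrow> 'a set \<Rightarrow> ('a \<Rightarrow> nat) set \<Rightarrow> ('a \<Rightarrow> nat) rel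
      \<Rightarrow> ('r, 'a) module \<Rightarrow> 'a set \<Rightarrow> 'a set \<Rightarrow> bool"
  where "reduced_groebner_basis R A H \<Sigma> ord L I G \<longleftrightarrow>
    groebner_basis R A H \<Sigma> ord L I G \<and>
    (\<forall>g\<in>G. LC R A H \<Sigma> ord g = \<one>\<^bsub>R\<^esub>) \<and>
    (\<forall>g\<in>G. \<forall>m\<in>occurring R A H \<Sigma> g.
      \<not> (\<exists>g'\<in>G. g' \<noteq> g \<and> divides_lt R A H \<Sigma> L (LT R A H \<Sigma> ord g') (monom_val A H m)))"


section \<open>The polynomial ring on the generators\<close>

definition exp_poly_ring :: "('r, 'm) ring_scheme \<Rightarrow> 'a set \<Rightarrow> (('a \<Rightarrow> nat) \<Rightarrow> 'r) ring"
  where "exp_poly_ring R H =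
    \<lparr> carrier = finite_coeffs R (exponents H),
      monoid.mult = (\<lambda>p q m. if m \<in> exponents H
        then (\<Oplus>\<^bsub>R\<^esub>u\<in>{u. \<forall>x. u x \<le> m x}. p u \<otimes>\<^bsub>R\<^esub> q (\<lambda>x. m x - u x)) else \<zero>\<^bsub>R\<^esub>),
      monoid.one = (\<lambda>m. if m = (\<lambda>_. 0) then \<one>\<^bsub>R\<^esub> else \<zero>\<^bsub>R\<^esub>),
      ring.zero = (\<lambda>_. \<zero>\<^bsub>R\<^esub>),
      ring.add = (\<lambda>p q m. p m \<oplus>\<^bsub>R\<^esub> q m) \<rparr>"

definition eval_kernel ::
    "('r, 'm) ring_scheme \<Rightarrow> 'a set \<Rightarrow> ('r, 'a) module \<Rightarrow> (('a \<Rightarrow> nat) \<Rightarrow> 'r) set"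
  where "eval_kernel R H L =
    {p \<in> carrier (exp_poly_ring R H). lin_comb R L (monom_val L H) p = \<zero>\<^bsub>L\<^esub>}"


section \<open>Algorithms over a field with subroutines\<close>

text \<open>Data are binary trees whose leaves are empty or carry a field element. Programs are finite
  syntactic objects that do not depend on the field: they can build and take apart trees, test
  whether a tree is the empty leaf, loop, apply the field operations and the equality test of the
  field to scalars, and call the supplied algorithms (multiplication of standard monomials of
  \<open>A\<close>, multiplication in the algebra of leading terms, comparison of standard monomials) as
  subroutines. Field elements are otherwise opaque.\<close>

datatype 'r data = Leaf | Scal 'r | Node "'r data" "'r data"

datatype subroutine = MultA | MultLt | Compare

datatype prog =
    Skip
  | MkLeaf
  | MkNode prog prog
  | GoLeft
  | GoRight
  | Then prog prog
  | IfLeaf prog prog prog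
  | WhileNode prog prog
  | FZero
  | FOne
  | FAdd
  | FNeg
  | FMult
  | FInv
  | FEq
  | Call subroutine

fun enc_bool :: "bool \<Rightarrow> 'r data"
  where
    "enc_bool False = Leaf"
  | "enc_bool True = Node Leaf Leaf"

text \<open>\<open>exec R sub p x y\<close>: program \<open>p\<close> started on \<open>x\<close> halts with output \<open>y\<close>. Ill-typed operations,
  including inversion of zero, have no output.\<close>

inductive exec ::
    "('r, 'm) ring_scheme \<Rightarrow> (subroutine \<Rightarrow> 'r data \<Rightarrow> 'r data) \<Rightarrow> prog \<Rightarrow> 'r data \<Rightarrow> 'r data \<Rightarrow> bool"
  for R :: "('r, 'm) ring_scheme" and sub :: "subroutine \<Rightarrow> 'r data \<Rightarrow> 'r data"
  where
    exec_Skip: "exec R sub Skip x x"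
  | exec_MkLeaf: "exec R sub MkLeaf x Leaf"
  | exec_MkNode: "exec R sub p x y \<Longrightarrow> exec R sub q x z \<Longrightarrow> exec R sub (MkNode p q) x (Node y z)"
  | exec_GoLeft: "exec R sub GoLeft (Node x y) x"
  | exec_GoRight: "exec R sub GoRight (Node x y) y"
  | exec_Then: "exec R sub p x y \<Longrightarrow> exec R sub q y z \<Longrightarrow> exec R sub (Then p q) x z"
  | exec_IfLeaf1: "exec R sub b x Leaf \<Longrightarrow> exec R sub p x y \<Longrightarrow> exec R sub (IfLeaf b p q) x y"
  | exec_IfLeaf2: "exec R sub b x v \<Longrightarrow> v \<noteq> Leaf \<Longrightarrow> exec R sub q x y \<Longrightarrow> exec R sub (IfLeaf b p q) x y"
  | exec_While1: "exec R sub b x Leaf \<Longrightarrow> exec R sub (WhileNode b p) x x"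
  | exec_While2: "exec R sub b x v \<Longrightarrow> v \<noteq> Leaf \<Longrightarrow> exec R sub p x y \<Longrightarrow>
      exec R sub (WhileNode b p) y z \<Longrightarrow> exec R sub (WhileNode b p) x z"
  | exec_FZero: "exec R sub FZero x (Scal \<zero>\<^bsub>R\<^esub>)"
  | exec_FOne: "exec R sub FOne x (Scal \<one>\<^bsub>R\<^esub>)"
  | exec_FAdd: "exec R sub FAdd (Node (Scal a) (Scal b)) (Scal (a \<oplus>\<^bsub>R\<^esub> b))"
  | exec_FNeg: "exec R sub FNeg (Scal a) (Scal (\<ominus>\<^bsub>R\<^esub> a))"
  | exec_FMult: "exec R sub FMult (Node (Scal a) (Scal b)) (Scal (a \<otimes>\<^bsub>R\<^esub> b))"
  | exec_FInv: "a \<noteq> \<zero>\<^bsub>R\<^esub> \<Longrightarrow> exec R sub FInv (Scal a) (Scal (inv\<^bsub>R\<^esub> a))"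
  | exec_FEq: "exec R sub FEq (Node (Scal a) (Scal b)) (enc_bool (a = b))"
  | exec_Call: "exec R sub (Call s) x (sub s x)"

inductive_cases exec_elims:
  "exec R sub Skip x y" "exec R sub MkLeaf x y" "exec R sub (MkNode p q) x y"
  "exec R sub GoLeft x y" "exec R sub GoRight x y" "exec R sub (Then p q) x y"
  "exec R sub (IfLeaf b p q) x y" "exec R sub FZero x y" "exec R sub FOne x y"
  "exec R sub FAdd x y" "exec R sub FNeg x y" "exec R sub FMult x y" "exec R sub FInv x y"
  "exec R sub FEq x y" "exec R sub (Call s) x y"

inductive_cases exec_While_elim: "exec R sub (WhileNode b p) x y"

lemma exec_deterministic: "exec R sub p x y \<Longrightarrow> exec R sub p x z \<Longrightarrow> y = z"
proof (induction arbitrary: z rule: exec.induct)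
  case (exec_While1 b x p)
  from exec_While1.prems show ?case
    by (rule exec_While_elim) (use exec_While1.IH in auto)
next
  case (exec_While2 b x v p y w)
  from exec_While2.prems show ?case
  proof (rule exec_While_elim)
    assume "z = x" "exec R sub b x Leaf"
    with exec_While2.IH(1) exec_While2.hyps show ?thesis by auto
  next
    fix v' y' assume "exec R sub p x y'" "exec R sub (WhileNode b p) y' z"
    with exec_While2.IH show ?thesis by metis
  qed
qed (blast elim: exec_elims)+


section \<open>Encoding of the input and output\<close>

fun enc_list :: "'r data list \<Rightarrow> 'r data"
  where
    "enc_list [] = Leaf"
  | "enc_list (x # xs) = Node x (enc_list xs)"

definition enc_nat :: "nat \<Rightarrow> 'r data"
  where "enc_nat n = enc_list (replicate n Leaf)"

text \<open>\<open>hs\<close> is an enumeration of \<open>H\<close> without repetition.\<close>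

definition enc_exp :: "'a list \<Rightarrow> ('a \<Rightarrow> nat) \<Rightarrow> 'r data"
  where "enc_exp hs m = enc_list (map (\<lambda>h. enc_nat (m h)) hs)"

definition enc_terms :: "'a list \<Rightarrow> ('r \<times> ('a \<Rightarrow> nat)) list \<Rightarrow> 'r data"
  where "enc_terms hs ts = enc_list (map (\<lambda>(c, m). Node (Scal c) (enc_exp hs m)) ts)"

text \<open>A list of terms denotes its sum: monomials may be repeated, coefficients may be zero.\<close>

fun terms_coeff ::
    "('r, 'm) ring_scheme \<Rightarrow> ('r \<times> ('a \<Rightarrow> nat)) list \<Rightarrow> ('a \<Rightarrow> nat) \<Rightarrow> 'r"
  where
    "terms_coeff R [] m = \<zero>\<^bsub>R\<^esub>"
  | "terms_coeff R ((c, m') # ts) m =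
      (if m' = m then c \<oplus>\<^bsub>R\<^esub> terms_coeff R ts m else terms_coeff R ts m)"

definition represents_coeffs ::
    "('r, 'm) ring_scheme \<Rightarrow> 'a list \<Rightarrow> ('a \<Rightarrow> nat) set \<Rightarrow> 'r data \<Rightarrow> (('a \<Rightarrow> nat) \<Rightarrow> 'r) \<Rightarrow> bool"
  where "represents_coeffs R hs S d c \<longleftrightarrow>
    (\<exists>ts. set ts \<subseteq> carrier R \<times> S \<and> d = enc_terms hs ts \<and> c = terms_coeff R ts)"

definition represents_elem ::
    "('r, 'm) ring_scheme \<Rightarrow> ('r, 'a) module \<Rightarrow> 'a set \<Rightarrow> ('a \<Rightarrow> nat) set \<Rightarrow> 'a list
      \<Rightarrow> 'r data \<Rightarrow> 'a \<Rightarrow> bool"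
  where "represents_elem R A H \<Sigma> hs d f \<longleftrightarrow>
    f \<in> carrier A \<and> represents_coeffs R hs (exponents H - \<Sigma>) d (coords R A H \<Sigma> f)"

definition represents_finite_set :: "('r data \<Rightarrow> 'x \<Rightarrow> bool) \<Rightarrow> 'r data \<Rightarrow> 'x set \<Rightarrow> bool"
  where "represents_finite_set rep d xset \<longleftrightarrow>
    (\<exists>ds xs. d = enc_list ds \<and> list_all2 rep ds xs \<and> set xs = xset)"

definition correct_subroutines ::
    "('r, 'm) ring_scheme \<Rightarrow> ('r, 'a) module \<Rightarrow> 'a set \<Rightarrow> ('a \<Rightarrow> nat) set \<Rightarrow> ('a \<Rightarrow> nat) rel
      \<Rightarrow> ('r, 'a) module \<Rightarrow> 'a list \<Rightarrow> (subroutine \<Rightarrow> 'r data \<Rightarrow> 'r data) \<Rightarrow> bool"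
  where "correct_subroutines R A H \<Sigma> ord L hs sub \<longleftrightarrow>
    (\<forall>m\<in>exponents H - \<Sigma>. \<forall>m'\<in>exponents H - \<Sigma>.
      represents_elem R A H \<Sigma> hs (sub MultA (Node (enc_exp hs m) (enc_exp hs m')))
        (monom_val A H m \<otimes>\<^bsub>A\<^esub> monom_val A H m')) \<and>
    (\<forall>d d' f g. represents_elem R L H \<Sigma> hs d f \<and> represents_elem R L H \<Sigma> hs d' g \<longrightarrow>
      represents_elem R L H \<Sigma> hs (sub MultLt (Node d d')) (f \<otimes>\<^bsub>L\<^esub> g)) \<and>
    (\<forall>m\<in>exponents H - \<Sigma>. \<forall>m'\<in>exponents H - \<Sigma>.
      sub Compare (Node (enc_exp hs m) (enc_exp hs m')) = enc_bool ((m, m') \<in> ord))"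

text \<open>The given data: the generators (as their number; exponent vectors are written with respect to
  the enumeration \<open>hs\<close>), a finite generating set of \<open>\<Sigma>\<close>, and a finite generating set of the kernel
  of \<open>R[H] \<rightarrow> L\<close> consisting of polynomials with at most two terms.\<close>

definition describes ::
    "('r, 'm) ring_scheme \<Rightarrow> 'a set \<Rightarrow> ('a \<Rightarrow> nat) set \<Rightarrow> ('r, 'a) module \<Rightarrow> 'a list \<Rightarrow> 'r data \<Rightarrow> bool"
  where "describes R H \<Sigma> L hs d \<longleftrightarrow>
    distinct hs \<and> set hs = H \<and>
    (\<exists>sgens dK K.
      set sgens \<subseteq> exponents H \<and> exp_genideal H (set sgens) = \<Sigma> \<and>
      represents_finite_set (represents_coeffs R hs (exponents H)) dK K \<and>
      (\<forall>p\<in>K. card {m. p m \<noteq> \<zero>\<^bsub>R\<^esub>} \<le> 2) \<and>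
      Idl\<^bsub>exp_poly_ring R H\<^esub> K = eval_kernel R H L \<and>
      d = enc_list [enc_nat (length hs), enc_list (map (enc_exp hs) sgens), dK])"

end

theory Submission
  imports Defs
begin

text \<open>
  Standard monomials are represented by their exponent vectors, which form the set \<open>S\<close>, and \<open>dv m m'\<close>
  is divisibility of the corresponding standard monomials of the algebra of leading terms \<open>L\<close>.
  Dickson's lemma makes the term order a well-order (\<open>wf_ord\<close>). The product of two standard
  monomials in \<open>L\<close> is zero or a nonzero multiple of one standard monomial, namely of the leading
  monomial of their product in \<open>A\<close> (\<open>L_mult\<close>). Consequently divisibility refines the term order
  (\<open>dv_ord\<close>), ideals of \<open>L\<close> generated by terms are determined by the monomials in them
  (\<open>leading_terms_occ\<close>), and multiplication by a monomial is compatible with leading monomials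
  wherever the product in \<open>L\<close> does not vanish (\<open>lm_mult\<close>). Hence the set \<open>lms I\<close> of leading monomials
  of an ideal \<open>I\<close> is closed under multiples, and \<open>G \<subseteq> I\<close> is a Groebner basis iff every element of
  \<open>lms I\<close> is a multiple of the leading monomial of some nonzero element of \<open>G\<close> (\<open>groebner_iff\<close>).

  From here existence and uniqueness are as for polynomials. For each divisibility-minimal
  \<open>m \<in> lms I\<close> exactly one element of \<open>I\<close> has the form \<open>m + r\<close>, where all monomials of \<open>r\<close> are smaller
  than \<open>m\<close> and none of them is in \<open>lms I\<close>: a normal form of \<open>m\<close> provides \<open>r\<close>, and the difference of two
  such elements could only have a leading monomial outside \<open>lms I\<close>. These elements are the
  reduced Groebner basis (\<open>reduced_iff\<close>).

  The algorithm selects the minimal leading monomials of \<open>G\<close> and computes their normal forms by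
  repeated cancellation of leading terms, which stops because the term order is a well-order. The
  difficulty is to decide divisibility in \<open>L\<close>. Let the fibre of \<open>m\<close> consist of all exponent vectors
  whose image in \<open>L\<close> is a nonzero multiple of \<open>m\<close>; then \<open>m\<close> divides \<open>m'\<close> iff \<open>m\<close> can be subtracted
  from some vector in the fibre of \<open>m'\<close> with a standard result (\<open>dv_fibre\<close>). A fibre is an antichain, because a proper multiple of a
  monomial is larger in the term order, so it is finite by Dickson's lemma (\<open>finite_fibre\<close>). Since the
  kernel of \<open>R[H] \<rightarrow> L\<close> is generated by polynomials with at most two terms, the exchange of one
  exponent of a generator for the other connects each fibre (\<open>fibre_connected\<close>). So a graph search
  enumerates it (\<open>exec_closure\<close>).
\<close>

section \<open>Dickson's lemma\<close>

lemma exists_nondecreasing_subsequence: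
  fixes f :: "nat \<Rightarrow> nat"
  shows "\<exists>r::nat \<Rightarrow> nat. strict_mono r \<and> mono (f \<circ> r)"
proof -
  obtain r :: "nat \<Rightarrow> nat" where r: "strict_mono r" "monoseq (f \<circ> r)"
    using seq_monosub[of f] by (auto simp: comp_def)
  show ?thesis
  proof (cases "mono (f \<circ> r)")
    case True
    with r show ?thesis by blast
  next
    case False
    then have dec: "(f \<circ> r) n \<le> (f \<circ> r) m" if "m \<le> n" for m n
      using r(2) that by (auto simp: monoseq_def mono_def)
    define k where "k = (ARG_MIN (f \<circ> r) n. True)"
    have k: "(f \<circ> r) k \<le> (f \<circ> r) n" for n
      unfolding k_def by (rule arg_min_nat_le) simp
    have "mono (f \<circ> (\<lambda>n. r (n + k)))"
      using dec[of k] k by (auto simp: mono_def) (metis le_add2 order_trans)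
    moreover have "strict_mono (\<lambda>n. r (n + k))"
      using r(1) by (auto simp: strict_mono_def)
    ultimately show ?thesis by blast
  qed
qed

lemma dickson_subsequence:
  fixes f :: "nat \<Rightarrow> 'a \<Rightarrow> nat"
  assumes "finite T"
  shows "\<exists>r::nat \<Rightarrow> nat. strict_mono r \<and> (\<forall>x\<in>T. mono (\<lambda>n. f (r n) x))"
  using assms
proof (induction T)
  case empty
  have "strict_mono (\<lambda>n::nat. n)" by (simp add: strict_mono_def)
  then show ?case by blast
next
  case (insert y T)
  then obtain r :: "nat \<Rightarrow> nat" where r: "strict_mono r" "\<forall>x\<in>T. mono (\<lambda>n. f (r n) x)" by blast
  obtain q :: "nat \<Rightarrow> nat" where q: "strict_mono q" "mono ((\<lambda>n. f (r n) y) \<circ> q)"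
    using exists_nondecreasing_subsequence[of "\<lambda>n. f (r n) y"] by blast
  have "strict_mono (r \<circ> q)" using r(1) q(1) by (simp add: strict_mono_def)
  moreover have "mono (\<lambda>n. f ((r \<circ> q) n) x)" if "x \<in> insert y T" for x
    using that
  proof
    assume "x = y" then show ?thesis using q(2) by (simp add: comp_def)
  next
    assume "x \<in> T"
    then have "mono (\<lambda>n. f (r n) x)" using r(2) by blast
    then show ?thesis using q(1) by (auto simp: mono_def strict_mono_less_eq)
  qed
  ultimately show ?case by blast
qed

lemma dickson:
  fixes f :: "nat \<Rightarrow> 'a \<Rightarrow> nat"
  assumes "finite H" "\<And>n. f n \<in> exponents H"
  shows "\<exists>i j. i < j \<and> f i \<le> f j"
proof -
  obtain r :: "nat \<Rightarrow> nat" where r: "strict_mono r" "\<forall>x\<in>H. mono (\<lambda>n. f (r n) x)"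
    using dickson_subsequence[OF assms(1)] by blast
  have "f (r 0) x \<le> f (r 1) x" for x
    using r(2) assms(2) by (cases "x \<in> H") (auto simp: mono_def exponents_def)
  moreover have "r 0 < r 1" using r(1) by (simp add: strict_mono_def)
  ultimately show ?thesis by (auto simp: le_fun_def)
qed

section \<open>Coordinates\<close>

lemma exp_add_mem: "u \<in> exponents H \<Longrightarrow> w \<in> exponents H \<Longrightarrow> exp_add u w \<in> exponents H"
  by (auto simp: exponents_def exp_add_def)

lemma exp_add_commute: "exp_add u w = exp_add w u"
  by (auto simp: exp_add_def)

lemma exp_add_zero: "exp_add u (\<lambda>_. 0) = u" "exp_add (\<lambda>_. 0) u = u"
  by (auto simp: exp_add_def)

lemma exp_add_diff: "u \<le> w \<Longrightarrow> exp_add u (\<lambda>x. w x - u x) = w"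
  by (auto simp: exp_add_def le_fun_def)

lemma exp_diff_mem: "w \<in> exponents H \<Longrightarrow> (\<lambda>x. w x - u x) \<in> exponents H"
  by (auto simp: exponents_def)

lemma exp_le_mem: "w \<in> exponents H \<Longrightarrow> u \<le> w \<Longrightarrow> u \<in> exponents H"
  by (simp add: exponents_def le_fun_def) (metis le_zero_eq)

lemma finite_coeffsI:
  assumes "\<And>i. i \<in> T \<Longrightarrow> c i \<in> carrier R" "\<And>i. i \<notin> T \<Longrightarrow> c i = \<zero>\<^bsub>R\<^esub>"
    "finite {i. c i \<noteq> \<zero>\<^bsub>R\<^esub>}"
  shows "c \<in> finite_coeffs R T"
  unfolding finite_coeffs_def using assms by blast

lemma finite_coeffsD:
  assumes "c \<in> finite_coeffs R T"
  shows "i \<in> T \<Longrightarrow> c i \<in> carrier R" "i \<notin> T \<Longrightarrow> c i = \<zero>\<^bsub>R\<^esub>" "finite {i. c i \<noteq> \<zero>\<^bsub>R\<^esub>}"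
  using assms unfolding finite_coeffs_def by blast+

locale pasl =
  fixes R :: "'r ring" and A :: "('r, 'a) module" (structure) and H :: "'a set" and \<Sigma> :: "('a \<Rightarrow> nat) set"
  assumes pasl: "pseudo_asl R A H \<Sigma>"
begin

sublocale R: field R
  using pasl by (simp add: pseudo_asl_def)

sublocale A: algebra R A
  using pasl by (simp add: pseudo_asl_def)

abbreviation S where "S \<equiv> exponents H - \<Sigma>"
abbreviation val where "val \<equiv> monom_val A H"
abbreviation lc where "lc \<equiv> lin_comb R A (monom_val A H)"
abbreviation co where "co \<equiv> coords R A H \<Sigma>"
abbreviation occ where "occ \<equiv> occurring R A H \<Sigma>"

lemma finite_H: "finite H" and H_sub: "H \<subseteq> carrier A"
  using pasl by (auto simp: pseudo_asl_def generates_algebra_def)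

lemma S_down:
  assumes "exp_add u w \<in> S" "u \<in> exponents H" "w \<in> exponents H"
  shows "u \<in> S" "w \<in> S"
proof -
  have "exp_add m m' \<in> \<Sigma>" if "m \<in> \<Sigma>" "m' \<in> exponents H" for m m'
    using pasl that unfolding pseudo_asl_def exp_ideal_def by blast
  from this[of u w] this[of w u] show "u \<in> S" "w \<in> S"
    using assms by (auto simp: exp_add_commute[of w u])
qed

lemma S_le: "w \<in> S \<Longrightarrow> u \<le> w \<Longrightarrow> u \<in> S"
  using S_down(1)[of u "\<lambda>x. w x - u x"] exp_add_diff[of u w] exp_le_mem exp_diff_mem
  by (metis DiffD1)

lemma gen_in_S: "h \<in> H \<Longrightarrow> (\<lambda>x. if x = h then 1 else 0) \<in> S"
  using pasl by (auto simp: pseudo_asl_def exponents_def)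

lemma val_closed [simp, intro]: "val u \<in> carrier A"
  unfolding monom_val_def using H_sub by (intro A.finprod_closed) auto

lemma val_zero [simp]: "val (\<lambda>_. 0) = \<one>"
  unfolding monom_val_def by simp

lemma val_add: "val (exp_add u w) = val u \<otimes> val w"
proof -
  have "val (exp_add u w) = (\<Otimes>h\<in>H. h [^] u h \<otimes> h [^] w h)"
    unfolding monom_val_def exp_add_def using H_sub
    by (intro A.finprod_cong') (auto simp: A.nat_pow_mult)
  also have "\<dots> = val u \<otimes> val w"
    unfolding monom_val_def using H_sub by (intro A.finprod_multf) auto
  finally show ?thesis .
qed

abbreviation coeffs where "coeffs \<equiv> finite_coeffs R S"
abbreviation pcoeffs where "pcoeffs \<equiv> finite_coeffs R (exponents H)"

lemma fc_closed: "c \<in> finite_coeffs R T \<Longrightarrow> c m \<in> carrier R"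
  using finite_coeffsD(1,2)[of c R T m] by (cases "m \<in> T") auto

lemma coeffs_sub: "c \<in> coeffs \<Longrightarrow> c \<in> pcoeffs"
  using finite_coeffsD(2,3)[of c R S] by (intro finite_coeffsI) (auto simp: fc_closed)

lemma pcoeffs_closed [simp]: "c \<in> pcoeffs \<Longrightarrow> c m \<in> carrier R"
  by (erule fc_closed)

lemmas pcoeffs_finite = finite_coeffsD(3)
lemmas pcoeffs_outside = finite_coeffsD(2)

lemma coeffs_closed [simp]: "c \<in> coeffs \<Longrightarrow> c m \<in> carrier R"
  by (erule fc_closed)

lemma lc_superset:
  assumes "c \<in> pcoeffs" "finite T" "{m. c m \<noteq> \<zero>\<^bsub>R\<^esub>} \<subseteq> T"
  shows "lc c = (\<Oplus>m\<in>T. c m \<odot> val m)"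
  unfolding lin_comb_def
  by (rule A.add.finprod_mono_neutral_cong_left) (use assms in auto)

lemma lc_closed [simp, intro]: "c \<in> pcoeffs \<Longrightarrow> lc c \<in> carrier A"
  unfolding lin_comb_def by (intro A.finsum_closed) auto

lemma lc_add:
  assumes "c \<in> pcoeffs" "d \<in> pcoeffs"
  shows "lc (\<lambda>m. c m \<oplus>\<^bsub>R\<^esub> d m) = lc c \<oplus> lc d" "(\<lambda>m. c m \<oplus>\<^bsub>R\<^esub> d m) \<in> pcoeffs"
proof -
  let ?T = "{m. c m \<noteq> \<zero>\<^bsub>R\<^esub>} \<union> {m. d m \<noteq> \<zero>\<^bsub>R\<^esub>}"
  have T: "finite ?T" "{m. c m \<oplus>\<^bsub>R\<^esub> d m \<noteq> \<zero>\<^bsub>R\<^esub>} \<subseteq> ?T"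
    using assms(2) pcoeffs_finite assms(1) by auto
  have fin: "finite {m. c m \<oplus>\<^bsub>R\<^esub> d m \<noteq> \<zero>\<^bsub>R\<^esub>}"
    by (rule finite_subset[OF T(2) T(1)])
  have cl: "c m \<oplus>\<^bsub>R\<^esub> d m \<in> carrier R" for m
    using assms by simp
  show cd: "(\<lambda>m. c m \<oplus>\<^bsub>R\<^esub> d m) \<in> pcoeffs"
    using fin cl pcoeffs_outside[OF assms(1)] pcoeffs_outside[OF assms(2)]
    by (intro finite_coeffsI) simp_all
  have "lc (\<lambda>m. c m \<oplus>\<^bsub>R\<^esub> d m) = (\<Oplus>m\<in>?T. (c m \<odot> val m) \<oplus> (d m \<odot> val m))"
    unfolding lc_superset[OF cd T] using assms
    by (intro A.finsum_cong' Pi_I refl) (simp_all add: A.smult_l_distr)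
  also have "\<dots> = (\<Oplus>m\<in>?T. c m \<odot> val m) \<oplus> (\<Oplus>m\<in>?T. d m \<odot> val m)"
    using assms by (intro A.finsum_addf Pi_I) simp_all
  also have "\<dots> = lc c \<oplus> lc d"
    using lc_superset[OF assms(1) T(1)] lc_superset[OF assms(2) T(1)] by simp
  finally show "lc (\<lambda>m. c m \<oplus>\<^bsub>R\<^esub> d m) = lc c \<oplus> lc d" .
qed

lemma lc_smult:
  assumes "c \<in> pcoeffs" "a \<in> carrier R"
  shows "lc (\<lambda>m. a \<otimes>\<^bsub>R\<^esub> c m) = a \<odot> lc c" "(\<lambda>m. a \<otimes>\<^bsub>R\<^esub> c m) \<in> pcoeffs"
proof -
  let ?T = "{m. c m \<noteq> \<zero>\<^bsub>R\<^esub>}"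
  have T: "finite ?T" "{m. a \<otimes>\<^bsub>R\<^esub> c m \<noteq> \<zero>\<^bsub>R\<^esub>} \<subseteq> ?T"
    using assms(2) pcoeffs_finite assms(1) by auto
  have fin: "finite {m. a \<otimes>\<^bsub>R\<^esub> c m \<noteq> \<zero>\<^bsub>R\<^esub>}"
    by (rule finite_subset[OF T(2) T(1)])
  have cl: "a \<otimes>\<^bsub>R\<^esub> c m \<in> carrier R" for m
    using assms by simp
  show cd: "(\<lambda>m. a \<otimes>\<^bsub>R\<^esub> c m) \<in> pcoeffs"
    using fin cl pcoeffs_outside[OF assms(1)] assms(2) by (intro finite_coeffsI) simp_all
  have "lc (\<lambda>m. a \<otimes>\<^bsub>R\<^esub> c m) = (\<Oplus>m\<in>?T. a \<odot> (c m \<odot> val m))"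
    unfolding lc_superset[OF cd T] using assms
    by (intro A.finsum_cong' Pi_I refl) (simp_all add: A.smult_assoc1)
  also have "\<dots> = a \<odot> lc c"
    unfolding lin_comb_def using assms
    by (intro A.finsum_smult_ldistr[symmetric] T(1) Pi_I) simp_all
  finally show "lc (\<lambda>m. a \<otimes>\<^bsub>R\<^esub> c m) = a \<odot> lc c" .
qed

definition single :: "'r \<Rightarrow> ('a \<Rightarrow> nat) \<Rightarrow> ('a \<Rightarrow> nat) \<Rightarrow> 'r"
  where "single a m = (\<lambda>x. if x = m then a else \<zero>\<^bsub>R\<^esub>)"

lemma single_coeffs: "a \<in> carrier R \<Longrightarrow> m \<in> T \<Longrightarrow> single a m \<in> finite_coeffs R T"
  by (rule finite_coeffsI) (auto simp: single_def)

lemma lc_single: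
  assumes "a \<in> carrier R" "m \<in> exponents H"
  shows "lc (single a m) = a \<odot> val m"
proof -
  have "lc (single a m) = (\<Oplus>x\<in>{m}. single a m x \<odot> val x)"
    by (rule lc_superset[OF single_coeffs[OF assms]]) (auto simp: single_def)
  then show ?thesis using assms by (simp add: single_def)
qed

lemma coords_ex1: "f \<in> carrier A \<Longrightarrow> \<exists>!c. c \<in> coeffs \<and> f = lc c"
  using pasl unfolding pseudo_asl_def family_basis_def by blast

lemma co_mem [simp]: "f \<in> carrier A \<Longrightarrow> co f \<in> coeffs"
  and lc_co [simp]: "f \<in> carrier A \<Longrightarrow> lc (co f) = f"
  using theI'[OF coords_ex1, of f] unfolding coords_def by auto

lemma co_lc [simp]: "c \<in> coeffs \<Longrightarrow> co (lc c) = c"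
  using coords_ex1[of "lc c"] co_mem[of "lc c"] lc_co[of "lc c"] coeffs_sub lc_closed by metis

lemma co_closed [simp]: "f \<in> carrier A \<Longrightarrow> co f m \<in> carrier R"
  using coeffs_closed co_mem by blast

lemma co_add:
  assumes "f \<in> carrier A" "g \<in> carrier A"
  shows "co (f \<oplus> g) = (\<lambda>m. co f m \<oplus>\<^bsub>R\<^esub> co g m)"
proof -
  let ?c = "\<lambda>m. co f m \<oplus>\<^bsub>R\<^esub> co g m"
  have "?c \<in> coeffs"
    using lc_add(2)[OF coeffs_sub coeffs_sub, OF co_mem co_mem, OF assms] assms
      finite_coeffsD(2)[OF co_mem] finite_coeffsD(3)
    by (intro finite_coeffsI) simp_all
  then show ?thesis
    using co_lc[of ?c] lc_add(1)[OF coeffs_sub coeffs_sub, OF co_mem co_mem, OF assms] assms by simp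
qed

lemma co_smult:
  assumes "f \<in> carrier A" "a \<in> carrier R"
  shows "co (a \<odot> f) = (\<lambda>m. a \<otimes>\<^bsub>R\<^esub> co f m)"
proof -
  let ?c = "\<lambda>m. a \<otimes>\<^bsub>R\<^esub> co f m"
  have "?c \<in> coeffs"
    using lc_smult(2)[OF coeffs_sub, OF co_mem, OF assms] assms
      finite_coeffsD(2)[OF co_mem] finite_coeffsD(3)
    by (intro finite_coeffsI) simp_all
  then show ?thesis
    using co_lc[of ?c] lc_smult(1)[OF coeffs_sub, OF co_mem, OF assms] assms by simp
qed

lemma co_term: "a \<in> carrier R \<Longrightarrow> m \<in> S \<Longrightarrow> co (a \<odot> val m) = single a m"
  using lc_single[of a m] co_lc[OF single_coeffs, of a m] by auto

lemma co_val: "m \<in> S \<Longrightarrow> co (val m) = single \<one>\<^bsub>R\<^esub> m"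
  using co_term[of "\<one>\<^bsub>R\<^esub>" m] by (simp add: A.smult_one)

lemma co_zero: "co \<zero> = (\<lambda>_. \<zero>\<^bsub>R\<^esub>)"
  using co_smult[of "\<zero>" "\<zero>\<^bsub>R\<^esub>"] by (simp add: A.smult_l_null)

lemma co_eq_iff: "f \<in> carrier A \<Longrightarrow> g \<in> carrier A \<Longrightarrow> co f = co g \<longleftrightarrow> f = g"
  by (metis lc_co)

lemma minus_eq_smult: "f \<in> carrier A \<Longrightarrow> \<ominus> f = (\<ominus>\<^bsub>R\<^esub> \<one>\<^bsub>R\<^esub>) \<odot> f"
  by (simp add: A.smult_l_minus)

lemma co_minus:
  assumes "f \<in> carrier A" "g \<in> carrier A"
  shows "co (f \<ominus> g) = (\<lambda>m. co f m \<ominus>\<^bsub>R\<^esub> co g m)"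
  using assms by (simp add: A.minus_eq minus_eq_smult co_add co_smult R.minus_eq R.l_minus)

lemma occ_sub_S: "f \<in> carrier A \<Longrightarrow> occ f \<subseteq> S"
  and finite_occ: "f \<in> carrier A \<Longrightarrow> finite (occ f)"
  using finite_coeffsD(2,3)[OF co_mem, of f] unfolding occurring_def by blast+

lemma occ_empty_iff: "f \<in> carrier A \<Longrightarrow> occ f = {} \<longleftrightarrow> f = \<zero>"
  using co_eq_iff[of f "\<zero>"] by (auto simp: occurring_def co_zero)

lemma occ_zero: "occ \<zero> = {}"
  by (simp add: occurring_def co_zero)

lemma occ_term: "a \<in> carrier R \<Longrightarrow> a \<noteq> \<zero>\<^bsub>R\<^esub> \<Longrightarrow> m \<in> S \<Longrightarrow> occ (a \<odot> val m) = {m}"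
  by (auto simp: occurring_def co_term single_def)

lemma occ_val: "m \<in> S \<Longrightarrow> occ (val m) = {m}"
  by (auto simp: occurring_def co_val single_def)

lemma occ_add: "f \<in> carrier A \<Longrightarrow> g \<in> carrier A \<Longrightarrow> occ (f \<oplus> g) \<subseteq> occ f \<union> occ g"
  by (auto simp: occurring_def co_add)

lemma occ_minus: "f \<in> carrier A \<Longrightarrow> g \<in> carrier A \<Longrightarrow> occ (f \<ominus> g) \<subseteq> occ f \<union> occ g"
  by (auto simp: occurring_def co_minus R.minus_eq)

lemma occ_smult: "f \<in> carrier A \<Longrightarrow> a \<in> carrier R \<Longrightarrow> occ (a \<odot> f) \<subseteq> occ f"
  by (auto simp: occurring_def co_smult)

lemma val_nonzero: "m \<in> S \<Longrightarrow> val m \<noteq> \<zero>"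
  using occ_val[of m] occ_empty_iff[of "\<zero>"] by auto

lemma term_nonzero: "m \<in> S \<Longrightarrow> a \<in> carrier R \<Longrightarrow> a \<noteq> \<zero>\<^bsub>R\<^esub> \<Longrightarrow> a \<odot> val m \<noteq> \<zero>"
  using occ_term[of a m] occ_empty_iff[of "\<zero>"] by auto

text \<open> The monomials of the terms that are added all occur in \<open>f\<close>, so a bound on the monomials
  of \<open>f\<close> is available throughout the induction. \<close>

lemma elem_induct [consumes 1, case_names zero add_term]:
  assumes f: "f \<in> carrier A"
    and z: "P \<zero>"
    and t: "\<And>a m g. \<lbrakk>m \<in> occ f; a \<in> carrier R; g \<in> carrier A; P g\<rbrakk> \<Longrightarrow> P (a \<odot> val m \<oplus> g)"
  shows "P f"
proof -
  have "finite T \<Longrightarrow> T \<subseteq> occ f \<Longrightarrow> P (\<Oplus>m\<in>T. co f m \<odot> val m)" for T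
  proof (induction T rule: finite_induct)
    case empty then show ?case using z by simp
  next
    case (insert m T)
    then show ?case using f t by (simp add: Pi_def)
  qed
  from this[of "occ f"] show ?thesis
    using lc_co[OF f] finite_occ[OF f] unfolding lin_comb_def occurring_def by auto
qed

lemma smult_assoc_right:
  "a \<in> carrier R \<Longrightarrow> x \<in> carrier A \<Longrightarrow> y \<in> carrier A \<Longrightarrow> x \<otimes> (a \<odot> y) = a \<odot> (x \<otimes> y)"
  using A.smult_assoc2[of a y x] by (simp add: A.m_comm)

lemma ideal_smult:
  assumes "ideal I A" "f \<in> I" "a \<in> carrier R"
  shows "a \<odot> f \<in> I"
proof -
  interpret I: ideal I A by fact
  have "f \<in> carrier A" using assms(2) by auto
  then have "a \<odot> f = (a \<odot> \<one>) \<otimes> f"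
    using assms by (simp add: A.smult_assoc2)
  then show ?thesis using assms I.I_l_closed by simp
qed

end

section \<open>Term orders\<close>

locale leading_pasl = pasl R A H \<Sigma>
  for R :: "'r ring" and A :: "('r, 'a) module" (structure) and H :: "'a set" and \<Sigma> :: "('a \<Rightarrow> nat) set" +
  fixes ord :: "('a \<Rightarrow> nat) rel" and L :: "('r, 'a) module"
  assumes ord: "term_order R A H \<Sigma> ord"
    and L: "leading_term_algebra R A H \<Sigma> ord L"
begin

sublocale L: pasl R L H \<Sigma>
  using L by unfold_locales (simp add: leading_term_algebra_def)

abbreviation lm where "lm \<equiv> LM R A H \<Sigma> ord"
abbreviation lcf where "lcf \<equiv> LC R A H \<Sigma> ord"
abbreviation lt where "lt \<equiv> LT R A H \<Sigma> ord"
abbreviation piL where "piL \<equiv> pi_lt R A H \<Sigma> L"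

lemma lin_ord: "linear_order_on S ord"
  using ord by (simp add: term_order_def Let_def)

lemma ord_props: "refl_on S ord" "trans ord" "antisym ord" "total_on S ord" "ord \<subseteq> S \<times> S"
  using lin_ord unfolding linear_order_on_def partial_order_on_def preorder_on_def by blast+

lemma ord_S: "(m, m') \<in> ord \<Longrightarrow> m \<in> S \<and> m' \<in> S"
  using ord_props(5) by auto

lemma ord_refl: "m \<in> S \<Longrightarrow> (m, m) \<in> ord"
  by (rule refl_onD[OF ord_props(1)])

lemma ord_antisym: "(m, m') \<in> ord \<Longrightarrow> (m', m) \<in> ord \<Longrightarrow> m = m'"
  by (rule antisymD[OF ord_props(3)])

lemma ord_trans: "(m, m') \<in> ord \<Longrightarrow> (m', m'') \<in> ord \<Longrightarrow> (m, m'') \<in> ord"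
  by (rule transD[OF ord_props(2)])

lemma ord_total: "m \<in> S \<Longrightarrow> m' \<in> S \<Longrightarrow> (m, m') \<in> ord \<or> (m', m) \<in> ord"
  using ord_refl[of m] ord_props(4) unfolding total_on_def by (cases "m = m'") metis+

lemma ord_zero: "m \<in> S \<Longrightarrow> ((\<lambda>_. 0), m) \<in> ord"
  using ord unfolding term_order_def Let_def by blast

lemma ord_mult:
  assumes "(f, g) \<in> ord" "f \<noteq> g" "(h, k) \<in> ord"
    "val f \<otimes> val h \<noteq> \<zero>" "val g \<otimes> val k \<noteq> \<zero>"
  shows "(lm (val f \<otimes> val h), lm (val g \<otimes> val k)) \<in> ord"
    "lm (val f \<otimes> val h) \<noteq> lm (val g \<otimes> val k)"
proof -
  have mem: "f \<in> S" "g \<in> S" "h \<in> S" "k \<in> S" using assms ord_S by blast+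
  note mono = conjunct2[OF conjunct2[OF ord[unfolded term_order_def Let_def]]]
  from mono[rule_format, OF mem] assms
  show "(lm (val f \<otimes> val h), lm (val g \<otimes> val k)) \<in> ord"
    "lm (val f \<otimes> val h) \<noteq> lm (val g \<otimes> val k)" by simp_all
qed

lemma finite_has_max:
  "finite T \<Longrightarrow> T \<noteq> {} \<Longrightarrow> T \<subseteq> S \<Longrightarrow> \<exists>m\<in>T. \<forall>m'\<in>T. (m', m) \<in> ord"
proof (induction T rule: finite_ne_induct)
  case (singleton x)
  then show ?case using ord_refl by blast
next
  case (insert x F)
  then obtain m where m: "m \<in> F" "\<forall>m'\<in>F. (m', m) \<in> ord" by auto
  then show ?case using ord_total[of x m] ord_trans ord_refl insert.prems by blast
qed

lemma lm_eqI:
  assumes "m \<in> occ f" "\<And>m'. m' \<in> occ f \<Longrightarrow> (m', m) \<in> ord"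
  shows "lm f = m"
  unfolding LM_def using assms ord_antisym by (intro the_equality) blast+

lemma
  assumes "f \<in> carrier A" "f \<noteq> \<zero>"
  shows lm_occ: "lm f \<in> occ f" and lm_max: "m \<in> occ f \<Longrightarrow> (m, lm f) \<in> ord" and lm_S: "lm f \<in> S"
proof -
  obtain x where x: "x \<in> occ f" "\<And>m'. m' \<in> occ f \<Longrightarrow> (m', x) \<in> ord"
    using finite_has_max[OF finite_occ _ occ_sub_S] occ_empty_iff assms by meson
  with lm_eqI[OF x] show "lm f \<in> occ f" "m \<in> occ f \<Longrightarrow> (m, lm f) \<in> ord" by auto
  then show "lm f \<in> S" using occ_sub_S assms by blast
qed

lemma
  assumes "f \<in> carrier A" "f \<noteq> \<zero>"
  shows lcf_nonzero: "lcf f \<noteq> \<zero>\<^bsub>R\<^esub>" and lcf_closed: "lcf f \<in> carrier R" and lcf_co: "lcf f = co f (lm f)"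
  using lm_occ[OF assms] assms by (auto simp: LC_def occurring_def)

lemma lm_val: "m \<in> S \<Longrightarrow> lm (val m) = m"
  by (rule lm_eqI) (auto simp: occ_val ord_refl)

text \<open> The quotient of \<open>w\<close> by \<open>u\<close> is standard and at least \<open>1\<close>, and multiplying \<open>1\<close> and this quotient by \<open>u\<close>
  preserves the order since both products are nonzero. \<close>

lemma le_imp_ord:
  assumes "w \<in> S" "u \<le> w"
  shows "(u, w) \<in> ord"
proof (cases "u = w")
  case True then show ?thesis using assms ord_refl by simp
next
  case False
  define x where "x = (\<lambda>y. w y - u y)"
  have w: "exp_add u x = w" unfolding x_def by (rule exp_add_diff[OF assms(2)])
  have u: "u \<in> S" by (rule S_le[OF assms])
  have x: "x \<in> S"
    using S_down(2)[of u x] w u assms unfolding x_def by (metis DiffD1 exp_diff_mem)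
  have ne: "(\<lambda>_. 0) \<noteq> x" using w False by (auto simp: exp_add_zero)
  have v: "val x \<otimes> val u = val w" using w val_add[of x u] exp_add_commute[of u x] by simp
  have "(lm (val (\<lambda>_. 0) \<otimes> val u), lm (val x \<otimes> val u)) \<in> ord"
    by (rule ord_mult(1)[OF ord_zero[OF x] ne ord_refl[OF u]])
      (use v val_nonzero assms(1) u in auto)
  then show ?thesis using v lm_val u assms(1) by simp
qed

text \<open> Dickson's lemma finds two members of a descending chain that are pointwise increasing. \<close>

lemma wf_ord: "wf (ord - Id)"
  unfolding wf_iff_no_infinite_down_chain
proof
  assume "\<exists>f. \<forall>i. (f (Suc i), f i) \<in> ord - Id"
  then obtain f where f: "\<And>i. (f (Suc i), f i) \<in> ord - Id" by blast
  have S: "f i \<in> S" for i using f ord_S by blast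
  have step: "(f (j + Suc i), f j) \<in> ord" for i j
  proof (induction i)
    case 0 then show ?case using f[of j] by simp
  next
    case (Suc i) then show ?case using f[of "j + Suc i"] ord_trans by auto
  qed
  obtain i j where ij: "i < j" "f i \<le> f j"
    using dickson[OF finite_H, of f] S by blast
  have le: "(f i, f j) \<in> ord" using le_imp_ord[OF S ij(2)] .
  have "(f j, f (Suc i)) \<in> ord"
  proof (cases "j = Suc i")
    case True then show ?thesis using ord_refl S by simp
  next
    case False
    then have "Suc i + Suc (j - Suc (Suc i)) = j" using ij(1) by simp
    then show ?thesis using step[of "Suc i" "j - Suc (Suc i)"] by metis
  qed
  then have "(f i, f (Suc i)) \<in> ord" using le ord_trans by blast
  then show False using f[of i] ord_antisym by blast
qed

lemma ord_induct [consumes 1, case_names less]: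
  assumes "m \<in> S" "\<And>m. m \<in> S \<Longrightarrow> (\<And>m'. (m', m) \<in> ord \<Longrightarrow> m' \<noteq> m \<Longrightarrow> P m') \<Longrightarrow> P m"
  shows "P m"
  using wf_ord assms(1)
proof (induction m rule: wf_induct_rule)
  case (less m)
  then show ?case using assms(2)[of m] ord_S by blast
qed

section \<open>Products of leading terms\<close>

lemma pi_term: "m \<in> S \<Longrightarrow> a \<in> carrier R \<Longrightarrow> piL (a \<odot> val m) = a \<odot>\<^bsub>L\<^esub> L.val m"
  by (simp add: pi_lt_def co_term L.lc_single)

lemma pi_val: "m \<in> S \<Longrightarrow> piL (val m) = L.val m"
  using pi_term[of m "\<one>\<^bsub>R\<^esub>"] by simp

lemma pi_zero: "piL \<zero> = \<zero>\<^bsub>L\<^esub>"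
  by (simp add: pi_lt_def co_zero lin_comb_def)

lemma pi_lt: "f \<in> carrier A \<Longrightarrow> f \<noteq> \<zero> \<Longrightarrow> piL (lt f) = lcf f \<odot>\<^bsub>L\<^esub> L.val (lm f)"
  unfolding LT_def using pi_term[OF lm_S lcf_closed, of f f] by simp

lemma L_mult:
  assumes "m \<in> S" "k \<in> S" "L.val m \<otimes>\<^bsub>L\<^esub> L.val k \<noteq> \<zero>\<^bsub>L\<^esub>"
  shows "val m \<otimes> val k \<noteq> \<zero>"
    "L.val m \<otimes>\<^bsub>L\<^esub> L.val k =
      lcf (val m \<otimes> val k) \<odot>\<^bsub>L\<^esub> L.val (lm (val m \<otimes> val k))"
proof -
  have *: "L.val m \<otimes>\<^bsub>L\<^esub> L.val k = piL (lt (val m \<otimes> val k))"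
    using L assms pi_val unfolding leading_term_algebra_def Let_def by metis
  then show nz: "val m \<otimes> val k \<noteq> \<zero>"
    using assms(3) pi_zero by (auto simp: LT_def)
  show "L.val m \<otimes>\<^bsub>L\<^esub> L.val k =
      lcf (val m \<otimes> val k) \<odot>\<^bsub>L\<^esub> L.val (lm (val m \<otimes> val k))"
    unfolding * using nz by (intro pi_lt) auto
qed

text \<open> A product with a single monomial has no monomials other than those that come from the
  monomials of the other factor one at a time. \<close>

lemma occ_L_mult:
  assumes "f \<in> carrier L" "m \<in> S" "m' \<in> L.occ (L.val m \<otimes>\<^bsub>L\<^esub> f)"
  shows "\<exists>k\<in>L.occ f. L.val m \<otimes>\<^bsub>L\<^esub> L.val k \<noteq> \<zero>\<^bsub>L\<^esub> \<and> lm (val m \<otimes> val k) = m'"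
proof -
  define T where "T = L.occ f"
  have "m' \<in> L.occ (L.val m \<otimes>\<^bsub>L\<^esub> f) \<longrightarrow>
      (\<exists>k\<in>T. L.val m \<otimes>\<^bsub>L\<^esub> L.val k \<noteq> \<zero>\<^bsub>L\<^esub> \<and> lm (val m \<otimes> val k) = m')"
    using assms(1)
  proof (induction rule: L.elem_induct)
    case zero
    then show ?case by (simp add: occurring_def L.co_zero)
  next
    case (add_term a k g)
    have kT: "k \<in> T" using add_term(1) by (simp add: T_def)
    have k: "k \<in> S" using add_term(1) L.occ_sub_S assms(1) by blast
    have "L.val m \<otimes>\<^bsub>L\<^esub> (a \<odot>\<^bsub>L\<^esub> L.val k \<oplus>\<^bsub>L\<^esub> g) =
        a \<odot>\<^bsub>L\<^esub> (L.val m \<otimes>\<^bsub>L\<^esub> L.val k) \<oplus>\<^bsub>L\<^esub> L.val m \<otimes>\<^bsub>L\<^esub> g" (is "_ = ?t \<oplus>\<^bsub>L\<^esub> _")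
      using add_term by (simp add: L.A.r_distr L.smult_assoc_right)
    then have "L.occ (L.val m \<otimes>\<^bsub>L\<^esub> (a \<odot>\<^bsub>L\<^esub> L.val k \<oplus>\<^bsub>L\<^esub> g)) \<subseteq>
        L.occ (L.val m \<otimes>\<^bsub>L\<^esub> L.val k) \<union> L.occ (L.val m \<otimes>\<^bsub>L\<^esub> g)"
      using L.occ_add[of ?t "L.val m \<otimes>\<^bsub>L\<^esub> g"] L.occ_smult[of "L.val m \<otimes>\<^bsub>L\<^esub> L.val k" a] add_term
      by auto
    note sub = this
    have lead: "L.val m \<otimes>\<^bsub>L\<^esub> L.val k \<noteq> \<zero>\<^bsub>L\<^esub> \<and> lm (val m \<otimes> val k) = m'"
      if "m' \<in> L.occ (L.val m \<otimes>\<^bsub>L\<^esub> L.val k)"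
    proof -
      have nz: "L.val m \<otimes>\<^bsub>L\<^esub> L.val k \<noteq> \<zero>\<^bsub>L\<^esub>"
        using that L.occ_empty_iff[of "\<zero>\<^bsub>L\<^esub>"] by auto
      note p = L_mult[OF assms(2) k nz]
      have c: "lm (val m \<otimes> val k) \<in> S" "lcf (val m \<otimes> val k) \<in> carrier R"
        "lcf (val m \<otimes> val k) \<noteq> \<zero>\<^bsub>R\<^esub>"
        using p(1) lm_S lcf_closed lcf_nonzero by auto
      show ?thesis
        using that nz unfolding p(2) L.occ_term[OF c(2,3,1)] by simp
    qed
    show ?case
    proof
      assume "m' \<in> L.occ (L.val m \<otimes>\<^bsub>L\<^esub> (a \<odot>\<^bsub>L\<^esub> L.val k \<oplus>\<^bsub>L\<^esub> g))"
      with sub have "m' \<in> L.occ (L.val m \<otimes>\<^bsub>L\<^esub> L.val k) \<or> m' \<in> L.occ (L.val m \<otimes>\<^bsub>L\<^esub> g)"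
        by blast
      then show "\<exists>k\<in>T. L.val m \<otimes>\<^bsub>L\<^esub> L.val k \<noteq> \<zero>\<^bsub>L\<^esub> \<and> lm (val m \<otimes> val k) = m'"
        using lead kT add_term(4) by (elim disjE) (rule bexI[of _ k], simp_all)
    qed
  qed
  then show ?thesis using assms by (simp add: T_def)
qed

section \<open>Divisibility of standard monomials\<close>

abbreviation dv where "dv m m' \<equiv> L.val m divides\<^bsub>L\<^esub> L.val m'"

text \<open> A quotient of \<open>m'\<close> by \<open>m\<close> in \<open>L\<close> need not be a term, but one of its monomials alone already
  yields \<open>m'\<close> up to a scalar. \<close>

lemma dvE:
  assumes "m \<in> S" "m' \<in> S" "dv m m'"
  obtains k where "k \<in> S" "val m \<otimes> val k \<noteq> \<zero>" "lm (val m \<otimes> val k) = m'"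
    "lcf (val m \<otimes> val k) \<noteq> \<zero>\<^bsub>R\<^esub>" "lcf (val m \<otimes> val k) \<in> carrier R"
    "L.val m \<otimes>\<^bsub>L\<^esub> L.val k = lcf (val m \<otimes> val k) \<odot>\<^bsub>L\<^esub> L.val m'"
    "L.val m \<otimes>\<^bsub>L\<^esub> L.val k \<noteq> \<zero>\<^bsub>L\<^esub>"
proof -
  obtain f where f: "f \<in> carrier L" "L.val m' = L.val m \<otimes>\<^bsub>L\<^esub> f"
    using assms(3) unfolding factor_def by blast
  have "m' \<in> L.occ (L.val m \<otimes>\<^bsub>L\<^esub> f)"
    using L.occ_val[OF assms(2)] f(2) by simp
  from occ_L_mult[OF f(1) assms(1) this] obtain k where
    k: "k \<in> L.occ f" "L.val m \<otimes>\<^bsub>L\<^esub> L.val k \<noteq> \<zero>\<^bsub>L\<^esub>" "lm (val m \<otimes> val k) = m'"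
    by blast
  have kS: "k \<in> S" using k(1) L.occ_sub_S f(1) by blast
  note p = L_mult[OF assms(1) kS k(2)]
  show ?thesis
    by (rule that[OF kS p(1) k(3)]) (use p k lcf_nonzero lcf_closed in auto)
qed

lemma dv_refl: "dv m m"
  by (rule L.A.divides_refl) simp

lemma dv_trans: "dv m m' \<Longrightarrow> dv m' m'' \<Longrightarrow> dv m m''"
  by (rule L.A.divides_trans) simp_all

lemma dvI:
  assumes "f \<in> carrier L" "c \<in> carrier R" "c \<noteq> \<zero>\<^bsub>R\<^esub>" "L.val m \<otimes>\<^bsub>L\<^esub> f = c \<odot>\<^bsub>L\<^esub> L.val m'"
  shows "dv m m'"
proof -
  have i: "inv\<^bsub>R\<^esub> c \<in> carrier R" "inv\<^bsub>R\<^esub> c \<otimes>\<^bsub>R\<^esub> c = \<one>\<^bsub>R\<^esub>"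
    using assms R.field_Units by auto
  have "L.val m \<otimes>\<^bsub>L\<^esub> (inv\<^bsub>R\<^esub> c \<odot>\<^bsub>L\<^esub> f) = inv\<^bsub>R\<^esub> c \<odot>\<^bsub>L\<^esub> (c \<odot>\<^bsub>L\<^esub> L.val m')"
    using assms i by (simp add: L.smult_assoc_right)
  also have "\<dots> = L.val m'"
    using i assms by (simp flip: L.A.smult_assoc1)
  finally show ?thesis
    using assms(1) i by (intro dividesI[of "inv\<^bsub>R\<^esub> c \<odot>\<^bsub>L\<^esub> f"]) auto
qed

text \<open> The cofactor is \<open>1\<close> or larger than \<open>1\<close>, so multiplying by it cannot decrease \<open>m\<close>. \<close>

lemma dv_ord:
  assumes "m \<in> S" "m' \<in> S" "dv m m'"
  shows "(m, m') \<in> ord"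
proof -
  obtain k where k: "k \<in> S" "val m \<otimes> val k \<noteq> \<zero>" "lm (val m \<otimes> val k) = m'"
    using dvE[OF assms] by metis
  show ?thesis
  proof (cases "k = (\<lambda>_. 0)")
    case True
    then show ?thesis using k lm_val assms(1) ord_refl by simp
  next
    case False
    have "(lm (val (\<lambda>_. 0) \<otimes> val m), lm (val k \<otimes> val m)) \<in> ord"
      by (rule ord_mult(1)[OF ord_zero[OF k(1)] False[symmetric] ord_refl[OF assms(1)]])
        (use k val_nonzero assms(1) in \<open>auto simp: A.m_comm\<close>)
    then show ?thesis using k lm_val assms(1) by (simp add: A.m_comm)
  qed
qed

lemma dv_mult:
  assumes "m \<in> S" "k \<in> S" "dv m m'" "m' \<in> S" "L.val k \<otimes>\<^bsub>L\<^esub> L.val m' \<noteq> \<zero>\<^bsub>L\<^esub>"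
  shows "dv m (lm (val k \<otimes> val m'))"
proof -
  note p = L_mult[OF assms(2,4,5)]
  have "dv m' (lm (val k \<otimes> val m'))"
    by (rule dvI[of "L.val k" "lcf (val k \<otimes> val m')"])
      (use p lcf_nonzero lcf_closed in \<open>auto simp: L.A.m_comm\<close>)
  with assms(3) show ?thesis by (rule dv_trans)
qed

section \<open>Leading monomials of products\<close>

text \<open> The zero element is below every monomial, so elements below \<open>m\<close> form a submodule. \<close>

definition below where
  "below f m \<longleftrightarrow> f \<in> carrier A \<and> (\<forall>m'\<in>occ f. (m', m) \<in> ord \<and> m' \<noteq> m)"

lemma below_add: "below f m \<Longrightarrow> below g m \<Longrightarrow> below (f \<oplus> g) m"
  using occ_add[of f g] unfolding below_def by auto

lemma below_smult: "below f m \<Longrightarrow> a \<in> carrier R \<Longrightarrow> below (a \<odot> f) m"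
  using occ_smult[of f a] unfolding below_def by auto

lemma below_zero: "below \<zero> m"
  by (simp add: below_def occ_zero)

lemma below_lm: "below f m \<Longrightarrow> f \<noteq> \<zero> \<Longrightarrow> (lm f, m) \<in> ord \<and> lm f \<noteq> m"
  using lm_occ[of f] unfolding below_def by blast

lemma lm_belowI:
  assumes "m \<in> S" "c \<in> carrier R" "c \<noteq> \<zero>\<^bsub>R\<^esub>" "below r m"
  shows "lm (c \<odot> val m \<oplus> r) = m" "lcf (c \<odot> val m \<oplus> r) = c"
    "c \<odot> val m \<oplus> r \<noteq> \<zero>"
proof -
  let ?f = "c \<odot> val m \<oplus> r"
  have r: "r \<in> carrier A" "co r m = \<zero>\<^bsub>R\<^esub>"
    using assms(4) unfolding below_def occurring_def by auto
  have com: "co ?f m = c"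
    using assms r by (simp add: co_add co_term single_def)
  show l: "lm ?f = m"
  proof (rule lm_eqI)
    show "m \<in> occ ?f" using com assms(3) by (simp add: occurring_def)
    show "(m', m) \<in> ord" if "m' \<in> occ ?f" for m'
      using that occ_add[of "c \<odot> val m" r] r assms occ_term[of c m] ord_refl[of m]
      unfolding below_def by auto
  qed
  show nz: "?f \<noteq> \<zero>" using com assms(3) by (auto simp: co_zero)
  then show "lcf ?f = c" using com l by (simp add: LC_def)
qed

lemma below_tail:
  assumes "f \<in> carrier A" "f \<noteq> \<zero>" "g \<in> carrier A" "g \<noteq> \<zero>" "lm g = lm f" "c \<in> carrier R"
    "c \<otimes>\<^bsub>R\<^esub> lcf g = lcf f"
  shows "below (f \<ominus> c \<odot> g) (lm f)"
  unfolding below_def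
proof (intro conjI ballI)
  show "f \<ominus> c \<odot> g \<in> carrier A" using assms by simp
  fix m assume m: "m \<in> occ (f \<ominus> c \<odot> g)"
  have "m \<in> occ f \<or> m \<in> occ g"
    using m occ_minus[of f "c \<odot> g"] occ_smult[of g c] assms by auto
  then show "(m, lm f) \<in> ord"
    using lm_max assms by metis
  have "co (f \<ominus> c \<odot> g) (lm f) = lcf f \<ominus>\<^bsub>R\<^esub> c \<otimes>\<^bsub>R\<^esub> lcf g"
    using assms by (simp add: co_minus co_smult lcf_co)
  then show "m \<noteq> lm f"
    using m assms lcf_closed[of f] by (auto simp: occurring_def R.r_neg R.minus_eq)
qed

lemma tail_decomp:
  assumes "f \<in> carrier A" "f \<noteq> \<zero>"
  obtains r where "below r (lm f)" "f = lcf f \<odot> val (lm f) \<oplus> r"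
proof
  note l = lm_S[OF assms] lcf_closed[OF assms]
  show "below (f \<ominus> lcf f \<odot> val (lm f)) (lm f)"
  proof (rule below_tail[OF assms])
    show "lcf f \<otimes>\<^bsub>R\<^esub> lcf (val (lm f)) = lcf f"
      using l by (simp add: LC_def val_nonzero lm_val co_val single_def)
  qed (use l in \<open>auto simp: val_nonzero lm_val\<close>)
  show "f = lcf f \<odot> val (lm f) \<oplus> (f \<ominus> lcf f \<odot> val (lm f))"
    using l assms by (simp add: A.minus_eq A.a_lcomm[of _ f] A.r_neg)
qed

text \<open> Each monomial \<open>x\<close> of \<open>r\<close> is smaller than \<open>m\<close>, so \<open>k x\<close> either vanishes or has a smaller leading
  monomial than \<open>k m\<close>. \<close>

lemma below_mult:
  assumes k: "k \<in> S" and m: "m \<in> S" and nz: "val k \<otimes> val m \<noteq> \<zero>" and r: "below r m"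
  shows "below (val k \<otimes> r) (lm (val k \<otimes> val m))"
proof -
  have "r \<in> carrier A" using r by (simp add: below_def)
  then show ?thesis
  proof (induction rule: elem_induct)
    case zero
    then show ?case by (simp add: below_zero)
  next
    case (add_term a x g)
    have x: "(x, m) \<in> ord" "x \<noteq> m" using add_term(1) r by (auto simp: below_def)
    have eq: "val k \<otimes> (a \<odot> val x \<oplus> g) = a \<odot> (val k \<otimes> val x) \<oplus> val k \<otimes> g"
      using add_term by (simp add: A.r_distr smult_assoc_right)
    have "below (val k \<otimes> val x) (lm (val k \<otimes> val m))"
    proof (cases "val k \<otimes> val x = \<zero>")
      case True
      then show ?thesis by (simp add: below_zero)
    next
      case False
      have c: "val x \<otimes> val k = val k \<otimes> val x" "val m \<otimes> val k = val k \<otimes> val m"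
        by (simp_all add: A.m_comm)
      have lt: "(lm (val k \<otimes> val x), lm (val k \<otimes> val m)) \<in> ord"
        "lm (val k \<otimes> val x) \<noteq> lm (val k \<otimes> val m)"
        using ord_mult[OF x ord_refl[OF k]] False nz unfolding c by blast+
      show ?thesis unfolding below_def
        using lm_max[OF _ False] lt ord_trans ord_antisym by (auto; metis)
    qed
    then show ?case unfolding eq using add_term by (intro below_add below_smult)
  qed
qed

text \<open> The leading term of \<open>k (lm f)\<close> cannot be cancelled: everything else in \<open>k f\<close> is below it. \<close>

lemma lm_mult:
  assumes f: "f \<in> carrier A" "f \<noteq> \<zero>" and k: "k \<in> S" and nz: "val k \<otimes> val (lm f) \<noteq> \<zero>"
  shows "val k \<otimes> f \<noteq> \<zero>" "lm (val k \<otimes> f) = lm (val k \<otimes> val (lm f))"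
proof -
  let ?p = "val k \<otimes> val (lm f)"
  note l = lm_S[OF f] lcf_closed[OF f] lcf_nonzero[OF f]
  obtain r where r: "below r (lm f)" "f = lcf f \<odot> val (lm f) \<oplus> r"
    using tail_decomp[OF f] by blast
  have rc: "r \<in> carrier A" using r(1) by (simp add: below_def)
  have pc: "?p \<in> carrier A" by simp
  note lp = lm_S[OF pc nz] lcf_closed[OF pc nz] lcf_nonzero[OF pc nz]
  obtain q where q: "below q (lm ?p)" "?p = lcf ?p \<odot> val (lm ?p) \<oplus> q"
    using tail_decomp[OF pc nz] by blast
  have qc: "q \<in> carrier A" using q(1) by (simp add: below_def)
  let ?r = "lcf f \<odot> q \<oplus> val k \<otimes> r"
  have "val k \<otimes> f = lcf f \<odot> ?p \<oplus> val k \<otimes> r"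
    by (subst r(2)) (use l rc in \<open>simp add: A.r_distr smult_assoc_right\<close>)
  also have "\<dots> = lcf f \<odot> (lcf ?p \<odot> val (lm ?p) \<oplus> q) \<oplus> val k \<otimes> r"
    using q(2) by simp
  also have "\<dots> = (lcf f \<otimes>\<^bsub>R\<^esub> lcf ?p) \<odot> val (lm ?p) \<oplus> ?r"
    using l lp qc rc by (simp add: A.smult_r_distr A.smult_assoc1 A.a_assoc)
  finally have eq: "val k \<otimes> f = (lcf f \<otimes>\<^bsub>R\<^esub> lcf ?p) \<odot> val (lm ?p) \<oplus> ?r" .
  have b: "below ?r (lm ?p)"
    using l by (intro below_add below_smult q(1) below_mult[OF k _ nz r(1)])
  have c: "lcf f \<otimes>\<^bsub>R\<^esub> lcf ?p \<in> carrier R" "lcf f \<otimes>\<^bsub>R\<^esub> lcf ?p \<noteq> \<zero>\<^bsub>R\<^esub>"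
    using l lp R.integral by auto
  show "val k \<otimes> f \<noteq> \<zero>" "lm (val k \<otimes> f) = lm ?p"
    unfolding eq using lm_belowI[OF lp(1) c b] by blast+
qed

section \<open>Ideals of leading terms\<close>

definition lms where "lms I = {lm f |f. f \<in> I \<and> f \<noteq> \<zero>}"

lemma lmsI: "f \<in> I \<Longrightarrow> f \<noteq> \<zero> \<Longrightarrow> lm f \<in> lms I"
  unfolding lms_def by blast

lemma lms_S: "I \<subseteq> carrier A \<Longrightarrow> lms I \<subseteq> S"
  unfolding lms_def using lm_S by blast

lemma ideal_sub: "ideal I A \<Longrightarrow> I \<subseteq> carrier A"
  using additive_subgroup.a_subset ideal.axioms(1) by blast

lemma lms_dv:
  assumes I: "ideal I A" and m: "m \<in> lms I" "m' \<in> S" "dv m m'"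
  shows "m' \<in> lms I"
proof -
  interpret I: ideal I A by (rule I)
  obtain f where f: "f \<in> I" "f \<noteq> \<zero>" "lm f = m" using m(1) by (auto simp: lms_def)
  have fc: "f \<in> carrier A" using f(1) ideal_sub[OF I] by blast
  have mS: "m \<in> S" using lm_S[OF fc f(2)] f(3) by simp
  obtain k where k: "k \<in> S" "val m \<otimes> val k \<noteq> \<zero>" "lm (val m \<otimes> val k) = m'"
    using dvE[OF mS m(2,3)] by metis
  have c: "val k \<otimes> val m = val m \<otimes> val k" by (simp add: A.m_comm)
  have "val k \<otimes> f \<noteq> \<zero>" "lm (val k \<otimes> f) = m'"
    using lm_mult[OF fc f(2) k(1)] k f(3) c by auto
  then show ?thesis using lmsI[of "val k \<otimes> f" I] I.I_l_closed[OF f(1)] by auto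
qed

text \<open> The elements of \<open>L\<close> all of whose monomials are divisible by some leading monomial of \<open>F\<close> form an
  ideal that contains the leading terms of \<open>F\<close>. \<close>

lemma leading_terms_occ:
  assumes F: "F \<subseteq> carrier A" and x: "x \<in> Idl\<^bsub>L\<^esub> ((\<lambda>f. piL (lt f)) ` F)" and m: "m \<in> L.occ x"
  shows "\<exists>f\<in>F. f \<noteq> \<zero> \<and> dv (lm f) m"
proof -
  define D where "D = {m. \<exists>f\<in>F. f \<noteq> \<zero> \<and> dv (lm f) m}"
  define J where "J = {x \<in> carrier L. L.occ x \<subseteq> D}"
  have Jc: "x \<in> carrier L" if "x \<in> J" for x using that by (simp add: J_def)
  have Jadd: "x \<oplus>\<^bsub>L\<^esub> y \<in> J" if "x \<in> J" "y \<in> J" for x y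
    using that L.occ_add[of x y] by (auto simp: J_def)
  have Jsmult: "a \<odot>\<^bsub>L\<^esub> x \<in> J" if "x \<in> J" "a \<in> carrier R" for x a
    using that L.occ_smult[of x a] by (auto simp: J_def)
  have J0: "\<zero>\<^bsub>L\<^esub> \<in> J" by (simp add: J_def L.occ_zero)
  have Jmono: "L.val k \<otimes>\<^bsub>L\<^esub> y \<in> J" if y: "y \<in> J" and k: "k \<in> S" for k y
  proof -
    have "m' \<in> D" if m': "m' \<in> L.occ (L.val k \<otimes>\<^bsub>L\<^esub> y)" for m'
    proof -
      obtain k' where k': "k' \<in> L.occ y" "L.val k \<otimes>\<^bsub>L\<^esub> L.val k' \<noteq> \<zero>\<^bsub>L\<^esub>" "lm (val k \<otimes> val k') = m'"
        using occ_L_mult[OF Jc[OF y] k m'] by blast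
      have k'S: "k' \<in> S" using k'(1) L.occ_sub_S Jc[OF y] by blast
      obtain f where f: "f \<in> F" "f \<noteq> \<zero>" "dv (lm f) k'"
        using y k'(1) by (auto simp: J_def D_def)
      have "dv (lm f) m'"
        using dv_mult[OF lm_S k f(3) k'S k'(2)] f k'(3) F by auto
      then show ?thesis using f by (auto simp: D_def)
    qed
    then show ?thesis using Jc[OF y] by (auto simp: J_def)
  qed
  have Jmult: "z \<otimes>\<^bsub>L\<^esub> y \<in> J" if y: "y \<in> J" and z: "z \<in> carrier L" for z y
  proof -
    define T where "T = L.occ z"
    have TS: "T \<subseteq> S" using L.occ_sub_S z by (simp add: T_def)
    from z show ?thesis
    proof (induction rule: L.elem_induct)
      case zero
      then show ?case using J0 Jc[OF y] by simp
    next
      case (add_term a k g)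
      have k: "k \<in> S" using add_term(1) TS by (auto simp: T_def)
      have "(a \<odot>\<^bsub>L\<^esub> L.val k \<oplus>\<^bsub>L\<^esub> g) \<otimes>\<^bsub>L\<^esub> y = a \<odot>\<^bsub>L\<^esub> (L.val k \<otimes>\<^bsub>L\<^esub> y) \<oplus>\<^bsub>L\<^esub> g \<otimes>\<^bsub>L\<^esub> y"
        using add_term Jc[OF y] by (simp add: L.A.l_distr L.A.smult_assoc2)
      then show ?case using add_term Jadd Jsmult Jmono[OF y k] by simp
    qed
  qed
  have Jinv: "\<ominus>\<^bsub>L\<^esub> x \<in> J" if "x \<in> J" for x
    using that Jsmult[of x "\<ominus>\<^bsub>R\<^esub> \<one>\<^bsub>R\<^esub>"] L.minus_eq_smult[OF Jc[OF that]] by simp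
  have "ideal J L"
  proof (rule idealI)
    show "ring L" by (rule L.A.ring_axioms)
    show "subgroup J (add_monoid L)"
      by (rule L.A.add.subgroupI) (use Jc J0 Jadd Jinv in \<open>auto simp: a_inv_def\<close>)
    show "z \<otimes>\<^bsub>L\<^esub> y \<in> J" "y \<otimes>\<^bsub>L\<^esub> z \<in> J" if "y \<in> J" "z \<in> carrier L" for y z
      using Jmult[OF that] L.A.m_comm[of y z] Jc that by auto
  qed
  moreover have "(\<lambda>f. piL (lt f)) ` F \<subseteq> J"
  proof
    fix x assume "x \<in> (\<lambda>f. piL (lt f)) ` F"
    then obtain f where f: "f \<in> F" "x = piL (lt f)" by blast
    show "x \<in> J"
    proof (cases "f = \<zero>")
      case True
      then show ?thesis using f J0 by (simp add: LT_def pi_zero)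
    next
      case False
      have fc: "f \<in> carrier A" using f F by blast
      have "lm f \<in> D" using f(1) False dv_refl by (auto simp: D_def)
      then have "L.val (lm f) \<in> J" using L.occ_val[OF lm_S[OF fc False]] by (simp add: J_def)
      then show ?thesis using f pi_lt[OF fc False] Jsmult lcf_closed[OF fc False] by simp
    qed
  qed
  ultimately have "Idl\<^bsub>L\<^esub> ((\<lambda>f. piL (lt f)) ` F) \<subseteq> J"
    by (rule L.A.genideal_minimal)
  then show ?thesis using x m by (auto simp: J_def D_def)
qed

lemma leading_term_mem:
  assumes J: "ideal J L" and f: "f \<in> carrier A" "f \<noteq> \<zero>" "piL (lt f) \<in> J" and "dv (lm f) m"
  shows "L.val m \<in> J"
proof -
  interpret J: ideal J L by (rule J)
  note c = lcf_closed[OF f(1,2)] lcf_nonzero[OF f(1,2)]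
  have i: "inv\<^bsub>R\<^esub> (lcf f) \<in> carrier R" "inv\<^bsub>R\<^esub> (lcf f) \<otimes>\<^bsub>R\<^esub> lcf f = \<one>\<^bsub>R\<^esub>"
    using c R.field_Units by auto
  have "L.val (lm f) = inv\<^bsub>R\<^esub> (lcf f) \<odot>\<^bsub>L\<^esub> piL (lt f)"
    using i c by (simp add: pi_lt[OF f(1,2)] flip: L.A.smult_assoc1)
  then have v: "L.val (lm f) \<in> J" using L.ideal_smult[OF J f(3) i(1)] by simp
  obtain y where "y \<in> carrier L" "L.val m = L.val (lm f) \<otimes>\<^bsub>L\<^esub> y"
    using assms(5) unfolding factor_def by blast
  then show ?thesis using J.I_r_closed[OF v] by simp
qed

lemma groebner_iff:
  assumes I: "ideal I A"
  shows "groebner_basis R A H \<Sigma> ord L I G \<longleftrightarrow>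
    G \<subseteq> I \<and> (\<forall>m\<in>lms I. \<exists>g\<in>G. g \<noteq> \<zero> \<and> dv (lm g) m)"
proof -
  let ?T = "\<lambda>F. (\<lambda>f. piL (lt f)) ` F"
  note Ic = ideal_sub[OF I]
  have Tc: "?T F \<subseteq> carrier L" if "F \<subseteq> carrier A" for F
  proof
    fix x assume "x \<in> ?T F"
    then obtain f where f: "f \<in> F" "x = piL (lt f)" by blast
    have "f \<in> carrier A" using f that by blast
    then show "x \<in> carrier L"
      using f pi_lt[of f] lcf_closed[of f] by (cases "f = \<zero>") (auto simp: LT_def pi_zero)
  qed
  have "Idl\<^bsub>L\<^esub> ?T I = Idl\<^bsub>L\<^esub> ?T G \<longleftrightarrow> (\<forall>m\<in>lms I. \<exists>g\<in>G. g \<noteq> \<zero> \<and> dv (lm g) m)"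
    if G: "G \<subseteq> I"
  proof
    have Gc: "G \<subseteq> carrier A" using G Ic by blast
    note idI = L.A.genideal_ideal[OF Tc[OF Ic]] and idG = L.A.genideal_ideal[OF Tc[OF Gc]]
    {
      assume eq: "Idl\<^bsub>L\<^esub> ?T I = Idl\<^bsub>L\<^esub> ?T G"
      show "\<forall>m\<in>lms I. \<exists>g\<in>G. g \<noteq> \<zero> \<and> dv (lm g) m"
      proof
        fix m assume "m \<in> lms I"
        then obtain f where f: "f \<in> I" "f \<noteq> \<zero>" "m = lm f" by (auto simp: lms_def)
        have "piL (lt f) \<in> Idl\<^bsub>L\<^esub> ?T I"
          using L.A.genideal_self[OF Tc[OF Ic]] f(1) by blast
        then have "L.val m \<in> Idl\<^bsub>L\<^esub> ?T I"
          using leading_term_mem[OF idI] f Ic dv_refl by blast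
        moreover have "m \<in> S" using f Ic lm_S by blast
        ultimately show "\<exists>g\<in>G. g \<noteq> \<zero> \<and> dv (lm g) m"
          using leading_terms_occ[OF Gc, of "L.val m" m] eq L.occ_val by simp
      qed
    }
    {
      assume r: "\<forall>m\<in>lms I. \<exists>g\<in>G. g \<noteq> \<zero> \<and> dv (lm g) m"
      have "?T I \<subseteq> Idl\<^bsub>L\<^esub> ?T G"
      proof
        fix x assume "x \<in> ?T I"
        then obtain f where f: "f \<in> I" "x = piL (lt f)" by blast
        have fc: "f \<in> carrier A" using f Ic by blast
        show "x \<in> Idl\<^bsub>L\<^esub> ?T G"
        proof (cases "f = \<zero>")
          case True
          then show ?thesis using f idG by (simp add: LT_def pi_zero additive_subgroup.zero_closed ideal.axioms(1))
        next
          case False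
          obtain g where g: "g \<in> G" "g \<noteq> \<zero>" "dv (lm g) (lm f)" using r lmsI[OF f(1) False] by blast
          have "piL (lt g) \<in> Idl\<^bsub>L\<^esub> ?T G" using L.A.genideal_self[OF Tc[OF Gc]] g(1) by blast
          then have "L.val (lm f) \<in> Idl\<^bsub>L\<^esub> ?T G"
            using leading_term_mem[OF idG] g Gc by blast
          then show ?thesis
            using f(2) pi_lt[OF fc False] L.ideal_smult[OF idG] lcf_closed[OF fc False] by simp
        qed
      qed
      then have "Idl\<^bsub>L\<^esub> ?T I \<subseteq> Idl\<^bsub>L\<^esub> ?T G" by (rule L.A.genideal_minimal[OF idG])
      moreover have "Idl\<^bsub>L\<^esub> ?T G \<subseteq> Idl\<^bsub>L\<^esub> ?T I"
        using L.A.genideal_self[OF Tc[OF Ic]] G by (intro L.A.genideal_minimal[OF idI]) blast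
      ultimately show "Idl\<^bsub>L\<^esub> ?T I = Idl\<^bsub>L\<^esub> ?T G" by blast
    }
  qed
  then show ?thesis unfolding groebner_basis_def by blast
qed

section \<open>The reduced Groebner basis\<close>

definition min_lms where "min_lms I = {m \<in> lms I. \<forall>m'\<in>lms I. dv m' m \<longrightarrow> m' = m}"

text \<open> This set turns out to be the only reduced Groebner basis of \<open>I\<close>. \<close>

definition rgb where
  "rgb I = {g \<in> I. g \<noteq> \<zero> \<and> lcf g = \<one>\<^bsub>R\<^esub> \<and> lm g \<in> min_lms I \<and>
    (\<forall>m\<in>occ g. m \<noteq> lm g \<longrightarrow> m \<notin> lms I)}"

lemma min_lms_dv:
  assumes I: "I \<subseteq> carrier A" and m: "m \<in> lms I"
  shows "\<exists>m0\<in>min_lms I. dv m0 m"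
proof -
  have "m \<in> S" using m lms_S[OF I] by blast
  then have "m \<in> lms I \<longrightarrow> (\<exists>m0\<in>min_lms I. dv m0 m)"
  proof (induction m rule: ord_induct)
    case (less m)
    show ?case
    proof
      assume m: "m \<in> lms I"
      show "\<exists>m0\<in>min_lms I. dv m0 m"
      proof (cases "m \<in> min_lms I")
        case True then show ?thesis using dv_refl by blast
      next
        case False
        then obtain m' where m': "m' \<in> lms I" "dv m' m" "m' \<noteq> m" using m by (auto simp: min_lms_def)
        then have "(m', m) \<in> ord" using dv_ord lms_S[OF I] less(1) by blast
        then show ?thesis using less(2) m' dv_trans by meson
      qed
    qed
  qed
  then show ?thesis using m by blast
qed

text \<open> In \<open>g - g'\<close> the leading terms cancel, and the other monomials are outside \<open>lms I\<close>; but the leading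
  monomial of a nonzero element of \<open>I\<close> is in \<open>lms I\<close>. \<close>

lemma rgb_unique:
  assumes I: "ideal I A" and g: "g \<in> rgb I" "g' \<in> rgb I" "lm g = lm g'"
  shows "g = g'"
proof (rule ccontr)
  interpret I: ideal I A by (rule I)
  assume "g \<noteq> g'"
  have gI: "g \<in> I" "g' \<in> I" and gnz: "g \<noteq> \<zero>" "g' \<noteq> \<zero>" and l: "lcf g = \<one>\<^bsub>R\<^esub>" "lcf g' = \<one>\<^bsub>R\<^esub>"
    using g by (auto simp: rgb_def)
  have gc: "g \<in> carrier A" "g' \<in> carrier A" using gI ideal_sub[OF I] by auto
  let ?d = "g \<ominus> g'"
  have d: "?d \<in> I" "?d \<in> carrier A"
    using gI gc by (auto simp: A.minus_eq)
  have dnz: "?d \<noteq> \<zero>" using \<open>g \<noteq> g'\<close> gc by simp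
  have "below (g \<ominus> \<one>\<^bsub>R\<^esub> \<odot> g') (lm g)"
    by (rule below_tail) (use gc gnz g(3) l in auto)
  then have "lm ?d \<noteq> lm g" using below_lm[of ?d "lm g"] gc dnz by simp
  moreover have "lm ?d \<in> occ g \<union> occ g'"
    using lm_occ[OF d(2) dnz] occ_minus[OF gc] by blast
  moreover have "lm ?d \<in> lms I" by (rule lmsI[OF d(1) dnz])
  ultimately show False using g by (auto simp: rgb_def)
qed

lemma rgbI:
  assumes "m \<in> min_lms I" "I \<subseteq> carrier A" "below r m" "occ r \<inter> lms I = {}" "val m \<oplus> r \<in> I"
  shows "val m \<oplus> r \<in> rgb I" "lm (val m \<oplus> r) = m"
proof -
  have m: "m \<in> S" using assms(1) lms_S[OF assms(2)] by (auto simp: min_lms_def)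
  note l = lm_belowI[OF m R.one_closed R.one_not_zero assms(3), unfolded A.smult_one[OF val_closed]]
  show "lm (val m \<oplus> r) = m" by (rule l(1))
  have "occ (val m \<oplus> r) \<subseteq> {m} \<union> occ r"
    using occ_add[of "val m" r] assms(3) occ_val[OF m] by (auto simp: below_def)
  then show "val m \<oplus> r \<in> rgb I"
    using l assms by (auto simp: rgb_def)
qed

text \<open> Induction on an upper bound for the monomials of \<open>f\<close>: the leading term is cancelled by an
  element of \<open>I\<close> if possible and otherwise moved to the remainder. \<close>

lemma normal_form_exists:
  assumes I: "ideal I A" and m: "m \<in> S" and f: "f \<in> carrier A" "\<And>m'. m' \<in> occ f \<Longrightarrow> (m', m) \<in> ord"
  shows "\<exists>r\<in>carrier A. f \<ominus> r \<in> I \<and> occ r \<inter> lms I = {} \<and> (\<forall>m'\<in>occ r. (m', m) \<in> ord)"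
  using m f
proof (induction m arbitrary: f rule: ord_induct)
  case (less m f)
  interpret I: ideal I A by (rule I)
  show ?case
  proof (cases "f = \<zero>")
    case True
    then show ?thesis by (intro bexI[of _ "\<zero>"]) (auto simp: occ_zero A.minus_eq)
  next
    case False
    note l = lm_S[OF less(3) False] lcf_closed[OF less(3) False]
    have lm: "(lm f, m) \<in> ord" using less(4) lm_occ[OF less(3) False] .
    \<comment> \<open>A multiple of \<open>q\<close> cancels the leading term of \<open>f\<close>; \<open>s\<close> is the part of \<open>q\<close> that goes to the
      remainder, nothing for \<open>q \<in> I\<close> and all of \<open>q\<close> otherwise.\<close>
    obtain q s where q: "q \<in> carrier A" "q \<noteq> \<zero>" "lm q = lm f"
      and s: "s \<in> carrier A" "\<And>c. c \<in> carrier R \<Longrightarrow> c \<odot> q \<ominus> c \<odot> s \<in> I" "occ s \<inter> lms I = {}"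
        "occ s \<subseteq> {lm f}"
    proof (cases "lm f \<in> lms I")
      case True
      then obtain q where q: "q \<in> I" "q \<noteq> \<zero>" "lm q = lm f" by (auto simp: lms_def)
      then have qc: "q \<in> carrier A" using ideal_sub[OF I] by blast
      show ?thesis
        by (rule that[of q "\<zero>"]) (use q qc ideal_smult[OF I] in \<open>auto simp: occ_zero A.minus_eq\<close>)
    next
      case F: False
      show ?thesis
        by (rule that[of "val (lm f)" "val (lm f)"]) (use F l in \<open>auto simp: occ_val val_nonzero lm_val A.minus_eq A.r_neg\<close>)
    qed
    note lq = lcf_closed[OF q(1,2)] lcf_nonzero[OF q(1,2)]
    define c where "c = lcf f \<otimes>\<^bsub>R\<^esub> inv\<^bsub>R\<^esub> (lcf q)"
    have i: "inv\<^bsub>R\<^esub> (lcf q) \<in> carrier R" "inv\<^bsub>R\<^esub> (lcf q) \<otimes>\<^bsub>R\<^esub> lcf q = \<one>\<^bsub>R\<^esub>"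
      using lq R.field_Units by auto
    have c: "c \<in> carrier R" "c \<otimes>\<^bsub>R\<^esub> lcf q = lcf f"
      using i l lq by (auto simp: c_def R.m_assoc)
    let ?f = "f \<ominus> c \<odot> q"
    have fc: "?f \<in> carrier A" using less(3) c q by simp
    have b: "below ?f (lm f)"
      by (rule below_tail[OF less(3) False q(1,2,3) c])
    obtain r where r: "r \<in> carrier A" "?f \<ominus> r \<in> I" "occ r \<inter> lms I = {}" "\<forall>m'\<in>occ r. (m', m) \<in> ord"
    proof (cases "?f = \<zero>")
      case True
      show ?thesis
        by (rule that[of "\<zero>"]) (use True in \<open>auto simp: occ_zero A.minus_eq\<close>)
    next
      case False
      note bl = below_lm[OF b False]
      have lt: "(lm ?f, m) \<in> ord" "lm ?f \<noteq> m" using bl lm ord_trans ord_antisym by metis+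
      obtain r where "r \<in> carrier A" "?f \<ominus> r \<in> I" "occ r \<inter> lms I = {}" "\<forall>m'\<in>occ r. (m', lm ?f) \<in> ord"
        using less(2)[OF lt fc lm_max[OF fc False]] by blast
      then show ?thesis using that lt(1) ord_trans by meson
    qed
    let ?r = "r \<oplus> c \<odot> s"
    have "f \<ominus> ?r = (?f \<ominus> r) \<oplus> (c \<odot> q \<ominus> c \<odot> s)"
    proof -
      have "f \<in> carrier A" "r \<in> carrier A" "c \<odot> q \<in> carrier A" "c \<odot> s \<in> carrier A"
        using less(3) r c q s by auto
      then show ?thesis by algebra
    qed
    then have "f \<ominus> ?r \<in> I" using r(2) s(2)[OF c(1)] I.a_closed by simp
    moreover have "occ ?r \<subseteq> occ r \<union> occ s"
      using occ_add[OF r(1), of "c \<odot> s"] occ_smult[OF s(1) c(1)] s(1) c(1) by auto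
    ultimately show ?thesis
      using r s lm c(1) by (intro bexI[of _ ?r]) auto
  qed
qed

lemma rgb_exists:
  assumes I: "ideal I A" and m: "m \<in> min_lms I"
  shows "\<exists>g\<in>rgb I. lm g = m"
proof -
  have mS: "m \<in> S" and ml: "m \<in> lms I" using m lms_S[OF ideal_sub[OF I]] by (auto simp: min_lms_def)
  obtain r where r: "r \<in> carrier A" "val m \<ominus> r \<in> I" "occ r \<inter> lms I = {}" "\<forall>m'\<in>occ r. (m', m) \<in> ord"
    using normal_form_exists[OF I mS, of "val m"] ord_refl[OF mS] by (auto simp: occ_val[OF mS])
  have o: "occ (\<ominus> r) \<subseteq> occ r"
    using occ_smult[OF r(1), of "\<ominus>\<^bsub>R\<^esub> \<one>\<^bsub>R\<^esub>"] minus_eq_smult[OF r(1)] by simp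
  have "below (\<ominus> r) m" using o r ml by (auto simp: below_def)
  then show ?thesis
    using rgbI[OF m ideal_sub[OF I], of "\<ominus> r"] o r by (auto simp: A.minus_eq)
qed

lemma divides_lt_iff:
  assumes "g \<in> carrier A" "lcf g = \<one>\<^bsub>R\<^esub>" "m \<in> S"
  shows "divides_lt R A H \<Sigma> L (lt g) (val m) \<longleftrightarrow> dv (lm g) m" "g \<noteq> \<zero>"
proof -
  show nz: "g \<noteq> \<zero>" using assms(2) by (auto simp: LC_def)
  show "divides_lt R A H \<Sigma> L (lt g) (val m) \<longleftrightarrow> dv (lm g) m"
    using pi_lt[OF assms(1) nz] assms pi_val[OF assms(3)] by (simp add: divides_lt_def)
qed

text \<open> Let \<open>G\<close> be reduced. A monomial of \<open>g \<in> G\<close> that is in \<open>lms I\<close> is divisible by some \<open>lm g'\<close>, and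
  then \<open>g' = g\<close>. As the other monomials of \<open>g\<close> are smaller than \<open>lm g\<close>, none of them is in \<open>lms I\<close>, and in the
  same way \<open>lm g\<close> is minimal. \<close>

theorem reduced_iff:
  assumes I: "ideal I A"
  shows "reduced_groebner_basis R A H \<Sigma> ord L I G \<longleftrightarrow> G = rgb I"
proof
  note Ic = ideal_sub[OF I]
  have rgb: "groebner_basis R A H \<Sigma> ord L I (rgb I)"
    unfolding groebner_iff[OF I]
  proof (intro conjI ballI)
    show "rgb I \<subseteq> I" by (auto simp: rgb_def)
    fix m assume "m \<in> lms I"
    then obtain m0 where m0: "m0 \<in> min_lms I" "dv m0 m" using min_lms_dv[OF Ic] by blast
    obtain g where "g \<in> rgb I" "lm g = m0" using rgb_exists[OF I m0(1)] by blast
    then show "\<exists>g\<in>rgb I. g \<noteq> \<zero> \<and> dv (lm g) m" using m0 by (auto simp: rgb_def)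
  qed
  {
    assume "G = rgb I"
    moreover have "\<not> divides_lt R A H \<Sigma> L (lt g') (val m)"
      if g: "g \<in> rgb I" "m \<in> occ g" "g' \<in> rgb I" "g' \<noteq> g" for g g' m
    proof
      assume d: "divides_lt R A H \<Sigma> L (lt g') (val m)"
      have gc: "g \<in> carrier A" "g' \<in> carrier A" using g Ic by (auto simp: rgb_def)
      have mS: "m \<in> S" using g gc occ_sub_S by blast
      have dv: "dv (lm g') m" using divides_lt_iff(1)[OF gc(2) _ mS] d g by (auto simp: rgb_def)
      have g'l: "lm g' \<in> lms I" using g(3) by (auto simp: rgb_def min_lms_def)
      have "m \<in> lms I" by (rule lms_dv[OF I g'l mS dv])
      then have "m = lm g" using g by (auto simp: rgb_def)
      then have "lm g' = lm g" using g(1) g'l dv by (auto simp: rgb_def min_lms_def)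
      then show False using rgb_unique[OF I g(3,1)] g(4) by blast
    qed
    moreover have lone: "lcf g = \<one>\<^bsub>R\<^esub>" if "g \<in> rgb I" for g using that by (simp add: rgb_def)
    ultimately show "reduced_groebner_basis R A H \<Sigma> ord L I G"
      unfolding reduced_groebner_basis_def using rgb lone by blast
  }
  assume red: "reduced_groebner_basis R A H \<Sigma> ord L I G"
  have GI: "G \<subseteq> I" and ex: "\<And>m. m \<in> lms I \<Longrightarrow> \<exists>g\<in>G. g \<noteq> \<zero> \<and> dv (lm g) m"
    and l1: "\<And>g. g \<in> G \<Longrightarrow> lcf g = \<one>\<^bsub>R\<^esub>"
    using red groebner_iff[OF I] by (auto simp: reduced_groebner_basis_def)
  have Gc: "G \<subseteq> carrier A" using GI Ic by blast
  have nz: "g \<noteq> \<zero>" if "g \<in> G" for g using l1[OF that] by (auto simp: LC_def)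
  have nd: "g' = g" if "g \<in> G" "m \<in> occ g" "g' \<in> G" "dv (lm g') m" for g g' m
  proof -
    have gc: "g \<in> carrier A" "g' \<in> carrier A" using that Gc by auto
    have mS: "m \<in> S" using that gc occ_sub_S by blast
    show ?thesis
      using red that divides_lt_iff(1)[OF gc(2) l1 mS] unfolding reduced_groebner_basis_def by blast
  qed
  have sub: "G \<subseteq> rgb I"
  proof
    fix g assume g: "g \<in> G"
    have gc: "g \<in> carrier A" using g Gc by blast
    have gl: "lm g \<in> lms I" using lmsI g GI nz by blast
    have "m' = lm g" if m': "m' \<in> lms I" "dv m' (lm g)" for m'
    proof -
      obtain g' where g': "g' \<in> G" "dv (lm g') m'" using ex m'(1) by blast
      then have "g' = g" using nd[OF g lm_occ[OF gc nz[OF g]] g'(1)] dv_trans m'(2) by blast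
      then show ?thesis
        using dv_ord[OF _ _ g'(2)] dv_ord[OF _ _ m'(2)] m'(1) gl lms_S[OF Ic] ord_antisym by blast
    qed
    then have "lm g \<in> min_lms I" using gl by (auto simp: min_lms_def)
    moreover have "m \<notin> lms I" if m: "m \<in> occ g" "m \<noteq> lm g" for m
    proof
      assume "m \<in> lms I"
      then obtain g' where g': "g' \<in> G" "dv (lm g') m" using ex by blast
      then have "g' = g" using nd[OF g m(1)] by blast
      then have "(lm g, m) \<in> ord" using dv_ord g' lm_S gc nz[OF g] occ_sub_S m(1) by blast
      then show False using lm_max[OF gc nz[OF g] m(1)] ord_antisym m(2) by blast
    qed
    ultimately show "g \<in> rgb I" using g GI nz l1 by (auto simp: rgb_def)
  qed
  moreover have "rgb I \<subseteq> G"
  proof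
    fix g assume g: "g \<in> rgb I"
    then have "lm g \<in> lms I" by (auto simp: rgb_def min_lms_def)
    then obtain g' where g': "g' \<in> G" "dv (lm g') (lm g)" using ex by blast
    have "lm g' = lm g" using g' g sub by (auto simp: rgb_def min_lms_def)
    then have "g' = g" using rgb_unique[OF I] g g' sub by blast
    then show "g \<in> G" using g' by simp
  qed
  ultimately show "G = rgb I" by blast
qed

section \<open>Leading monomials of a Groebner basis\<close>

lemma lms_groebner:
  assumes I: "ideal I A" and G: "groebner_basis R A H \<Sigma> ord L I G"
  shows "m \<in> lms I \<longleftrightarrow> m \<in> S \<and> (\<exists>g\<in>G. g \<noteq> \<zero> \<and> dv (lm g) m)"
  using G lms_dv[OF I] lms_S[OF ideal_sub[OF I]] lmsI unfolding groebner_iff[OF I] by blast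

lemma min_lms_groebner:
  assumes I: "ideal I A" and G: "groebner_basis R A H \<Sigma> ord L I G"
  shows "min_lms I = {lm g |g. g \<in> G \<and> g \<noteq> \<zero> \<and>
    (\<forall>g'\<in>G. g' \<noteq> \<zero> \<and> dv (lm g') (lm g) \<longrightarrow> lm g' = lm g)}" (is "_ = ?M")
proof
  have GI: "G \<subseteq> I" using G by (simp add: groebner_basis_def)
  show "min_lms I \<subseteq> ?M"
  proof
    fix m assume m: "m \<in> min_lms I"
    then obtain g where g: "g \<in> G" "g \<noteq> \<zero>" "dv (lm g) m"
      using lms_groebner[OF I G, of m] by (auto simp: min_lms_def)
    then have "lm g = m" using m lmsI[of g I] GI by (auto simp: min_lms_def)
    have "lm g' = m" if "g' \<in> G" "g' \<noteq> \<zero>" "dv (lm g') m" for g'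
      using m that lmsI[of g' I] GI by (auto simp: min_lms_def)
    then show "m \<in> ?M" using g \<open>lm g = m\<close> by blast
  qed
  show "?M \<subseteq> min_lms I"
  proof
    fix m assume "m \<in> ?M"
    then obtain g where g: "g \<in> G" "g \<noteq> \<zero>" "m = lm g"
      "\<And>g'. g' \<in> G \<Longrightarrow> g' \<noteq> \<zero> \<Longrightarrow> dv (lm g') m \<Longrightarrow> lm g' = m" by blast
    have ml: "m \<in> lms I" using g lmsI GI by blast
    have "m' = m" if m': "m' \<in> lms I" "dv m' m" for m'
    proof -
      obtain g' where g': "g' \<in> G" "g' \<noteq> \<zero>" "dv (lm g') m'"
        using lms_groebner[OF I G, of m'] m'(1) by blast
      have "lm g' = m" using g(4)[OF g'(1,2)] dv_trans[OF g'(3) m'(2)] by blast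
      then show ?thesis
        using dv_ord[OF _ _ g'(3)] dv_ord[OF _ _ m'(2)] ml m'(1) lms_S[OF ideal_sub[OF I]] ord_antisym
        by blast
    qed
    then show "m \<in> min_lms I" using ml by (auto simp: min_lms_def)
  qed
qed

end

section \<open>Monomials with the same image\<close>

lemma finite_below_exponent:
  assumes "finite H" "z \<in> exponents H"
  shows "finite {x. \<forall>y. x y \<le> z y}"
proof -
  have "finite {x. \<forall>y. (y \<in> H \<longrightarrow> x y \<in> (\<Union>y\<in>H. {..z y})) \<and> (y \<notin> H \<longrightarrow> x y = 0)}"
    by (rule finite_set_of_finite_funs) (use assms in auto)
  moreover have "{x. \<forall>y. x y \<le> z y} \<subseteq>
      {x. \<forall>y. (y \<in> H \<longrightarrow> x y \<in> (\<Union>y\<in>H. {..z y})) \<and> (y \<notin> H \<longrightarrow> x y = 0)}"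
    using assms(2) by (auto simp: exponents_def) (metis le_zero_eq)
  ultimately show ?thesis by (rule finite_subset[rotated])
qed

lemma (in abelian_monoid) finsum_swap:
  assumes "finite C" "finite T" "\<And>z x. z \<in> C \<Longrightarrow> x \<in> T \<Longrightarrow> f z x \<in> carrier G"
  shows "(\<Oplus>z\<in>C. \<Oplus>x\<in>T. f z x) = (\<Oplus>x\<in>T. \<Oplus>z\<in>C. f z x)"
  using assms(1,3)
proof (induction C rule: finite_induct)
  case empty
  then show ?case by (simp add: finsum_zero)
next
  case (insert z C)
  have "(\<Oplus>z\<in>insert z C. \<Oplus>x\<in>T. f z x) = (\<Oplus>x\<in>T. f z x) \<oplus> (\<Oplus>z\<in>C. \<Oplus>x\<in>T. f z x)"
    using insert by (intro finsum_insert Pi_I finsum_closed) auto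
  also have "\<dots> = (\<Oplus>x\<in>T. f z x) \<oplus> (\<Oplus>x\<in>T. \<Oplus>z\<in>C. f z x)"
    using insert by simp
  also have "\<dots> = (\<Oplus>x\<in>T. f z x \<oplus> (\<Oplus>z\<in>C. f z x))"
    using insert by (intro finsum_addf[symmetric] Pi_I finsum_closed) auto
  also have "\<dots> = (\<Oplus>x\<in>T. \<Oplus>z\<in>insert z C. f z x)"
    using insert by (intro finsum_cong' refl Pi_I finsum_closed finsum_insert[symmetric]) auto
  finally show ?case .
qed

context leading_pasl
begin

text \<open> The exponent vectors are arbitrary here: those in the fibre of \<open>m\<close> other than \<open>m\<close> itself are
  never standard, yet they may show that a standard monomial divides \<open>m\<close>. \<close>

definition fibre where
  "fibre m = {u \<in> exponents H. \<exists>c\<in>carrier R. c \<noteq> \<zero>\<^bsub>R\<^esub> \<and> L.val u = c \<odot>\<^bsub>L\<^esub> L.val m}"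

lemma fibre_self: "m \<in> S \<Longrightarrow> m \<in> fibre m"
  unfolding fibre_def by (auto intro: bexI[of _ "\<one>\<^bsub>R\<^esub>"])

text \<open> If \<open>u' = u + w\<close> with \<open>w \<noteq> 0\<close>, let \<open>h\<close> be a generator in the support of \<open>w\<close>. The images of \<open>u\<close> and \<open>u'\<close>
  are multiples of \<open>m\<close>, so \<open>h m\<close> divides \<open>m\<close> in \<open>L\<close> up to a scalar, although \<open>h m\<close> is larger than \<open>m\<close>. \<close>

lemma fibre_antichain:
  assumes m: "m \<in> S" and u: "u \<in> fibre m" "u' \<in> fibre m" "u \<le> u'"
  shows "u = u'"
proof (rule ccontr)
  assume "u \<noteq> u'"
  define w where "w = (\<lambda>x. u' x - u x)"
  have uw: "exp_add u w = u'" unfolding w_def by (rule exp_add_diff[OF u(3)])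
  have uH: "u' \<in> exponents H" using u(2) by (simp add: fibre_def)
  have wH: "w \<in> exponents H" unfolding w_def by (rule exp_diff_mem[OF uH])
  have "w \<noteq> (\<lambda>_. 0)" using uw \<open>u \<noteq> u'\<close> by (auto simp: exp_add_zero)
  then obtain h where h: "w h > 0" by (auto simp: fun_eq_iff)
  then have hH: "h \<in> H" using wH by (auto simp: exponents_def)
  define e where "e = (\<lambda>x. if x = h then 1 else 0 :: nat)"
  have e: "e \<in> S" unfolding e_def by (rule gen_in_S[OF hH])
  have "e \<le> w" using h by (auto simp: e_def le_fun_def)
  then have ew: "exp_add e (\<lambda>x. w x - e x) = w" by (rule exp_add_diff)
  define y where "y = L.val (\<lambda>x. w x - e x)"
  have y: "y \<in> carrier L" by (simp add: y_def)
  obtain c where c: "c \<in> carrier R" "c \<noteq> \<zero>\<^bsub>R\<^esub>" "L.val u = c \<odot>\<^bsub>L\<^esub> L.val m" using u by (auto simp: fibre_def)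
  obtain c' where c': "c' \<in> carrier R" "c' \<noteq> \<zero>\<^bsub>R\<^esub>" "L.val u' = c' \<odot>\<^bsub>L\<^esub> L.val m" using u by (auto simp: fibre_def)
  have eq: "c' \<odot>\<^bsub>L\<^esub> L.val m = c \<odot>\<^bsub>L\<^esub> ((L.val m \<otimes>\<^bsub>L\<^esub> L.val e) \<otimes>\<^bsub>L\<^esub> y)"
    using L.val_add[of u w] L.val_add[of e "\<lambda>x. w x - e x"] uw ew c c' y
    by (simp add: y_def[symmetric] L.A.smult_assoc2 L.A.m_assoc)
  have nz: "L.val m \<otimes>\<^bsub>L\<^esub> L.val e \<noteq> \<zero>\<^bsub>L\<^esub>"
    using eq y c L.term_nonzero[OF m c'(1,2)] by auto
  let ?p = "val m \<otimes> val e"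
  note p = L_mult[OF m e nz]
  note lp = lm_S[OF _ p(1)] lcf_closed[OF _ p(1)] lcf_nonzero[OF _ p(1)]
  have "c' \<odot>\<^bsub>L\<^esub> L.val m = (c \<otimes>\<^bsub>R\<^esub> lcf ?p) \<odot>\<^bsub>L\<^esub> (L.val (lm ?p) \<otimes>\<^bsub>L\<^esub> y)"
    using eq y c lp unfolding p(2) by (simp add: L.A.smult_assoc2 L.A.smult_assoc1)
  also have "\<dots> = L.val (lm ?p) \<otimes>\<^bsub>L\<^esub> ((c \<otimes>\<^bsub>R\<^esub> lcf ?p) \<odot>\<^bsub>L\<^esub> y)"
    using y c lp by (simp add: L.smult_assoc_right)
  finally have "dv (lm ?p) m"
    using y c c' lp by (intro dvI[of "(c \<otimes>\<^bsub>R\<^esub> lcf ?p) \<odot>\<^bsub>L\<^esub> y" c']) auto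
  then have le: "(lm ?p, m) \<in> ord" using dv_ord lp m by simp
  have ne: "(\<lambda>_. 0) \<noteq> e" by (auto simp: e_def fun_eq_iff)
  have "(lm (val (\<lambda>_. 0) \<otimes> val m), lm (val e \<otimes> val m)) \<in> ord"
    "lm (val (\<lambda>_. 0) \<otimes> val m) \<noteq> lm (val e \<otimes> val m)"
    using ord_mult[OF ord_zero[OF e] ne ord_refl[OF m]] p(1) val_nonzero[OF m]
    by (auto simp: A.m_comm)
  then have "(m, lm ?p) \<in> ord" "m \<noteq> lm ?p" using lm_val[OF m] by (simp_all add: A.m_comm)
  then show False using le ord_antisym by blast
qed

lemma finite_fibre:
  assumes m: "m \<in> S"
  shows "finite (fibre m)"
proof (rule ccontr)
  assume "infinite (fibre m)"
  then obtain f :: "nat \<Rightarrow> _" where f: "inj f" "range f \<subseteq> fibre m"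
    using infinite_countable_subset by blast
  have "f n \<in> exponents H" for n using f(2) unfolding fibre_def by blast
  then obtain i j where "i < j" "f i \<le> f j"
    using dickson[OF finite_H, of f] by blast
  moreover have "f i = f j" using fibre_antichain[OF m _ _ \<open>f i \<le> f j\<close>] f(2) by blast
  ultimately show False using f(1) by (auto dest: injD)
qed

lemma fibre_quotient:
  assumes m: "m \<in> S" "m' \<in> S" and u: "u \<in> fibre m'" "m \<le> u" and k: "k = (\<lambda>x. u x - m x)" "k \<in> S"
  shows "dv m m'" "val k \<otimes> val m \<noteq> \<zero>" "lm (val k \<otimes> val m) = m'"
proof -
  obtain c where c: "c \<in> carrier R" "c \<noteq> \<zero>\<^bsub>R\<^esub>" "L.val u = c \<odot>\<^bsub>L\<^esub> L.val m'" using u by (auto simp: fibre_def)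
  have eq: "L.val m \<otimes>\<^bsub>L\<^esub> L.val k = c \<odot>\<^bsub>L\<^esub> L.val m'"
    using L.val_add[of m k] exp_add_diff[OF u(2)] c k(1) by simp
  then show "dv m m'" using c by (intro dvI) auto
  have nz: "L.val k \<otimes>\<^bsub>L\<^esub> L.val m \<noteq> \<zero>\<^bsub>L\<^esub>"
    using eq L.term_nonzero[OF m(2) c(1,2)] by (simp add: L.A.m_comm)
  note p = L_mult[OF k(2) m(1) nz]
  show "val k \<otimes> val m \<noteq> \<zero>" by (rule p(1))
  let ?p = "val k \<otimes> val m"
  have "L.occ (c \<odot>\<^bsub>L\<^esub> L.val m') = L.occ (lcf ?p \<odot>\<^bsub>L\<^esub> L.val (lm ?p))"
    using eq p(2) by (simp add: L.A.m_comm)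
  then show "lm ?p = m'"
    using L.occ_term[OF c(1,2) m(2)] L.occ_term[OF lcf_closed lcf_nonzero lm_S] p(1) by auto
qed

text \<open> The quotient \<open>u - m\<close> can be chosen standard, which makes it a legitimate argument of the
  multiplication routine for \<open>A\<close>. \<close>

lemma dv_fibre:
  assumes m: "m \<in> S" "m' \<in> S"
  shows "dv m m' \<longleftrightarrow> (\<exists>u\<in>fibre m'. m \<le> u \<and> (\<lambda>x. u x - m x) \<in> S)"
proof
  assume "dv m m'"
  then obtain k where k: "k \<in> S" "lcf (val m \<otimes> val k) \<noteq> \<zero>\<^bsub>R\<^esub>" "lcf (val m \<otimes> val k) \<in> carrier R"
    "L.val m \<otimes>\<^bsub>L\<^esub> L.val k = lcf (val m \<otimes> val k) \<odot>\<^bsub>L\<^esub> L.val m'"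
    using dvE[OF m] by metis
  have "exp_add m k \<in> exponents H" using m k by (intro exp_add_mem) auto
  then have "exp_add m k \<in> fibre m'"
    using k unfolding fibre_def by (auto simp: L.val_add)
  moreover have "m \<le> exp_add m k" "(\<lambda>x. exp_add m k x - m x) = k"
    by (auto simp: exp_add_def le_fun_def)
  ultimately show "\<exists>u\<in>fibre m'. m \<le> u \<and> (\<lambda>x. u x - m x) \<in> S" using k(1) by metis
next
  assume "\<exists>u\<in>fibre m'. m \<le> u \<and> (\<lambda>x. u x - m x) \<in> S"
  then show "dv m m'" using fibre_quotient(1)[OF m] by blast
qed

section \<open>Connecting the fibres by binomials\<close>

text \<open> With \<open>a\<close> and \<open>b\<close> in exchanged roles a move is undone, and \<open>a = b\<close> gives the trivial move. \<close>

definition moves where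
  "moves K u = {exp_add (\<lambda>x. u x - a x) b |p a b. p \<in> K \<and> p a \<noteq> \<zero>\<^bsub>R\<^esub> \<and> p b \<noteq> \<zero>\<^bsub>R\<^esub> \<and> a \<le> u}"

lemma kernel_pair:
  assumes p: "p \<in> eval_kernel R H L" "card {m. p m \<noteq> \<zero>\<^bsub>R\<^esub>} \<le> 2" and ab: "p a \<noteq> \<zero>\<^bsub>R\<^esub>" "p b \<noteq> \<zero>\<^bsub>R\<^esub>" "a \<noteq> b"
  shows "p a \<odot>\<^bsub>L\<^esub> L.val a \<oplus>\<^bsub>L\<^esub> p b \<odot>\<^bsub>L\<^esub> L.val b = \<zero>\<^bsub>L\<^esub>"
proof -
  have pc: "p \<in> pcoeffs" and z: "L.lc p = \<zero>\<^bsub>L\<^esub>" using p(1) by (auto simp: eval_kernel_def exp_poly_ring_def)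
  have "{a, b} \<subseteq> {m. p m \<noteq> \<zero>\<^bsub>R\<^esub>}" using ab by auto
  then have "{m. p m \<noteq> \<zero>\<^bsub>R\<^esub>} = {a, b}"
    using p(2) ab(3) pcoeffs_finite[OF pc] by (metis card_2_iff card_seteq)
  then have "L.lc p = (\<Oplus>\<^bsub>L\<^esub>m\<in>{a, b}. p m \<odot>\<^bsub>L\<^esub> L.val m)" by (simp add: lin_comb_def)
  then show ?thesis using z ab(3) pc by simp
qed

lemma moves_fibre:
  assumes K: "K \<subseteq> eval_kernel R H L" "\<forall>p\<in>K. card {m. p m \<noteq> \<zero>\<^bsub>R\<^esub>} \<le> 2"
    and m: "m \<in> S" and u: "u \<in> fibre m"
  shows "moves K u \<subseteq> fibre m"
proof
  fix w assume "w \<in> moves K u"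
  then obtain p a b where p: "p \<in> K" "p a \<noteq> \<zero>\<^bsub>R\<^esub>" "p b \<noteq> \<zero>\<^bsub>R\<^esub>" "a \<le> u"
    "w = exp_add (\<lambda>x. u x - a x) b" by (auto simp: moves_def)
  have pc: "p \<in> pcoeffs" using p(1) K(1) by (auto simp: eval_kernel_def exp_poly_ring_def)
  let ?x = "\<lambda>x. u x - a x"
  show "w \<in> fibre m"
  proof (cases "a = b")
    case True
    then have "w = u" using exp_add_diff[OF p(4)] p(5) by (simp add: exp_add_commute)
    then show ?thesis using u by simp
  next
    case False
    have uH: "u \<in> exponents H" using u by (simp add: fibre_def)
    have bH: "b \<in> exponents H" using pcoeffs_outside[OF pc] p(3) by blast
    obtain c where c: "c \<in> carrier R" "c \<noteq> \<zero>\<^bsub>R\<^esub>" "L.val u = c \<odot>\<^bsub>L\<^esub> L.val m" using u by (auto simp: fibre_def)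
    have cp: "p a \<in> carrier R" "p b \<in> carrier R" using pc by auto
    define d where "d = \<ominus>\<^bsub>R\<^esub> (inv\<^bsub>R\<^esub> (p b) \<otimes>\<^bsub>R\<^esub> p a)"
    have i: "inv\<^bsub>R\<^esub> (p b) \<in> carrier R" "inv\<^bsub>R\<^esub> (p b) \<otimes>\<^bsub>R\<^esub> p b = \<one>\<^bsub>R\<^esub>"
      using p(3) cp R.field_Units by auto
    have i0: "inv\<^bsub>R\<^esub> (p b) \<noteq> \<zero>\<^bsub>R\<^esub>" using i(2) cp by auto
    have d: "d \<in> carrier R" "d \<noteq> \<zero>\<^bsub>R\<^esub>"
      using i i0 cp p(2) R.integral by (auto simp: d_def)
    have "p b \<odot>\<^bsub>L\<^esub> L.val b = \<ominus>\<^bsub>L\<^esub> (p a \<odot>\<^bsub>L\<^esub> L.val a)"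
      using kernel_pair[of p a b] K p False cp by (auto intro!: L.A.minus_equality[symmetric] simp: L.A.a_comm)
    then have "inv\<^bsub>R\<^esub> (p b) \<odot>\<^bsub>L\<^esub> (p b \<odot>\<^bsub>L\<^esub> L.val b) = inv\<^bsub>R\<^esub> (p b) \<odot>\<^bsub>L\<^esub> (\<ominus>\<^bsub>L\<^esub> (p a \<odot>\<^bsub>L\<^esub> L.val a))" by simp
    then have vb: "L.val b = d \<odot>\<^bsub>L\<^esub> L.val a"
      using i cp by (simp add: d_def L.A.smult_r_minus L.A.smult_l_minus flip: L.A.smult_assoc1)
    have "L.val w = d \<odot>\<^bsub>L\<^esub> L.val u"
      using L.val_add[of a ?x] L.val_add[of b ?x] exp_add_diff[OF p(4)] p(5) vb d
      by (simp add: exp_add_commute L.A.smult_assoc2)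
    also have "\<dots> = (d \<otimes>\<^bsub>R\<^esub> c) \<odot>\<^bsub>L\<^esub> L.val m"
      using c d by (simp add: L.A.smult_assoc1)
    finally have "L.val w = (d \<otimes>\<^bsub>R\<^esub> c) \<odot>\<^bsub>L\<^esub> L.val m" .
    moreover have "w \<in> exponents H" unfolding p(5) by (rule exp_add_mem[OF exp_diff_mem[OF uH] bH])
    moreover have "d \<otimes>\<^bsub>R\<^esub> c \<noteq> \<zero>\<^bsub>R\<^esub>" using c d R.integral by blast
    ultimately show ?thesis using c d unfolding fibre_def by auto
  qed
qed


text \<open>Why a set \<open>C\<close> of vectors in the fibre of \<open>m\<close> that contains \<open>m\<close> and is closed under moves is the
  whole fibre: write \<open>lam z\<close> for the scalar with which \<open>z \<in> C\<close> is mapped to a multiple of \<open>m\<close> in \<open>L\<close>, and let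
  \<open>phi w p\<close> be the coefficient of \<open>m\<close> in the image of that part of \<open>H^w p\<close> whose exponents are in \<open>C\<close>. For a
  generator \<open>p\<close> of the kernel, \<open>C\<close> contains all or none of the exponents of \<open>H^w p\<close>, so \<open>phi w p = 0\<close>. As
  \<open>phi w (q p)\<close> is a combination of the values \<open>phi (w + x) p\<close>, the polynomials annihilated by all \<open>phi w\<close>
  form an ideal, which therefore contains the kernel. For \<open>u\<close> in the fibre but not in \<open>C\<close>, the kernel
  contains some \<open>H^u - c H^m\<close> with \<open>c \<noteq> 0\<close>, on which \<open>phi 0\<close> has the value \<open>-c\<close>, a contradiction.\<close>

context
  fixes C :: "('a \<Rightarrow> nat) set" and m :: "'a \<Rightarrow> nat" and K :: "(('a \<Rightarrow> nat) \<Rightarrow> 'r) set"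
  assumes m: "m \<in> S" and C: "C \<subseteq> fibre m" and mC: "m \<in> C"
    and C_moves: "\<And>u. u \<in> C \<Longrightarrow> moves K u \<subseteq> C"
    and K2: "\<forall>p\<in>K. card {m. p m \<noteq> \<zero>\<^bsub>R\<^esub>} \<le> 2"
    and K_gen: "Idl\<^bsub>exp_poly_ring R H\<^esub> K = eval_kernel R H L"
begin

definition lam where "lam z = L.co (L.val z) m"

definition phi :: "('a \<Rightarrow> nat) \<Rightarrow> (('a \<Rightarrow> nat) \<Rightarrow> 'r) \<Rightarrow> 'r" where
  "phi w p = (\<Oplus>\<^bsub>R\<^esub>z\<in>C. if w \<le> z then lam z \<otimes>\<^bsub>R\<^esub> p (\<lambda>x. z x - w x) else \<zero>\<^bsub>R\<^esub>)"

definition annihilated where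
  "annihilated = {p \<in> pcoeffs. \<forall>w\<in>exponents H. phi w p = \<zero>\<^bsub>R\<^esub>}"

lemma finite_C: "finite C"
  using finite_subset[OF C finite_fibre[OF m]] .

lemma C_exponents: "z \<in> C \<Longrightarrow> z \<in> exponents H"
  using C by (auto simp: fibre_def)

lemma lam_closed [simp]: "lam z \<in> carrier R"
  by (simp add: lam_def)

lemma lam_m: "lam m = \<one>\<^bsub>R\<^esub>"
  using L.co_val[OF m] by (simp add: lam_def L.single_def)

lemma K_sub: "K \<subseteq> eval_kernel R H L"
  unfolding K_gen[symmetric] genideal_def by blast

abbreviation P where "P \<equiv> exp_poly_ring R H"

lemma carrier_P: "carrier P = pcoeffs"
  by (simp add: exp_poly_ring_def)

lemma eval_kernel_sub: "eval_kernel R H L \<subseteq> pcoeffs"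
  by (auto simp: eval_kernel_def carrier_P)

text \<open> A structure that is not a ring has no ideals, and then the intersection of all ideals that
  contain \<open>K\<close> would be the type of all functions, which contains functions with infinite support. \<close>

lemma ring_P: "ring P"
proof (rule ccontr)
  assume "\<not> ring P"
  then have "{I. ideal I P \<and> K \<subseteq> I} = {}" by (auto dest: ideal.axioms(2))
  then have "Idl\<^bsub>P\<^esub> K = UNIV" unfolding genideal_def by (metis Inter_empty)
  then have "(\<lambda>_. \<one>\<^bsub>R\<^esub>) \<in> pcoeffs" using K_gen eval_kernel_sub by auto
  then have "finite {i :: 'a \<Rightarrow> nat. \<one>\<^bsub>R\<^esub> \<noteq> \<zero>\<^bsub>R\<^esub>}" by (rule pcoeffs_finite)
  then have "finite (UNIV :: ('a \<Rightarrow> nat) set)" by simp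
  then have "finite (range (\<lambda>n. (\<lambda>_ :: 'a. n :: nat)))" by (rule finite_subset[rotated]) simp
  moreover have "inj (\<lambda>n. (\<lambda>_ :: 'a. n :: nat))" by (auto simp: inj_def fun_eq_iff)
  ultimately show False using finite_imageD infinite_UNIV_nat by blast
qed

interpretation P: ring P
  by (rule ring_P)

lemma phi_closed: "p \<in> pcoeffs \<Longrightarrow> phi w p \<in> carrier R"
  unfolding phi_def by (intro R.finsum_closed Pi_I) auto

lemma phi_zero: "phi w \<zero>\<^bsub>P\<^esub> = \<zero>\<^bsub>R\<^esub>"
proof -
  have "phi w \<zero>\<^bsub>P\<^esub> = (\<Oplus>\<^bsub>R\<^esub>z\<in>C. \<zero>\<^bsub>R\<^esub>)"
    unfolding phi_def by (intro R.finsum_cong' refl Pi_I) (auto simp: exp_poly_ring_def)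
  then show ?thesis by simp
qed

lemma phi_add:
  assumes "p \<in> pcoeffs" "q \<in> pcoeffs"
  shows "phi w (p \<oplus>\<^bsub>P\<^esub> q) = phi w p \<oplus>\<^bsub>R\<^esub> phi w q"
proof -
  have "phi w (p \<oplus>\<^bsub>P\<^esub> q) = (\<Oplus>\<^bsub>R\<^esub>z\<in>C. (if w \<le> z then lam z \<otimes>\<^bsub>R\<^esub> p (\<lambda>x. z x - w x) else \<zero>\<^bsub>R\<^esub>) \<oplus>\<^bsub>R\<^esub>
      (if w \<le> z then lam z \<otimes>\<^bsub>R\<^esub> q (\<lambda>x. z x - w x) else \<zero>\<^bsub>R\<^esub>))"
    unfolding phi_def using assms
    by (intro R.finsum_cong' refl Pi_I) (auto simp: exp_poly_ring_def R.r_distr)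
  also have "\<dots> = phi w p \<oplus>\<^bsub>R\<^esub> phi w q"
    unfolding phi_def using assms by (intro R.finsum_addf Pi_I) auto
  finally show ?thesis .
qed

lemma P_mult_comm:
  assumes "p \<in> pcoeffs" "q \<in> pcoeffs"
  shows "p \<otimes>\<^bsub>P\<^esub> q = q \<otimes>\<^bsub>P\<^esub> p"
proof
  fix z :: "'a \<Rightarrow> nat"
  let ?D = "{u. \<forall>x. u x \<le> z x}"
  let ?r = "\<lambda>u x. z x - u x :: nat"
  show "(p \<otimes>\<^bsub>P\<^esub> q) z = (q \<otimes>\<^bsub>P\<^esub> p) z"
  proof (cases "z \<in> exponents H")
    case True
    have inj: "inj_on ?r ?D"
    proof (rule inj_onI)
      fix u v assume uv: "u \<in> ?D" "v \<in> ?D" "?r u = ?r v"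
      show "u = v"
      proof
        fix x
        have "z x - u x = z x - v x" "u x \<le> z x" "v x \<le> z x" using uv by (auto dest: fun_cong)
        then show "u x = v x" by simp
      qed
    qed
    have im: "?r ` ?D = ?D"
    proof
      show "?D \<subseteq> ?r ` ?D"
      proof
        fix u assume u: "u \<in> ?D"
        then have eq: "u = ?r (?r u)" by (auto simp: fun_eq_iff)
        have "?r u \<in> ?D" by simp
        with eq show "u \<in> ?r ` ?D" by (rule image_eqI)
      qed
    qed auto
    have "(\<Oplus>\<^bsub>R\<^esub>u\<in>?D. p u \<otimes>\<^bsub>R\<^esub> q (?r u)) = (\<Oplus>\<^bsub>R\<^esub>u\<in>?r ` ?D. p u \<otimes>\<^bsub>R\<^esub> q (?r u))"
      unfolding im ..
    also have "\<dots> = (\<Oplus>\<^bsub>R\<^esub>u\<in>?D. p (?r u) \<otimes>\<^bsub>R\<^esub> q (?r (?r u)))"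
      by (rule R.finsum_reindex[OF _ inj]) (use assms in auto)
    also have "\<dots> = (\<Oplus>\<^bsub>R\<^esub>u\<in>?D. q u \<otimes>\<^bsub>R\<^esub> p (?r u))"
    proof (rule R.finsum_cong'[OF refl])
      fix u assume "u \<in> ?D"
      then have "?r (?r u) = u" by (auto simp: fun_eq_iff)
      then show "p (?r u) \<otimes>\<^bsub>R\<^esub> q (?r (?r u)) = q u \<otimes>\<^bsub>R\<^esub> p (?r u)"
        using assms by (simp add: R.m_comm)
    qed (use assms in auto)
    finally show ?thesis using True by (simp add: exp_poly_ring_def)
  next
    case False
    then show ?thesis by (simp add: exp_poly_ring_def)
  qed
qed

text \<open> Exchanging the two sums gives \<open>phi w (q p) = (\<Sum>x. q x * phi (w + x) p)\<close>. \<close>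

lemma phi_mult:
  assumes p: "p \<in> pcoeffs" and q: "q \<in> pcoeffs" and w: "w \<in> exponents H"
    and z: "\<And>w. w \<in> exponents H \<Longrightarrow> phi w p = \<zero>\<^bsub>R\<^esub>"
  shows "phi w (q \<otimes>\<^bsub>P\<^esub> p) = \<zero>\<^bsub>R\<^esub>"
proof -
  define T where "T = (\<Union>z\<in>C. {x. \<forall>y. x y \<le> z y})"
  have T: "finite T" unfolding T_def using finite_C finite_below_exponent[OF finite_H C_exponents] by blast
  have TH: "x \<in> exponents H" if "x \<in> T" for x
    using that exp_le_mem[OF C_exponents] by (auto simp: T_def le_fun_def)
  define g where "g z x = (if exp_add w x \<le> z
      then q x \<otimes>\<^bsub>R\<^esub> (lam z \<otimes>\<^bsub>R\<^esub> p (\<lambda>y. z y - exp_add w x y)) else \<zero>\<^bsub>R\<^esub>)" for z x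
  have gc: "g z x \<in> carrier R" for z x using p q by (simp add: g_def)
  have inner: "(if w \<le> z then lam z \<otimes>\<^bsub>R\<^esub> (q \<otimes>\<^bsub>P\<^esub> p) (\<lambda>x. z x - w x) else \<zero>\<^bsub>R\<^esub>) = (\<Oplus>\<^bsub>R\<^esub>x\<in>T. g z x)"
    if zC: "z \<in> C" for z
  proof (cases "w \<le> z")
    case True
    let ?d = "\<lambda>x. z x - w x"
    let ?D = "{u. \<forall>x. u x \<le> ?d x}"
    have dH: "?d \<in> exponents H" by (rule exp_diff_mem[OF C_exponents[OF zC]])
    have le: "exp_add w x \<le> z \<longleftrightarrow> x \<in> ?D" for x
    proof -
      have "w y + x y \<le> z y \<longleftrightarrow> x y \<le> z y - w y" for y using True by (auto simp: le_fun_def le_diff_conv2 add.commute)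
      then show ?thesis by (simp add: exp_add_def le_fun_def)
    qed
    have D: "finite ?D" by (rule finite_below_exponent[OF finite_H dH])
    have DT: "?D \<subseteq> T"
    proof
      fix x assume "x \<in> ?D"
      then have "\<forall>y. x y \<le> z y" using diff_le_self le_trans by blast
      then show "x \<in> T" using zC by (auto simp: T_def)
    qed
    have "lam z \<otimes>\<^bsub>R\<^esub> (q \<otimes>\<^bsub>P\<^esub> p) ?d = lam z \<otimes>\<^bsub>R\<^esub> (\<Oplus>\<^bsub>R\<^esub>u\<in>?D. q u \<otimes>\<^bsub>R\<^esub> p (\<lambda>x. ?d x - u x))"
      using dH by (simp add: exp_poly_ring_def)
    also have "\<dots> = (\<Oplus>\<^bsub>R\<^esub>u\<in>?D. lam z \<otimes>\<^bsub>R\<^esub> (q u \<otimes>\<^bsub>R\<^esub> p (\<lambda>x. ?d x - u x)))"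
      using D p q by (intro R.finsum_rdistr) auto
    also have "\<dots> = (\<Oplus>\<^bsub>R\<^esub>x\<in>T. g z x)"
    proof (rule R.add.finprod_mono_neutral_cong_left[OF T DT])
      show "g z x = \<zero>\<^bsub>R\<^esub>" if "x \<in> T - ?D" for x
      proof -
        have "\<not> exp_add w x \<le> z" using that le by blast
        then show ?thesis by (simp add: g_def)
      qed
      show "lam z \<otimes>\<^bsub>R\<^esub> (q x \<otimes>\<^bsub>R\<^esub> p (\<lambda>y. ?d y - x y)) = g z x" if "x \<in> ?D" for x
        using that le[of x] p q by (simp add: g_def exp_add_def R.m_lcomm)
    qed (use gc in auto)
    finally show ?thesis using True by simp
  next
    case False
    have "\<not> exp_add w x \<le> z" for x
      using False by (auto simp: le_fun_def exp_add_def) (meson add_leD1)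
    then show ?thesis using False by (simp add: g_def)
  qed
  have "phi w (q \<otimes>\<^bsub>P\<^esub> p) = (\<Oplus>\<^bsub>R\<^esub>z\<in>C. \<Oplus>\<^bsub>R\<^esub>x\<in>T. g z x)"
    unfolding phi_def using inner gc by (intro R.finsum_cong' refl Pi_I R.finsum_closed) auto
  also have "\<dots> = (\<Oplus>\<^bsub>R\<^esub>x\<in>T. \<Oplus>\<^bsub>R\<^esub>z\<in>C. g z x)"
    using finite_C T gc by (intro R.finsum_swap) auto
  also have "\<dots> = (\<Oplus>\<^bsub>R\<^esub>x\<in>T. \<zero>\<^bsub>R\<^esub>)"
  proof (rule R.finsum_cong'[OF refl])
    fix x assume x: "x \<in> T"
    have "(\<Oplus>\<^bsub>R\<^esub>z\<in>C. g z x) = q x \<otimes>\<^bsub>R\<^esub> phi (exp_add w x) p"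
      unfolding phi_def using p q finite_C
      by (subst R.finsum_rdistr) (auto intro!: R.finsum_cong' simp: g_def)
    then show "(\<Oplus>\<^bsub>R\<^esub>z\<in>C. g z x) = \<zero>\<^bsub>R\<^esub>"
      using z[OF exp_add_mem[OF w TH[OF x]]] q by simp
  qed auto
  finally show ?thesis by simp
qed

lemma annihilated_ideal: "ideal annihilated P"
proof (rule idealI)
  have sub: "p \<in> pcoeffs" if "p \<in> annihilated" for p using that by (simp add: annihilated_def)
  have add: "p \<oplus>\<^bsub>P\<^esub> q \<in> annihilated" if "p \<in> annihilated" "q \<in> annihilated" for p q
    using that P.a_closed[of p q] phi_add[of p q] by (auto simp: annihilated_def carrier_P)
  have mult: "q \<otimes>\<^bsub>P\<^esub> p \<in> annihilated" if "p \<in> annihilated" "q \<in> carrier P" for p q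
    using that P.m_closed[of q p] phi_mult[of p q] by (auto simp: annihilated_def carrier_P)
  have zero: "\<zero>\<^bsub>P\<^esub> \<in> annihilated"
    using P.zero_closed phi_zero by (auto simp: annihilated_def carrier_P)
  have inv: "\<ominus>\<^bsub>P\<^esub> p \<in> annihilated" if "p \<in> annihilated" for p
    using mult[OF that, of "\<ominus>\<^bsub>P\<^esub> \<one>\<^bsub>P\<^esub>"] sub[OF that] by (simp add: P.l_minus flip: carrier_P)
  show "subgroup annihilated (add_monoid P)"
    by (rule P.add.subgroupI) (use sub add zero inv in \<open>auto simp: a_inv_def carrier_P\<close>)
  show "q \<otimes>\<^bsub>P\<^esub> p \<in> annihilated" "p \<otimes>\<^bsub>P\<^esub> q \<in> annihilated" if "p \<in> annihilated" "q \<in> carrier P" for p q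
    using mult[OF that] P_mult_comm[of p q] that sub by (auto simp: carrier_P)
qed (rule ring_P)

lemma lam_val: "z \<in> C \<Longrightarrow> L.val z = lam z \<odot>\<^bsub>L\<^esub> L.val m" and lam_nonzero: "z \<in> C \<Longrightarrow> lam z \<noteq> \<zero>\<^bsub>R\<^esub>"
proof -
  assume "z \<in> C"
  then obtain c where c: "c \<in> carrier R" "c \<noteq> \<zero>\<^bsub>R\<^esub>" "L.val z = c \<odot>\<^bsub>L\<^esub> L.val m" using C by (auto simp: fibre_def)
  then have "lam z = c" using L.co_term[OF c(1) m] by (simp add: lam_def L.single_def)
  then show "L.val z = lam z \<odot>\<^bsub>L\<^esub> L.val m" "lam z \<noteq> \<zero>\<^bsub>R\<^esub>" using c by auto
qed

lemma C_move_iff: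
  assumes p: "p \<in> K" "p a \<noteq> \<zero>\<^bsub>R\<^esub>" "p b \<noteq> \<zero>\<^bsub>R\<^esub>" and C: "exp_add a w \<in> C"
  shows "exp_add b w \<in> C"
proof -
  have "a \<le> exp_add a w" "exp_add (\<lambda>x. exp_add a w x - a x) b = exp_add b w"
    by (auto simp: exp_add_def le_fun_def)
  then have "exp_add b w \<in> moves K (exp_add a w)" unfolding moves_def using p by force
  then show ?thesis using C_moves[OF C] by blast
qed

lemma phi_summand:
  fixes w z :: "'a \<Rightarrow> nat"
  assumes "w \<in> exponents H" "w \<le> z" "p (\<lambda>x. z x - w x) \<noteq> \<zero>\<^bsub>R\<^esub>"
  obtains a where "p a \<noteq> \<zero>\<^bsub>R\<^esub>" "z = exp_add a w" "a = (\<lambda>x. z x - w x)"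
proof (rule that[OF assms(3)])
  show "z = exp_add (\<lambda>x. z x - w x) w"
    using exp_add_diff[OF assms(2)] exp_add_commute by metis
qed (rule refl)

text \<open> Multiplied by \<open>H^w\<close>, a generator with two exponents has both or none of them in \<open>C\<close>, and one
  with a single exponent none, because that monomial vanishes in \<open>L\<close> whereas fibres avoid zero. \<close>

lemma phi_kernel:
  assumes p: "p \<in> K" and w: "w \<in> exponents H"
  shows "phi w p = \<zero>\<^bsub>R\<^esub>"
proof -
  have pc: "p \<in> pcoeffs" and pk: "p \<in> eval_kernel R H L" using p K_sub eval_kernel_sub by auto
  let ?f = "\<lambda>z :: 'a \<Rightarrow> nat. if w \<le> z then lam z \<otimes>\<^bsub>R\<^esub> p (\<lambda>x. z x - w x) else \<zero>\<^bsub>R\<^esub>"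
  have f_exp: "?f (exp_add a w) = lam (exp_add a w) \<otimes>\<^bsub>R\<^esub> p a" for a
    by (simp add: exp_add_def le_fun_def)
  have f_zero: "?f z = \<zero>\<^bsub>R\<^esub>" if "\<And>a. p a \<noteq> \<zero>\<^bsub>R\<^esub> \<Longrightarrow> z \<noteq> exp_add a w" for z
  proof (rule ccontr)
    assume "?f z \<noteq> \<zero>\<^bsub>R\<^esub>"
    then have "w \<le> z" "p (\<lambda>x. z x - w x) \<noteq> \<zero>\<^bsub>R\<^esub>" by (auto split: if_splits)
    then obtain a where "p a \<noteq> \<zero>\<^bsub>R\<^esub>" "z = exp_add a w"
      using phi_summand[OF w, of z p] by blast
    then show False using that by blast
  qed
  show ?thesis
  proof (cases "\<exists>a. p a \<noteq> \<zero>\<^bsub>R\<^esub> \<and> exp_add a w \<in> C")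
    case False
    then have "?f z = \<zero>\<^bsub>R\<^esub>" if "z \<in> C" for z using f_zero[of z] that by blast
    then have "phi w p = (\<Oplus>\<^bsub>R\<^esub>z\<in>C. \<zero>\<^bsub>R\<^esub>)" unfolding phi_def by (intro R.finsum_cong' refl Pi_I) auto
    then show ?thesis by simp
  next
    case True
    then obtain a where a: "p a \<noteq> \<zero>\<^bsub>R\<^esub>" "exp_add a w \<in> C" by blast
    have va: "L.val a \<otimes>\<^bsub>L\<^esub> L.val w \<noteq> \<zero>\<^bsub>L\<^esub>"
      using lam_val[OF a(2)] lam_nonzero[OF a(2)] L.term_nonzero[OF m] by (simp add: L.val_add)
    have "\<exists>b. p b \<noteq> \<zero>\<^bsub>R\<^esub> \<and> b \<noteq> a"
    proof (rule ccontr)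
      assume "\<not> (\<exists>b. p b \<noteq> \<zero>\<^bsub>R\<^esub> \<and> b \<noteq> a)"
      then have "{b. p b \<noteq> \<zero>\<^bsub>R\<^esub>} = {a}" using a by auto
      then have "L.lc p = p a \<odot>\<^bsub>L\<^esub> L.val a" using pc by (simp add: lin_comb_def)
      then have z: "p a \<odot>\<^bsub>L\<^esub> L.val a = \<zero>\<^bsub>L\<^esub>" using pk by (simp add: eval_kernel_def)
      have pa: "p a \<in> carrier R" using pc by simp
      have "p a \<odot>\<^bsub>L\<^esub> (L.val a \<otimes>\<^bsub>L\<^esub> L.val w) = \<zero>\<^bsub>L\<^esub>"
        using z L.A.smult_assoc2[OF pa, of "L.val a" "L.val w"] by simp
      then have "(p a \<otimes>\<^bsub>R\<^esub> lam (exp_add a w)) \<odot>\<^bsub>L\<^esub> L.val m = \<zero>\<^bsub>L\<^esub>"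
        using lam_val[OF a(2)] pa by (simp add: L.val_add L.A.smult_assoc1)
      then show False
        using L.term_nonzero[OF m, of "p a \<otimes>\<^bsub>R\<^esub> lam (exp_add a w)"] pa a(1) lam_nonzero[OF a(2)]
          R.integral[OF _ pa lam_closed[of "exp_add a w"]] by auto
    qed
    then obtain b where b: "p b \<noteq> \<zero>\<^bsub>R\<^esub>" "b \<noteq> a" by blast
    have bC: "exp_add b w \<in> C" by (rule C_move_iff[of p a b w, OF p a(1) b(1) a(2)])
    have supp: "{x. p x \<noteq> \<zero>\<^bsub>R\<^esub>} = {a, b}"
    proof (rule card_seteq[symmetric])
      show "finite {x. p x \<noteq> \<zero>\<^bsub>R\<^esub>}" by (rule pcoeffs_finite[OF pc])
      show "{a, b} \<subseteq> {x. p x \<noteq> \<zero>\<^bsub>R\<^esub>}" using a b by auto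
      show "card {x. p x \<noteq> \<zero>\<^bsub>R\<^esub>} \<le> card {a, b}" using K2 p b(2) by auto
    qed
    have ne: "exp_add a w \<noteq> exp_add b w" using b(2) by (auto simp: exp_add_def fun_eq_iff dest: not_sym)
    have cp: "p a \<in> carrier R" "p b \<in> carrier R" using pc by auto
    have "phi w p = (\<Oplus>\<^bsub>R\<^esub>z\<in>{exp_add a w, exp_add b w}. ?f z)"
      unfolding phi_def
    proof (rule R.add.finprod_mono_neutral_cong_right[OF finite_C])
      show "?f z = \<zero>\<^bsub>R\<^esub>" if "z \<in> C - {exp_add a w, exp_add b w}" for z
      proof (rule f_zero)
        fix x assume "p x \<noteq> \<zero>\<^bsub>R\<^esub>"
        then have "x \<in> {a, b}" using supp by blast
        then show "z \<noteq> exp_add x w" using that by auto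
      qed
    qed (use a(2) bC pc in auto)
    also have "\<dots> = ?f (exp_add a w) \<oplus>\<^bsub>R\<^esub> ?f (exp_add b w)"
      using ne pc by (subst R.finsum_insert) auto
    also have "\<dots> = lam (exp_add a w) \<otimes>\<^bsub>R\<^esub> p a \<oplus>\<^bsub>R\<^esub> lam (exp_add b w) \<otimes>\<^bsub>R\<^esub> p b"
      unfolding f_exp ..
    finally have phi: "phi w p = lam (exp_add a w) \<otimes>\<^bsub>R\<^esub> p a \<oplus>\<^bsub>R\<^esub> lam (exp_add b w) \<otimes>\<^bsub>R\<^esub> p b" .
    have "(p a \<odot>\<^bsub>L\<^esub> L.val a \<oplus>\<^bsub>L\<^esub> p b \<odot>\<^bsub>L\<^esub> L.val b) \<otimes>\<^bsub>L\<^esub> L.val w = \<zero>\<^bsub>L\<^esub>"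
      using kernel_pair[OF pk _ a(1) b(1) b(2)[symmetric]] K2 p by simp
    then have "p a \<odot>\<^bsub>L\<^esub> L.val (exp_add a w) \<oplus>\<^bsub>L\<^esub> p b \<odot>\<^bsub>L\<^esub> L.val (exp_add b w) = \<zero>\<^bsub>L\<^esub>"
      using cp by (simp add: L.val_add L.A.l_distr L.A.smult_assoc2)
    then have "phi w p \<odot>\<^bsub>L\<^esub> L.val m = \<zero>\<^bsub>L\<^esub>"
      unfolding phi lam_val[OF a(2)] lam_val[OF bC]
      using cp by (simp add: L.A.smult_l_distr L.A.smult_assoc1 R.m_comm[of "lam _"])
    then show ?thesis using L.term_nonzero[OF m phi_closed[OF pc]] by blast
  qed
qed

lemma fibre_connected: "C = fibre m"
proof
  show "C \<subseteq> fibre m" by (rule C)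
  have "K \<subseteq> annihilated"
    using phi_kernel K_sub eval_kernel_sub by (auto simp: annihilated_def)
  then have ker: "eval_kernel R H L \<subseteq> annihilated"
    using annihilated_ideal unfolding K_gen[symmetric] genideal_def by blast
  show "fibre m \<subseteq> C"
  proof
    fix u assume u: "u \<in> fibre m"
    show "u \<in> C"
    proof (rule ccontr)
      assume uC: "u \<notin> C"
      obtain c where c: "c \<in> carrier R" "c \<noteq> \<zero>\<^bsub>R\<^esub>" "L.val u = c \<odot>\<^bsub>L\<^esub> L.val m" using u by (auto simp: fibre_def)
      have uH: "u \<in> exponents H" and mH: "m \<in> exponents H" using u m by (auto simp: fibre_def)
      define p where "p = (\<lambda>x. L.single \<one>\<^bsub>R\<^esub> u x \<oplus>\<^bsub>R\<^esub> L.single (\<ominus>\<^bsub>R\<^esub> c) m x)"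
      have s: "L.single \<one>\<^bsub>R\<^esub> u \<in> pcoeffs" "L.single (\<ominus>\<^bsub>R\<^esub> c) m \<in> pcoeffs"
        using c uH mH by (auto intro: L.single_coeffs)
      have "L.lc p = \<one>\<^bsub>R\<^esub> \<odot>\<^bsub>L\<^esub> L.val u \<oplus>\<^bsub>L\<^esub> (\<ominus>\<^bsub>R\<^esub> c) \<odot>\<^bsub>L\<^esub> L.val m"
        unfolding p_def using L.lc_add(1)[OF s] c uH mH by (simp add: L.lc_single)
      also have "\<dots> = \<zero>\<^bsub>L\<^esub>"
        using c by (simp add: L.A.smult_l_minus L.A.r_neg)
      finally have "p \<in> eval_kernel R H L"
        using L.lc_add(2)[OF s] by (simp add: eval_kernel_def carrier_P p_def)
      then have z: "phi (\<lambda>_. 0) p = \<zero>\<^bsub>R\<^esub>"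
        using ker by (auto simp: annihilated_def exponents_def)
      have pu: "p z = (if z = m then \<ominus>\<^bsub>R\<^esub> c else \<zero>\<^bsub>R\<^esub>)" if "z \<in> C" for z
        using that uC c by (auto simp: p_def L.single_def)
      have "phi (\<lambda>_. 0) p = (\<Oplus>\<^bsub>R\<^esub>z\<in>C. if z = m then \<ominus>\<^bsub>R\<^esub> c else \<zero>\<^bsub>R\<^esub>)"
        unfolding phi_def using c pu lam_m
        by (intro R.finsum_cong' refl Pi_I) (auto simp: le_fun_def)
      also have "\<dots> = \<ominus>\<^bsub>R\<^esub> c"
        using R.finsum_singleton[OF mC finite_C, of "\<lambda>_. \<ominus>\<^bsub>R\<^esub> c"] c by (simp add: eq_commute)
      finally show False using z c by (metis R.minus_minus R.minus_zero)
    qed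
  qed
qed

end

end

section \<open>Structured programs\<close>

text \<open> By determinism a single known run describes all runs on the same input. Stated as
  equivalences, the evaluation rules let the simplifier execute programs. \<close>

lemma exec_iff: "exec R sub p x y \<Longrightarrow> exec R sub p x z \<longleftrightarrow> z = y"
  using exec_deterministic by blast

lemma exec_simps [simp]:
  "exec R sub Skip x y \<longleftrightarrow> y = x"
  "exec R sub MkLeaf x y \<longleftrightarrow> y = Leaf"
  "exec R sub (MkNode p q) x y \<longleftrightarrow> (\<exists>a b. exec R sub p x a \<and> exec R sub q x b \<and> y = Node a b)"
  "exec R sub GoLeft (Node a b) y \<longleftrightarrow> y = a"
  "exec R sub GoRight (Node a b) y \<longleftrightarrow> y = b"
  "exec R sub (Then p q) x y \<longleftrightarrow> (\<exists>z. exec R sub p x z \<and> exec R sub q z y)"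
  "exec R sub FZero x y \<longleftrightarrow> y = Scal \<zero>\<^bsub>R\<^esub>"
  "exec R sub FOne x y \<longleftrightarrow> y = Scal \<one>\<^bsub>R\<^esub>"
  "exec R sub FAdd (Node (Scal c) (Scal d)) y \<longleftrightarrow> y = Scal (c \<oplus>\<^bsub>R\<^esub> d)"
  "exec R sub FNeg (Scal c) y \<longleftrightarrow> y = Scal (\<ominus>\<^bsub>R\<^esub> c)"
  "exec R sub FMult (Node (Scal c) (Scal d)) y \<longleftrightarrow> y = Scal (c \<otimes>\<^bsub>R\<^esub> d)"
  "c \<noteq> \<zero>\<^bsub>R\<^esub> \<Longrightarrow> exec R sub FInv (Scal c) y \<longleftrightarrow> y = Scal (inv\<^bsub>R\<^esub> c)"
  "exec R sub FEq (Node (Scal c) (Scal d)) y \<longleftrightarrow> y = enc_bool (c = d)"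
  "exec R sub (Call s) x y \<longleftrightarrow> y = sub s x"
  by (auto intro: exec.intros elim: exec_elims)

lemma exec_IfLeaf [simp]:
  "exec R sub (IfLeaf b p q) x y \<longleftrightarrow>
    (\<exists>v. exec R sub b x v \<and> (if v = Leaf then exec R sub p x y else exec R sub q x y))"
proof
  assume "\<exists>v. exec R sub b x v \<and> (if v = Leaf then exec R sub p x y else exec R sub q x y)"
  then obtain v where v: "exec R sub b x v" "if v = Leaf then exec R sub p x y else exec R sub q x y"
    by blast
  then show "exec R sub (IfLeaf b p q) x y"
    by (cases "v = Leaf") (auto intro: exec_IfLeaf1 exec_IfLeaf2)
qed (auto elim!: exec_elims(7))

lemma enc_bool_Leaf [simp]: "enc_bool b = Leaf \<longleftrightarrow> \<not> b" "Leaf = enc_bool b \<longleftrightarrow> \<not> b"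
  by (cases b; simp)+

lemma enc_list_Leaf [simp]: "enc_list xs = Leaf \<longleftrightarrow> xs = []"
  by (cases xs) auto

definition true_prog where "true_prog = MkNode MkLeaf MkLeaf"

lemma exec_true [simp]: "exec R sub true_prog x y \<longleftrightarrow> y = enc_bool True"
  by (auto simp: true_prog_def)

text \<open> Programs act on a single tree, which serves as an environment. \<open>Fold l i body\<close> evaluates the
  list \<open>l\<close> and the initial accumulator \<open>i\<close> in the environment \<open>env\<close> and then runs \<open>body\<close> on
  \<open>Node x (Node a env)\<close> for each list item \<open>x\<close> and current accumulator \<open>a\<close>; inside a body, \<open>Out p\<close>
  evaluates \<open>p\<close> in \<open>env\<close>. Local bindings are made with \<open>Then (MkNode e Skip) p\<close>, which runs \<open>p\<close> in the
  environment extended by the value of \<open>e\<close> on the left. \<close>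

definition Fold :: "prog \<Rightarrow> prog \<Rightarrow> prog \<Rightarrow> prog" where
  "Fold l i body = Then (MkNode l (MkNode i Skip))
    (Then (WhileNode GoLeft
      (MkNode (Then GoLeft GoRight)
        (MkNode (Then (MkNode (Then GoLeft GoLeft) GoRight) body) (Then GoRight GoRight))))
    (Then GoRight GoLeft))"

abbreviation item where "item \<equiv> GoLeft"
abbreviation acc where "acc \<equiv> Then GoRight GoLeft"
abbreviation Out where "Out p \<equiv> Then GoRight (Then GoRight p)"

lemma exec_Fold:
  assumes l: "exec R sub l env (enc_list xs)" and i: "exec R sub i env a0" and P0: "P [] a0"
    and step: "\<And>ys x zs a. xs = ys @ x # zs \<Longrightarrow> P ys a \<Longrightarrow>
      \<exists>a'. exec R sub body (Node x (Node a env)) a' \<and> P (ys @ [x]) a'"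
  shows "\<exists>a. exec R sub (Fold l i body) env a \<and> P xs a"
proof -
  let ?loop = "MkNode (Then GoLeft GoRight)
    (MkNode (Then (MkNode (Then GoLeft GoLeft) GoRight) body) (Then GoRight GoRight))"
  have "\<exists>a'. exec R sub (WhileNode GoLeft ?loop) (Node (enc_list zs) (Node a env)) (Node Leaf (Node a' env))
      \<and> P xs a'" if "xs = ys @ zs" "P ys a" for ys zs a
    using that
  proof (induction zs arbitrary: ys a)
    case Nil
    have "exec R sub (WhileNode GoLeft ?loop) (Node (enc_list []) (Node a env)) (Node Leaf (Node a env))"
      by simp (rule exec_While1, simp)
    then show ?case using Nil by auto
  next
    case (Cons z zs)
    obtain a1 where a1: "exec R sub body (Node z (Node a env)) a1" "P (ys @ [z]) a1"
      using step[of ys z zs a] Cons.prems by blast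
    obtain a' where a': "exec R sub (WhileNode GoLeft ?loop) (Node (enc_list zs) (Node a1 env)) (Node Leaf (Node a' env))"
      "P xs a'"
      using Cons.IH[of "ys @ [z]" a1] Cons.prems a1(2) by auto
    have "exec R sub ?loop (Node (enc_list (z # zs)) (Node a env)) (Node (enc_list zs) (Node a1 env))"
      using a1(1) by auto
    then have "exec R sub (WhileNode GoLeft ?loop) (Node (enc_list (z # zs)) (Node a env)) (Node Leaf (Node a' env))"
      using a'(1) by (rule exec_While2[where v = "enc_list (z # zs)", rotated 2]) auto
    then show ?case using a'(2) by blast
  qed
  from this[of "[]" xs a0] P0 obtain a' where
    w: "exec R sub (WhileNode GoLeft ?loop) (Node (enc_list xs) (Node a0 env)) (Node Leaf (Node a' env))" "P xs a'"
    by auto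
  have s: "exec R sub (MkNode l (MkNode i Skip)) env (Node (enc_list xs) (Node a0 env))"
    using l i by auto
  have "exec R sub (Fold l i body) env a'"
    unfolding Fold_def by (rule exec_Then[OF s], rule exec_Then[OF w(1)]) simp
  with w(2) show ?thesis by blast
qed

lemma exec_Fold_map:
  assumes l: "exec R sub l env (enc_list (map ex xs))" and i: "exec R sub i env a0" and P0: "P [] a0"
    and step: "\<And>ys x zs a. xs = ys @ x # zs \<Longrightarrow> P ys a \<Longrightarrow>
      \<exists>a'. exec R sub body (Node (ex x) (Node a env)) a' \<and> P (ys @ [x]) a'"
  shows "\<exists>a. exec R sub (Fold l i body) env a \<and> P xs a"
proof -
  have "\<exists>a. exec R sub (Fold l i body) env a \<and> P (take (length (map ex xs)) xs) a"
  proof (rule exec_Fold[where P = "\<lambda>ys. P (take (length ys) xs)", OF l i])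
    fix ys x zs a assume eq: "map ex xs = ys @ x # zs" and a: "P (take (length ys) xs) a"
    have len: "length ys < length xs" using arg_cong[OF eq, of length] by simp
    have x: "x = ex (xs ! length ys)" using len arg_cong[OF eq, of "\<lambda>l. l ! length ys"] by simp
    show "\<exists>a'. exec R sub body (Node x (Node a env)) a' \<and> P (take (length (ys @ [x])) xs) a'"
      using step[OF id_take_nth_drop[OF len] a] len unfolding x by (simp add: take_Suc_conv_app_nth)
  qed (simp add: P0)
  then show ?thesis by simp
qed

lemma exec_fold:
  assumes l: "exec R sub l env (enc_list (map ex xs))" and i: "exec R sub i env (ea a0)"
    and step: "\<And>x a. x \<in> set xs \<Longrightarrow> exec R sub body (Node (ex x) (Node (ea a) env)) (ea (f x a))"
  shows "exec R sub (Fold l i body) env (ea (fold f xs a0))"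
proof -
  have "\<exists>a. exec R sub (Fold l i body) env a \<and> a = ea (fold f xs a0)"
    by (rule exec_Fold_map[where P = "\<lambda>ys a. a = ea (fold f ys a0)", OF l i]) (use step in auto)
  then show ?thesis by auto
qed

lemma exec_fold_any:
  assumes l: "exec R sub l env (enc_list (map ex xs))" and i: "exec R sub i env Leaf"
    and step: "\<And>x a. x \<in> set xs \<Longrightarrow> exec R sub body (Node (ex x) (Node (enc_bool a) env)) (enc_bool (Q x \<or> a))"
  shows "exec R sub (Fold l i body) env (enc_bool (\<exists>x\<in>set xs. Q x))"
proof -
  have "exec R sub (Fold l i body) env (enc_bool (fold (\<lambda>x a. Q x \<or> a) xs False))"
    by (rule exec_fold[OF l]) (use i step in auto)
  moreover have "fold (\<lambda>x a. Q x \<or> a) xs b = (b \<or> (\<exists>x\<in>set xs. Q x))" for b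
    by (induction xs arbitrary: b) auto
  ultimately show ?thesis by simp
qed

section \<open>Arithmetic of exponents\<close>

lemma enc_nat_simps [simp]: "enc_nat 0 = Leaf" "enc_nat (Suc n) = Node Leaf (enc_nat n)"
  by (simp_all add: enc_nat_def)

lemma enc_nat_Leaf [simp]: "enc_nat n = Leaf \<longleftrightarrow> n = 0"
  by (cases n) auto

definition monus_prog where
  "monus_prog = Fold GoRight GoLeft (IfLeaf acc MkLeaf (Then acc GoRight))"

lemma exec_monus:
  fixes R :: "('r, 'm) ring_scheme"
  shows "exec R sub monus_prog (Node (enc_nat n) (enc_nat m)) (enc_nat (n - m))"
proof -
  have "exec R sub monus_prog (Node (enc_nat n) (enc_nat m))
      (enc_nat (fold (\<lambda>_ a. a - 1) (replicate m (Leaf :: 'r data)) n))"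
    unfolding monus_prog_def
  proof (rule exec_fold[where ex = "\<lambda>x. x" and ea = enc_nat])
    fix x :: "'r data" and a :: nat
    show "exec R sub (IfLeaf acc MkLeaf (Then acc GoRight))
        (Node x (Node (enc_nat a) (Node (enc_nat n) (enc_nat m)))) (enc_nat (a - 1))"
      by (cases a) auto
  qed (auto simp: enc_nat_def)
  moreover have "fold (\<lambda>_ a. a - 1) (replicate m (Leaf :: 'r data)) n = n - m" by (induction m arbitrary: n) auto
  ultimately show ?thesis by simp
qed

definition add_prog where
  "add_prog = Fold GoLeft GoRight (MkNode MkLeaf acc)"

lemma exec_add:
  fixes R :: "('r, 'm) ring_scheme"
  shows "exec R sub add_prog (Node (enc_nat n) (enc_nat m)) (enc_nat (n + m))"
proof -
  have "exec R sub add_prog (Node (enc_nat n) (enc_nat m))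
      (enc_nat (fold (\<lambda>_ a. Suc a) (replicate n (Leaf :: 'r data)) m))"
    unfolding add_prog_def
    by (rule exec_fold[where ex = "\<lambda>x. x" and ea = enc_nat]) (auto simp: enc_nat_def)
  moreover have "fold (\<lambda>_ a. Suc a) (replicate n (Leaf :: 'r data)) m = n + m" by (induction n arbitrary: m) auto
  ultimately show ?thesis by simp
qed

definition rev_prog where "rev_prog = Fold Skip MkLeaf (MkNode item acc)"

lemma exec_rev: "exec R sub rev_prog (enc_list xs) (enc_list (rev xs))"
proof -
  have "exec R sub rev_prog (enc_list xs) (enc_list (fold (#) xs []))"
    unfolding rev_prog_def by (rule exec_fold[where ex = "\<lambda>x. x" and ea = enc_list]) auto
  then show ?thesis by (simp add: rev_conv_fold)
qed

text \<open> The accumulator holds the rest of the second list and the results so far, last one first. \<close>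

definition Zip where
  "Zip p = Then (Fold GoLeft (MkNode GoRight MkLeaf)
      (MkNode (Then acc (Then GoLeft GoRight))
        (MkNode (Then (MkNode item (Then acc (Then GoLeft GoLeft))) p) (Then acc GoRight))))
    (Then GoRight rev_prog)"

lemma exec_Zip:
  assumes "\<And>h. h \<in> set hs \<Longrightarrow> exec R sub p (Node (e1 h) (e2 h)) (e3 h)"
  shows "exec R sub (Zip p) (Node (enc_list (map e1 hs)) (enc_list (map e2 hs))) (enc_list (map e3 hs))"
proof -
  define P where "P ys a \<longleftrightarrow> a = Node (enc_list (drop (length ys) (map e2 hs)))
    (enc_list (rev (take (length ys) (map e3 hs))))" for ys :: "'b data list" and a
  let ?env = "Node (enc_list (map e1 hs)) (enc_list (map e2 hs))"
  let ?body = "MkNode (Then acc (Then GoLeft GoRight))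
        (MkNode (Then (MkNode item (Then acc (Then GoLeft GoLeft))) p) (Then acc GoRight))"
  have "\<exists>a. exec R sub (Fold GoLeft (MkNode GoRight MkLeaf) ?body) ?env a \<and> P (map e1 hs) a"
  proof (rule exec_Fold[where P = P])
    fix ys x zs a assume eq: "map e1 hs = ys @ x # zs" and a: "P ys a"
    let ?n = "length ys"
    have len: "?n < length hs" using arg_cong[OF eq, of length] by simp
    have x: "x = e1 (hs ! ?n)" using len arg_cong[OF eq, of "\<lambda>l. l ! ?n"] by simp
    have dr: "drop ?n (map e2 hs) = e2 (hs ! ?n) # drop (Suc ?n) (map e2 hs)"
      using len by (simp add: Cons_nth_drop_Suc[symmetric])
    have tk: "take (Suc ?n) (map e3 hs) = take ?n (map e3 hs) @ [e3 (hs ! ?n)]"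
      using len by (simp add: take_Suc_conv_app_nth)
    have "exec R sub p (Node (e1 (hs ! ?n)) (e2 (hs ! ?n))) (e3 (hs ! ?n))" using assms len by simp
    then show "\<exists>a'. exec R sub ?body (Node x (Node a ?env)) a' \<and> P (ys @ [x]) a'"
      using a unfolding P_def x dr by (auto simp: tk simp del: take_map drop_map)
  qed (auto simp: P_def)
  then show ?thesis
    using exec_rev[of R sub "rev (map e3 hs)"] unfolding Zip_def P_def by (auto simp: rev_map)
qed

abbreviation "exp_monus_prog \<equiv> Zip monus_prog"
abbreviation "exp_add_prog \<equiv> Zip add_prog"

lemma exec_exp_monus: "exec R sub exp_monus_prog (Node (enc_exp hs u) (enc_exp hs w)) (enc_exp hs (\<lambda>x. u x - w x))"
  unfolding enc_exp_def by (rule exec_Zip) (rule exec_monus)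

lemma exec_exp_add: "exec R sub exp_add_prog (Node (enc_exp hs u) (enc_exp hs w)) (enc_exp hs (exp_add u w))"
  unfolding enc_exp_def exp_add_def by (rule exec_Zip) (rule exec_add)

definition exp_pos_prog where
  "exp_pos_prog = Fold Skip MkLeaf (IfLeaf item acc true_prog)"

lemma exec_exp_pos: "exec R sub exp_pos_prog (enc_exp hs u) (enc_bool (\<exists>h\<in>set hs. u h \<noteq> 0))"
  unfolding exp_pos_prog_def enc_exp_def
  by (rule exec_fold_any[where ex = "\<lambda>h. enc_nat (u h)"]) auto

definition exp_le_prog where
  "exp_le_prog = IfLeaf (Then exp_monus_prog exp_pos_prog) true_prog MkLeaf"

lemma exec_exp_le:
  "exec R sub exp_le_prog (Node (enc_exp hs u) (enc_exp hs w)) (enc_bool (\<forall>h\<in>set hs. u h \<le> w h))"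
  unfolding exp_le_prog_def
  using exec_exp_monus[of R sub hs u w] exec_exp_pos[of R sub hs "\<lambda>x. u x - w x"]
  by (auto simp: exec_iff[OF exec_exp_monus] exec_iff[OF exec_exp_pos])

definition exp_eq_prog where
  "exp_eq_prog = IfLeaf exp_le_prog MkLeaf (Then (MkNode GoRight GoLeft) exp_le_prog)"

lemma exec_exp_eq:
  "exec R sub exp_eq_prog (Node (enc_exp hs u) (enc_exp hs w)) (enc_bool (\<forall>h\<in>set hs. u h = w h))"
proof -
  have "(\<forall>h\<in>set hs. u h = w h) \<longleftrightarrow> (\<forall>h\<in>set hs. u h \<le> w h) \<and> (\<forall>h\<in>set hs. w h \<le> u h)"
    by (auto simp: order.eq_iff)
  then show ?thesis unfolding exp_eq_prog_def by (simp add: exec_iff[OF exec_exp_le])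
qed

lemma exec_exp_le_iff:
  assumes "u \<in> exponents (set hs)"
  shows "exec R sub exp_le_prog (Node (enc_exp hs u) (enc_exp hs w)) y \<longleftrightarrow> y = enc_bool (u \<le> w)"
proof -
  have "(\<forall>h\<in>set hs. u h \<le> w h) \<longleftrightarrow> u \<le> w"
    using assms by (auto simp: exponents_def le_fun_def)
  then show ?thesis using exec_iff[OF exec_exp_le, of R sub hs u w y] by simp
qed

lemma exec_exp_eq_iff:
  assumes "u \<in> exponents (set hs)" "w \<in> exponents (set hs)"
  shows "exec R sub exp_eq_prog (Node (enc_exp hs u) (enc_exp hs w)) y \<longleftrightarrow> y = enc_bool (u = w)"
proof -
  have "(\<forall>h\<in>set hs. u h = w h) \<longleftrightarrow> u = w"
    using assms by (auto simp: exponents_def fun_eq_iff)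
  then show ?thesis using exec_iff[OF exec_exp_eq, of R sub hs u w y] by simp
qed

lemmas exec_exp_monus_iff = exec_iff[OF exec_exp_monus]
lemmas exec_exp_add_iff = exec_iff[OF exec_exp_add]

section \<open>Lists of terms\<close>

abbreviation enc_term where "enc_term hs t \<equiv> Node (Scal (fst t)) (enc_exp hs (snd t))"

lemma enc_terms_map: "enc_terms hs ts = enc_list (map (enc_term hs) ts)"
  unfolding enc_terms_def by (rule arg_cong[where f = enc_list]) auto

definition coeff_body where
  "coeff_body =
    IfLeaf (Then (MkNode (Then item GoRight) (Out GoRight)) exp_eq_prog) acc
      (Then (MkNode (Then item GoLeft) acc) FAdd)"

definition coeff_prog where
  "coeff_prog = Fold GoLeft FZero coeff_body"

definition zero_prog where "zero_prog = Then (MkNode coeff_prog FZero) FEq"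

context pasl
begin

lemma terms_coeff_mem: "set ts \<subseteq> carrier R \<times> T \<Longrightarrow> terms_coeff R ts \<in> finite_coeffs R T"
proof (induction ts)
  case Nil
  show ?case by (rule finite_coeffsI) auto
next
  case (Cons t ts)
  obtain c m where t: "t = (c, m)" by (cases t)
  have c: "c \<in> carrier R" "m \<in> T" "set ts \<subseteq> carrier R \<times> T" using Cons.prems t by auto
  note IH = Cons.IH[OF c(3)]
  show ?case
  proof (rule finite_coeffsI)
    show "terms_coeff R (t # ts) i \<in> carrier R" for i
      using c fc_closed[OF IH, of i] by (simp add: t)
    show "terms_coeff R (t # ts) i = \<zero>\<^bsub>R\<^esub>" if "i \<notin> T" for i
      using that c finite_coeffsD(2)[OF IH that] by (auto simp: t)
    show "finite {i. terms_coeff R (t # ts) i \<noteq> \<zero>\<^bsub>R\<^esub>}"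
      by (rule finite_subset[of _ "insert m {i. terms_coeff R ts i \<noteq> \<zero>\<^bsub>R\<^esub>}"])
        (auto simp: t finite_coeffsD(3)[OF IH])
  qed
qed

lemma terms_coeff_outside: "m \<notin> snd ` set ts \<Longrightarrow> terms_coeff R ts m = \<zero>\<^bsub>R\<^esub>"
  by (induction ts) auto

lemma terms_coeff_closed: "set ts \<subseteq> carrier R \<times> T \<Longrightarrow> terms_coeff R ts m \<in> carrier R"
  by (rule fc_closed[OF terms_coeff_mem])

definition tval where "tval ts = lc (terms_coeff R ts)"

lemma tval_Nil: "tval [] = \<zero>"
  by (simp add: tval_def lin_comb_def)

abbreviation std_terms where "std_terms ts \<equiv> set ts \<subseteq> carrier R \<times> S"

lemma std_coeff: "std_terms ts \<Longrightarrow> terms_coeff R ts \<in> coeffs"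
  by (rule terms_coeff_mem)

lemma tval_closed: "std_terms ts \<Longrightarrow> tval ts \<in> carrier A"
  unfolding tval_def by (intro lc_closed coeffs_sub std_coeff)

lemma co_tval: "std_terms ts \<Longrightarrow> co (tval ts) = terms_coeff R ts"
  unfolding tval_def by (intro co_lc std_coeff)

lemma tval_Cons:
  assumes "c \<in> carrier R" "m \<in> S" "std_terms ts"
  shows "tval ((c, m) # ts) = c \<odot> val m \<oplus> tval ts"
proof -
  note t = coeffs_sub[OF std_coeff[OF assms(3)]]
  have s: "single c m \<in> pcoeffs" using assms by (intro single_coeffs) auto
  have "terms_coeff R ((c, m) # ts) = (\<lambda>x. single c m x \<oplus>\<^bsub>R\<^esub> terms_coeff R ts x)"
    using t by (auto simp: single_def fun_eq_iff)
  then show ?thesis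
    unfolding tval_def using lc_add(1)[OF s t] lc_single[of c m] assms by simp
qed

lemma tval_snoc:
  assumes "c \<in> carrier R" "m \<in> S" "std_terms ts"
  shows "tval (ts @ [(c, m)]) = tval ts \<oplus> c \<odot> val m"
  using assms(3)
proof (induction ts)
  case Nil
  then show ?case using assms by (simp add: tval_Cons tval_Nil)
next
  case (Cons t ts)
  obtain d n where t: "t = (d, n)" by (cases t)
  have d: "d \<in> carrier R" "n \<in> S" "std_terms ts" using Cons.prems t by auto
  have "tval ((t # ts) @ [(c, m)]) = d \<odot> val n \<oplus> tval (ts @ [(c, m)])"
    using d assms tval_Cons[OF d(1,2), of "ts @ [(c, m)]"] by (simp add: t)
  also have "\<dots> = tval (t # ts) \<oplus> c \<odot> val m"
    using d assms tval_Cons[OF d] Cons.IH[OF d(3)] tval_closed[OF d(3)] by (simp add: t A.a_assoc)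
  finally show ?case .
qed

lemma represents_elem_iff:
  "represents_elem R A H \<Sigma> hs d f \<longleftrightarrow> (\<exists>ts. std_terms ts \<and> d = enc_terms hs ts \<and> f = tval ts)"
proof
  assume "represents_elem R A H \<Sigma> hs d f"
  then obtain ts where ts: "f \<in> carrier A" "std_terms ts" "d = enc_terms hs ts" "co f = terms_coeff R ts"
    by (auto simp: represents_elem_def represents_coeffs_def)
  then have "f = tval ts" unfolding tval_def by (metis lc_co)
  then show "\<exists>ts. std_terms ts \<and> d = enc_terms hs ts \<and> f = tval ts" using ts by blast
next
  assume "\<exists>ts. std_terms ts \<and> d = enc_terms hs ts \<and> f = tval ts"
  then show "represents_elem R A H \<Sigma> hs d f"
    using tval_closed co_tval unfolding represents_elem_def represents_coeffs_def by metis
qed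

end

locale algorithm_setting = leading_pasl R A H \<Sigma> ord L
  for R :: "'r ring" and A :: "('r, 'a) module" (structure) and H :: "'a set" and \<Sigma> :: "('a \<Rightarrow> nat) set"
    and ord :: "('a \<Rightarrow> nat) rel" and L :: "('r, 'a) module" +
  fixes hs :: "'a list" and sub :: "subroutine \<Rightarrow> 'r data \<Rightarrow> 'r data"
    and sgens :: "('a \<Rightarrow> nat) list" and kgens :: "('r \<times> ('a \<Rightarrow> nat)) list list"
  assumes hs: "set hs = H"
    and sub: "correct_subroutines R A H \<Sigma> ord L hs sub"
    and sgens: "set sgens \<subseteq> exponents H" "exp_genideal H (set sgens) = \<Sigma>"
    and kgens: "\<And>ts. ts \<in> set kgens \<Longrightarrow> set ts \<subseteq> carrier R \<times> exponents H"
      "\<forall>p\<in>terms_coeff R ` set kgens. card {m. p m \<noteq> \<zero>\<^bsub>R\<^esub>} \<le> 2"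
      "Idl\<^bsub>exp_poly_ring R H\<^esub> (terms_coeff R ` set kgens) = eval_kernel R H L"
begin

abbreviation ee where "ee \<equiv> enc_exp hs"
abbreviation et where "et \<equiv> enc_terms hs"
abbreviation enc_exps where "enc_exps us \<equiv> enc_list (map ee us)"
abbreviation rep where "rep \<equiv> represents_elem R A H \<Sigma> hs"
abbreviation run where "run \<equiv> exec R sub"

lemma exp_le_iff: "u \<in> exponents H \<Longrightarrow> run exp_le_prog (Node (ee u) (ee w)) y \<longleftrightarrow> y = enc_bool (u \<le> w)"
  using exec_exp_le_iff[of u hs] hs by simp

lemma exp_eq_iff:
  "u \<in> exponents H \<Longrightarrow> w \<in> exponents H \<Longrightarrow> run exp_eq_prog (Node (ee u) (ee w)) y \<longleftrightarrow> y = enc_bool (u = w)"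
  using exec_exp_eq_iff[of u hs w] hs by simp

lemmas exp_simps = exp_le_iff exp_eq_iff exec_exp_monus_iff exec_exp_add_iff

lemma exec_coeff:
  assumes ts: "set ts \<subseteq> carrier R \<times> exponents H" and m: "m \<in> exponents H"
  shows "run coeff_prog (Node (et ts) (ee m)) (Scal (terms_coeff R ts m))"
proof -
  let ?f = "\<lambda>t a. if snd t = m then fst t \<oplus>\<^bsub>R\<^esub> a else a"
  have "run coeff_prog (Node (et ts) (ee m)) (Scal (fold ?f ts \<zero>\<^bsub>R\<^esub>))"
    unfolding coeff_prog_def
  proof (rule exec_fold[where ex = "enc_term hs" and ea = Scal])
    fix t a assume t: "t \<in> set ts"
    then have "snd t \<in> exponents H" using ts by auto
    then show "run coeff_body (Node (enc_term hs t) (Node (Scal a) (Node (et ts) (ee m))))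
      (Scal (?f t a))"
      using m by (simp add: coeff_body_def exp_simps)
  qed (simp_all add: enc_terms_map)
  moreover have "fold ?f ts a = terms_coeff R ts m \<oplus>\<^bsub>R\<^esub> a" if "a \<in> carrier R" for a
    using ts that
  proof (induction ts arbitrary: a)
    case Nil
    then show ?case by simp
  next
    case (Cons t ts)
    have "fst t \<in> carrier R" "terms_coeff R ts m \<in> carrier R"
      using Cons.prems terms_coeff_closed[of ts "exponents H" m] by auto
    then show ?case using Cons by (cases t) (auto simp: R.a_ac)
  qed
  ultimately show ?thesis using terms_coeff_closed[OF ts, of m] by simp
qed

lemma zero_iff:
  assumes "set ts \<subseteq> carrier R \<times> exponents H" and "m \<in> exponents H"
  shows "run zero_prog (Node (et ts) (ee m)) y \<longleftrightarrow> y = enc_bool (terms_coeff R ts m = \<zero>\<^bsub>R\<^esub>)"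
  unfolding zero_prog_def by (simp add: exec_iff[OF exec_coeff[OF assms]])

lemma S_exponents: "m \<in> S \<Longrightarrow> m \<in> exponents H" by simp

lemma std_exponents: "std_terms ts \<Longrightarrow> set ts \<subseteq> carrier R \<times> exponents H" by auto

section \<open>Leading terms and arithmetic\<close>

definition enc_lead where
  "enc_lead f = (if f = \<zero> then Leaf else Node (Scal (lcf f)) (ee (lm f)))"

end

text \<open> A list of terms may repeat monomials and may contain cancelling terms, so a monomial
  competes for the maximum only if its total coefficient is nonzero. \<close>

definition lead_body where
  "lead_body =
    (let better = MkNode (Then (MkNode (Out Skip) (Then item GoRight)) coeff_prog) (Then item GoRight)
     in IfLeaf (Then (MkNode (Out Skip) (Then item GoRight)) zero_prog)
       (IfLeaf acc better
         (IfLeaf (Then (MkNode (Then item GoRight) (Then acc GoRight)) (Call Compare)) better acc))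
       acc)"

definition lead_prog where
  "lead_prog = Fold Skip MkLeaf lead_body"

definition axpy_body where
  "axpy_body =
    MkNode (MkNode (Then (MkNode (Out GoLeft) (Then item GoLeft)) FMult) (Then item GoRight)) acc"

definition axpy_prog where
  "axpy_prog = Fold (Then GoRight GoLeft) (Then GoRight GoRight) axpy_body"

definition mul_body where
  "mul_body =
    Then (MkNode (Then item GoLeft)
        (MkNode (Then (MkNode (Out GoLeft) (Then item GoRight)) (Call MultA)) acc))
      axpy_prog"

definition mul_prog where
  "mul_prog = Fold GoRight MkLeaf mul_body"

context algorithm_setting
begin

lemma compare: "m \<in> S \<Longrightarrow> m' \<in> S \<Longrightarrow> sub Compare (Node (ee m) (ee m')) = enc_bool ((m, m') \<in> ord)"
  using sub unfolding correct_subroutines_def by blast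

lemma multA: "m \<in> S \<Longrightarrow> m' \<in> S \<Longrightarrow> rep (sub MultA (Node (ee m) (ee m'))) (val m \<otimes> val m')"
  using sub unfolding correct_subroutines_def by blast

lemma rep_closed: "rep d f \<Longrightarrow> f \<in> carrier A"
  by (simp add: represents_elem_def)

lemma rep_zero: "rep Leaf \<zero>"
  unfolding represents_elem_iff by (rule exI[of _ "[]"]) (simp add: tval_Nil enc_terms_def)

lemma rep_nonzero: "rep d f \<Longrightarrow> f \<noteq> \<zero> \<Longrightarrow> d \<noteq> Leaf"
  unfolding represents_elem_iff by (auto simp: tval_Nil enc_terms_def)

lemma rep_Cons:
  assumes "rep d f" "c \<in> carrier R" "m \<in> S"
  shows "rep (Node (Node (Scal c) (ee m)) d) (c \<odot> val m \<oplus> f)"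
proof -
  obtain ts where ts: "std_terms ts" "d = et ts" "f = tval ts"
    using assms(1) unfolding represents_elem_iff by blast
  show ?thesis unfolding represents_elem_iff
    by (rule exI[of _ "(c, m) # ts"]) (use ts assms tval_Cons in \<open>auto simp: enc_terms_def\<close>)
qed

lemma rep_term: "c \<in> carrier R \<Longrightarrow> m \<in> S \<Longrightarrow> rep (Node (Node (Scal c) (ee m)) Leaf) (c \<odot> val m)"
  using rep_Cons[OF rep_zero, of c m] by simp

lemma exec_lead:
  assumes "rep d f"
  shows "run lead_prog d (enc_lead f)"
proof -
  obtain ts where ts: "std_terms ts" "d = et ts" "f = tval ts"
    using assms unfolding represents_elem_iff by blast
  note fc = tval_closed[OF ts(1)]
  define N where "N ys = {m \<in> snd ` set ys. terms_coeff R ts m \<noteq> \<zero>\<^bsub>R\<^esub>}" for ys :: "('r \<times> ('a \<Rightarrow> nat)) list"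
  define P where "P ys a \<longleftrightarrow> (N ys = {} \<and> a = Leaf) \<or>
    (\<exists>m\<in>N ys. a = Node (Scal (terms_coeff R ts m)) (ee m) \<and> (\<forall>m'\<in>N ys. (m', m) \<in> ord))" for ys a
  let ?better = "MkNode (Then (MkNode (Out Skip) (Then item GoRight)) coeff_prog) (Then item GoRight)"
  have "\<exists>a. run lead_prog (et ts) a \<and> P ts a"
    unfolding lead_prog_def Let_def
  proof (rule exec_Fold_map[where ex = "enc_term hs" and P = P])
    fix ys t zs a assume eq: "ts = ys @ t # zs" and P: "P ys a"
    let ?m = "snd t"
    have m: "?m \<in> S" using eq ts(1) by auto
    have NS: "N ys \<subseteq> S" using eq ts(1) by (auto simp: N_def)
    note simps = zero_iff[OF std_exponents[OF ts(1)] S_exponents[OF m]]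
      exec_iff[OF exec_coeff[OF std_exponents[OF ts(1)] S_exponents[OF m]]]
    have N: "N (ys @ [t]) = (if terms_coeff R ts ?m = \<zero>\<^bsub>R\<^esub> then N ys else insert ?m (N ys))"
      by (auto simp: N_def)
    let ?env = "Node (enc_term hs t) (Node a (et ts))"
    let ?new = "Node (Scal (terms_coeff R ts ?m)) (ee ?m)"
    show "\<exists>a'. run lead_body ?env a' \<and> P (ys @ [t]) a'"
    proof (cases "terms_coeff R ts ?m = \<zero>\<^bsub>R\<^esub>")
      case True
      have "run lead_body ?env a" using True by (simp add: lead_body_def Let_def simps)
      moreover have "P (ys @ [t]) a" using True P N by (simp add: P_def)
      ultimately show ?thesis by blast
    next
      case nz: False
      show ?thesis
      proof (cases "N ys = {}")
        case True
        have "run lead_body ?env ?new" using nz True P by (simp add: lead_body_def Let_def simps P_def)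
        moreover have "P (ys @ [t]) ?new" using nz True N ord_refl[OF m] by (simp add: P_def)
        ultimately show ?thesis by blast
      next
        case False
        then obtain m' where m': "m' \<in> N ys" "a = Node (Scal (terms_coeff R ts m')) (ee m')"
          "\<forall>x\<in>N ys. (x, m') \<in> ord" using P by (auto simp: P_def)
        have m'S: "m' \<in> S" using m'(1) NS by blast
        show ?thesis
        proof (cases "(?m, m') \<in> ord")
          case True
          have "run lead_body ?env a" using nz True compare[OF m m'S] by (simp add: lead_body_def Let_def simps m'(2))
          moreover have "P (ys @ [t]) a" unfolding P_def N using nz m' True by auto
          ultimately show ?thesis by blast
        next
          case F: False
          have "run lead_body ?env ?new" using nz F compare[OF m m'S] by (simp add: lead_body_def Let_def simps m'(2))
          moreover have "(m', ?m) \<in> ord" using F ord_total[OF m m'S] by blast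
          then have "\<forall>x\<in>insert ?m (N ys). (x, ?m) \<in> ord"
            using m'(3) ord_trans ord_refl[OF m] by blast
          then have "P (ys @ [t]) ?new" unfolding P_def N using nz by auto
          ultimately show ?thesis by blast
        qed
      qed
    qed
  qed (auto simp: enc_terms_map P_def N_def)
  then obtain a where a: "run lead_prog (et ts) a" "P ts a" by blast
  have "N ts = occ f"
    using terms_coeff_outside[of _ ts] unfolding N_def occurring_def ts(3) co_tval[OF ts(1)] by auto
  then have "a = enc_lead f"
    using a(2) lm_eqI[of _ f] occ_empty_iff[OF fc] fc unfolding P_def enc_lead_def ts(3)
    by (auto simp: lcf_co co_tval[OF ts(1)])
  then show ?thesis using a(1) ts(2) by simp
qed

lemma exec_axpy:
  assumes s: "s \<in> carrier R" and d: "rep d f" and d0: "rep d0 f0"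
  shows "\<exists>d'. run axpy_prog (Node (Scal s) (Node d d0)) d' \<and> rep d' (s \<odot> f \<oplus> f0)"
proof -
  obtain ts where ts: "std_terms ts" "d = et ts" "f = tval ts"
    using d unfolding represents_elem_iff by blast
  note f0 = rep_closed[OF d0]
  show ?thesis
    unfolding axpy_prog_def ts(2,3)
  proof (rule exec_Fold_map[where ex = "enc_term hs" and P = "\<lambda>ys a. rep a (s \<odot> tval ys \<oplus> f0)"])
    fix ys t zs a assume eq: "ts = ys @ t # zs" and P: "rep a (s \<odot> tval ys \<oplus> f0)"
    obtain c m where t: "t = (c, m)" by (cases t)
    have c: "c \<in> carrier R" "m \<in> S" "std_terms ys" using ts(1) eq t by auto
    have "rep (Node (Node (Scal (s \<otimes>\<^bsub>R\<^esub> c)) (ee m)) a)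
        ((s \<otimes>\<^bsub>R\<^esub> c) \<odot> val m \<oplus> (s \<odot> tval ys \<oplus> f0))"
      using c s by (intro rep_Cons[OF P]) auto
    moreover have "(s \<otimes>\<^bsub>R\<^esub> c) \<odot> val m \<oplus> (s \<odot> tval ys \<oplus> f0)
        = s \<odot> tval (ys @ [t]) \<oplus> f0"
      using c s f0 tval_closed[OF c(3)]
      by (simp add: t tval_snoc A.smult_r_distr A.smult_assoc1 A.a_ac)
    ultimately show "\<exists>a'. run axpy_body (Node (enc_term hs t) (Node a (Node (Scal s) (Node (et ts) d0)))) a' \<and>
        rep a' (s \<odot> tval (ys @ [t]) \<oplus> f0)"
      by (auto simp: axpy_body_def t)
  qed (use f0 s d0 in \<open>auto simp: enc_terms_map tval_Nil\<close>)
qed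

lemma exec_mul:
  assumes k: "k \<in> S" and d: "rep d f"
  shows "\<exists>d'. run mul_prog (Node (ee k) d) d' \<and> rep d' (val k \<otimes> f)"
proof -
  obtain ts where ts: "std_terms ts" "d = et ts" "f = tval ts"
    using d unfolding represents_elem_iff by blast
  show ?thesis
    unfolding mul_prog_def ts(2,3)
  proof (rule exec_Fold_map[where ex = "enc_term hs" and P = "\<lambda>ys a. rep a (val k \<otimes> tval ys)"])
    fix ys t zs a assume eq: "ts = ys @ t # zs" and P: "rep a (val k \<otimes> tval ys)"
    obtain c m where t: "t = (c, m)" by (cases t)
    have c: "c \<in> carrier R" "m \<in> S" "std_terms ys" using ts(1) eq t by auto
    obtain d' where d': "run axpy_prog (Node (Scal c) (Node (sub MultA (Node (ee k) (ee m))) a)) d'"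
      "rep d' (c \<odot> (val k \<otimes> val m) \<oplus> val k \<otimes> tval ys)"
      using exec_axpy[OF c(1) multA[OF k c(2)] P] by blast
    have "c \<odot> (val k \<otimes> val m) \<oplus> val k \<otimes> tval ys = val k \<otimes> tval (ys @ [t])"
      using c tval_closed[OF c(3)] by (simp add: t tval_snoc A.r_distr smult_assoc_right A.a_comm)
    then show "\<exists>a'. run mul_body
        (Node (enc_term hs t) (Node a (Node (ee k) (et ts)))) a' \<and> rep a' (val k \<otimes> tval (ys @ [t]))"
      using d' by (auto simp: mul_body_def t)
  qed (auto simp: enc_terms_map tval_Nil rep_zero)
qed

end

section \<open>Computing fibres\<close>

definition shift_body where
  "shift_body =
    IfLeaf (Then (MkNode (Out GoLeft) (Then item GoRight)) zero_prog)
      (MkNode (Then (MkNode (Out (Then GoRight GoLeft)) (Then item GoRight)) exp_add_prog) acc)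
      acc"

definition shift_prog where
  "shift_prog = Fold GoLeft (Then GoRight GoRight) shift_body"

definition move_body where
  "move_body =
    IfLeaf (Then (MkNode (Out GoLeft) (Then item GoRight)) zero_prog)
      (IfLeaf (Then (MkNode (Then item GoRight) (Out (Then GoRight GoLeft))) exp_le_prog) acc
        (Then (MkNode (Out GoLeft)
            (MkNode (Then (MkNode (Out (Then GoRight GoLeft)) (Then item GoRight)) exp_monus_prog) acc))
          shift_prog))
      acc"

definition move_prog where
  "move_prog = Fold GoLeft (Then GoRight GoRight) move_body"

definition moves_body where
  "moves_body =
    Then (MkNode item (MkNode (Out (Then GoRight GoLeft)) acc)) move_prog"

definition moves_prog where
  "moves_prog = Fold GoLeft (Then GoRight GoRight) moves_body"

definition mem_body where
  "mem_body =
    IfLeaf (Then (MkNode item (Out GoLeft)) exp_eq_prog) acc true_prog"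

definition mem_prog where
  "mem_prog = Fold GoRight MkLeaf mem_body"

text \<open> Graph search with the state \<open>Node todo (Node seen generators)\<close>. \<close>

definition closure_step where
  "closure_step =
    IfLeaf (Then (MkNode (Then GoLeft GoLeft) (Then GoRight GoLeft)) mem_prog)
        (MkNode
          (Then (MkNode (Then GoRight GoRight) (MkNode (Then GoLeft GoLeft) (Then GoLeft GoRight))) moves_prog)
          (MkNode (MkNode (Then GoLeft GoLeft) (Then GoRight GoLeft)) (Then GoRight GoRight)))
        (MkNode (Then GoLeft GoRight) GoRight)"

definition closure_prog where
  "closure_prog = Then (MkNode (MkNode GoRight MkLeaf) (MkNode MkLeaf GoLeft))
    (Then (WhileNode GoLeft closure_step)
    (Then GoRight GoLeft))"

definition nonstd_body where
  "nonstd_body =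
    IfLeaf (Then (MkNode item (Out GoRight)) exp_le_prog) acc true_prog"

definition nonstd_prog where
  "nonstd_prog = Fold GoLeft MkLeaf nonstd_body"

definition quotients_body where
  "quotients_body =
    IfLeaf (Then (MkNode (Out (Then GoRight GoLeft)) item) exp_le_prog) acc
      (Then (MkNode (Then (MkNode item (Out (Then GoRight GoLeft))) exp_monus_prog) Skip)
        (IfLeaf (Then (MkNode (Then GoRight (Out GoLeft)) GoLeft) nonstd_prog)
          (MkNode GoLeft (Then GoRight acc))
          (Then GoRight acc)))"

definition quotients_prog where
  "quotients_prog = Fold (Then GoRight GoRight) MkLeaf quotients_body"

definition divide_prog where
  "divide_prog = Then
    (MkNode (Then GoLeft GoLeft)
      (MkNode (Then GoRight GoLeft)
        (Then (MkNode (Then GoLeft GoRight) (Then GoRight GoRight)) closure_prog)))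
    quotients_prog"

context algorithm_setting
begin

abbreviation kset where "kset \<equiv> terms_coeff R ` set kgens"
abbreviation enc_kgens where "enc_kgens \<equiv> enc_list (map et kgens)"

lemma exec_shift:
  assumes ts: "set ts \<subseteq> carrier R \<times> exponents H"
  shows "\<exists>ws'. run shift_prog (Node (et ts) (Node (ee v) (enc_exps ws))) (enc_exps ws') \<and>
    set ws' = set ws \<union> {exp_add v b |b. terms_coeff R ts b \<noteq> \<zero>\<^bsub>R\<^esub>}"
proof -
  define P where "P ys a \<longleftrightarrow> (\<exists>ws'. a = enc_exps ws' \<and>
    set ws' = set ws \<union> {exp_add v b |b. b \<in> snd ` set ys \<and> terms_coeff R ts b \<noteq> \<zero>\<^bsub>R\<^esub>})"
    for ys :: "('r \<times> ('a \<Rightarrow> nat)) list" and a :: "'r data"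
  have "\<exists>a. run shift_prog (Node (et ts) (Node (ee v) (enc_exps ws))) a \<and> P ts a"
    unfolding shift_prog_def
  proof (rule exec_Fold_map[where ex = "enc_term hs" and P = P])
    fix ys t zs a assume eq: "ts = ys @ t # zs" and P: "P ys a"
    let ?env = "Node (enc_term hs t) (Node a (Node (et ts) (Node (ee v) (enc_exps ws))))"
    have m: "snd t \<in> exponents H" using eq ts by auto
    obtain ws' where ws': "a = enc_exps ws'"
      "set ws' = set ws \<union> {exp_add v b |b. b \<in> snd ` set ys \<and> terms_coeff R ts b \<noteq> \<zero>\<^bsub>R\<^esub>}"
      using P by (auto simp: P_def)
    show "\<exists>a'. run shift_body ?env a' \<and> P (ys @ [t]) a'"
    proof (cases "terms_coeff R ts (snd t) = \<zero>\<^bsub>R\<^esub>")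
      case True
      have "run shift_body ?env a" using True by (simp add: shift_body_def zero_iff[OF ts m])
      moreover have "P (ys @ [t]) a" unfolding P_def using ws' True by (intro exI[of _ ws']) auto
      ultimately show ?thesis by blast
    next
      case False
      have "run shift_body ?env (Node (ee (exp_add v (snd t))) a)"
        using False by (simp add: shift_body_def zero_iff[OF ts m] exp_simps)
      moreover have "P (ys @ [t]) (Node (ee (exp_add v (snd t))) a)"
        unfolding P_def using ws' False by (intro exI[of _ "exp_add v (snd t) # ws'"]) auto
      ultimately show ?thesis by blast
    qed
  qed (auto simp: enc_terms_map P_def)
  then obtain ws' where "run shift_prog (Node (et ts) (Node (ee v) (enc_exps ws))) (enc_exps ws')"
    "set ws' = set ws \<union> {exp_add v b |b. b \<in> snd ` set ts \<and> terms_coeff R ts b \<noteq> \<zero>\<^bsub>R\<^esub>}"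
    by (auto simp: P_def)
  moreover have "b \<in> snd ` set ts" if "terms_coeff R ts b \<noteq> \<zero>\<^bsub>R\<^esub>" for b
    using terms_coeff_outside that by blast
  ultimately show ?thesis by (intro exI[of _ ws']) auto
qed

lemma exec_move:
  assumes ts: "set ts \<subseteq> carrier R \<times> exponents H"
  shows "\<exists>ws'. run move_prog (Node (et ts) (Node (ee u) (enc_exps ws))) (enc_exps ws') \<and>
    set ws' = set ws \<union> moves {terms_coeff R ts} u"
proof -
  let ?p = "terms_coeff R ts"
  define M where "M T = {exp_add (\<lambda>x. u x - a x) b |a b. a \<in> T \<and> ?p a \<noteq> \<zero>\<^bsub>R\<^esub> \<and> ?p b \<noteq> \<zero>\<^bsub>R\<^esub> \<and> a \<le> u}" for T
  have M_insert: "M (insert a T) = M T \<union> (if ?p a \<noteq> \<zero>\<^bsub>R\<^esub> \<and> a \<le> u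
      then {exp_add (\<lambda>x. u x - a x) b |b. ?p b \<noteq> \<zero>\<^bsub>R\<^esub>} else {})" for a T
    unfolding M_def by auto
  define P where "P ys a \<longleftrightarrow> (\<exists>ws'. a = enc_exps ws' \<and> set ws' = set ws \<union> M (snd ` set ys))"
    for ys :: "('r \<times> ('a \<Rightarrow> nat)) list" and a :: "'r data"
  have "\<exists>a. run move_prog (Node (et ts) (Node (ee u) (enc_exps ws))) a \<and> P ts a"
    unfolding move_prog_def
  proof (rule exec_Fold_map[where ex = "enc_term hs" and P = P])
    fix ys t zs a assume eq: "ts = ys @ t # zs" and P: "P ys a"
    let ?env = "Node (enc_term hs t) (Node a (Node (et ts) (Node (ee u) (enc_exps ws))))"
    let ?m = "snd t"
    have m: "?m \<in> exponents H" using eq ts by auto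
    obtain ws' where ws': "a = enc_exps ws'" "set ws' = set ws \<union> M (snd ` set ys)"
      using P by (auto simp: P_def)
    have M: "M (snd ` set (ys @ [t])) = M (insert ?m (snd ` set ys))" by simp
    show "\<exists>a'. run move_body ?env a' \<and> P (ys @ [t]) a'"
    proof (cases "?p ?m \<noteq> \<zero>\<^bsub>R\<^esub> \<and> ?m \<le> u")
      case False
      have "run move_body ?env a" using False by (auto simp: move_body_def zero_iff[OF ts m] exp_simps m)
      moreover have "P (ys @ [t]) a" unfolding P_def M M_insert using ws' False by auto
      ultimately show ?thesis by blast
    next
      case True
      obtain ws2 where ws2: "run shift_prog (Node (et ts) (Node (ee (\<lambda>x. u x - ?m x)) (enc_exps ws'))) (enc_exps ws2)"
        "set ws2 = set ws' \<union> {exp_add (\<lambda>x. u x - ?m x) b |b. ?p b \<noteq> \<zero>\<^bsub>R\<^esub>}"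
        using exec_shift[OF ts] by blast
      have "run move_body ?env (enc_exps ws2)"
        using True ws2(1) ws'(1) by (simp add: move_body_def zero_iff[OF ts m] exp_simps m)
      moreover have "P (ys @ [t]) (enc_exps ws2)"
        unfolding P_def M M_insert using ws' ws2(2) True by (intro exI[of _ ws2]) auto
      ultimately show ?thesis by blast
    qed
  qed (auto simp: enc_terms_map P_def M_def)
  moreover have "M (snd ` set ts) = moves {?p} u"
    using terms_coeff_outside unfolding M_def moves_def by blast
  ultimately show ?thesis by (auto simp: P_def)
qed

lemma moves_insert: "moves (insert p K) u = moves K u \<union> moves {p} u"
  unfolding moves_def by auto

lemma exec_moves:
  "\<exists>ws'. run moves_prog (Node enc_kgens (Node (ee u) (enc_exps ws))) (enc_exps ws') \<and>
    set ws' = set ws \<union> moves kset u"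
proof -
  define P where "P ys a \<longleftrightarrow> (\<exists>ws'. a = enc_exps ws' \<and> set ws' = set ws \<union> moves (terms_coeff R ` set ys) u)"
    for ys :: "('r \<times> ('a \<Rightarrow> nat)) list list" and a :: "'r data"
  have "\<exists>a. run moves_prog (Node enc_kgens (Node (ee u) (enc_exps ws))) a \<and> P kgens a"
    unfolding moves_prog_def
  proof (rule exec_Fold_map[where ex = et and P = P])
    fix ys ts zs a assume eq: "kgens = ys @ ts # zs" and P: "P ys a"
    have ts: "set ts \<subseteq> carrier R \<times> exponents H" using eq kgens(1) by auto
    obtain ws1 where ws1: "a = enc_exps ws1" "set ws1 = set ws \<union> moves (terms_coeff R ` set ys) u"
      using P by (auto simp: P_def)
    obtain ws2 where ws2: "run move_prog (Node (et ts) (Node (ee u) (enc_exps ws1))) (enc_exps ws2)"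
      "set ws2 = set ws1 \<union> moves {terms_coeff R ts} u" using exec_move[OF ts] by blast
    have "P (ys @ [ts]) (enc_exps ws2)"
      using ws1 ws2 moves_insert[of "terms_coeff R ts" "terms_coeff R ` set ys" u]
      unfolding P_def by (intro exI[of _ ws2]) auto
    then show "\<exists>a'. run moves_body
        (Node (et ts) (Node a (Node enc_kgens (Node (ee u) (enc_exps ws))))) a' \<and> P (ys @ [ts]) a'"
      using ws2(1) ws1(1) by (auto simp: moves_body_def)
  qed (auto simp: P_def moves_def)
  then show ?thesis by (auto simp: P_def)
qed

lemma mem_iff:
  assumes "u \<in> exponents H" "set ws \<subseteq> exponents H"
  shows "run mem_prog (Node (ee u) (enc_exps ws)) y \<longleftrightarrow> y = enc_bool (u \<in> set ws)"
proof (rule exec_iff)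
  have "run mem_prog (Node (ee u) (enc_exps ws)) (enc_bool (\<exists>w\<in>set ws. w = u))"
    unfolding mem_prog_def
  proof (rule exec_fold_any[where ex = ee])
    fix w a assume "w \<in> set ws"
    then have "w \<in> exponents H" using assms(2) by blast
    then show "run mem_body
        (Node (ee w) (Node (enc_bool a) (Node (ee u) (enc_exps ws)))) (enc_bool (w = u \<or> a))"
      using assms(1) by (simp add: mem_body_def exp_eq_iff)
  qed simp_all
  then show "run mem_prog (Node (ee u) (enc_exps ws)) (enc_bool (u \<in> set ws))" by simp
qed

lemma kset_kernel: "kset \<subseteq> eval_kernel R H L"
  unfolding kgens(3)[symmetric] genideal_def by blast

lemma fibre_exponents: "fibre m \<subseteq> exponents H"
  by (auto simp: fibre_def)

text \<open> Every vector that is reached lies in the fibre, so each step either marks a new vector of this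
  finite set as seen or shortens the list \<open>todo\<close>. At the end \<open>seen\<close> is closed under moves and contains
  \<open>m\<close>. \<close>

lemma exec_closure:
  assumes m: "m \<in> S"
  shows "\<exists>us. run closure_prog (Node enc_kgens (ee m)) (enc_exps us) \<and> set us = fibre m"
proof -
  let ?state = "\<lambda>todo seen. Node (enc_exps todo) (Node (enc_exps seen) enc_kgens)"
  have loop: "\<exists>us. run (WhileNode GoLeft closure_step) (?state todo seen) (?state [] us) \<and> set us = fibre m"
    if "set todo \<union> set seen \<subseteq> fibre m" "m \<in> set todo \<union> set seen"
      "\<And>u. u \<in> set seen \<Longrightarrow> moves kset u \<subseteq> set todo \<union> set seen" for todo seen
    using that
  proof (induction "(card (fibre m - set seen), length todo)" arbitrary: todo seen
      rule: wf_induct_rule[OF wf_lex_prod[OF wf_less_than wf_less_than]])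
    case (1 todo seen)
    note IH = 1(1) and inv = 1(2,3,4)
    show ?case
    proof (cases todo)
      case Nil
      have "moves kset u \<subseteq> set seen" if "u \<in> set seen" for u
        using inv(3)[OF that] Nil by simp
      then have "set seen = fibre m"
        using inv(1,2) Nil by (intro fibre_connected[OF m _ _ _ kgens(2,3)]) auto
      moreover have "run (WhileNode GoLeft closure_step) (?state [] seen) (?state [] seen)"
        by (rule exec_While1) simp
      ultimately show ?thesis using Nil by blast
    next
      case (Cons u rest)
      have u: "u \<in> exponents H" "set seen \<subseteq> exponents H" using inv(1) fibre_exponents Cons by auto
      have guard: "run GoLeft (?state todo seen) (enc_exps todo)" "enc_exps todo \<noteq> Leaf"
        using Cons by auto
      show ?thesis
      proof (cases "u \<in> set seen")
        case True
        have "run closure_step (?state todo seen) (?state rest seen)"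
          using True by (simp add: closure_step_def Cons mem_iff[OF u])
        moreover have "\<exists>us. run (WhileNode GoLeft closure_step) (?state rest seen) (?state [] us) \<and> set us = fibre m"
          by (rule IH) (use inv True Cons in auto)
        ultimately show ?thesis using exec_While2[OF guard] by blast
      next
        case False
        obtain ws where ws: "run moves_prog (Node enc_kgens (Node (ee u) (enc_exps rest))) (enc_exps ws)"
          "set ws = set rest \<union> moves kset u" using exec_moves by blast
        have "run closure_step (?state todo seen) (?state ws (u # seen))"
          using False ws(1) by (simp add: closure_step_def Cons mem_iff[OF u])
        moreover have "\<exists>us. run (WhileNode GoLeft closure_step) (?state ws (u # seen)) (?state [] us) \<and> set us = fibre m"
        proof (rule IH)
          have uf: "u \<in> fibre m" using inv(1) Cons by auto
          have "fibre m - set (u # seen) \<subset> fibre m - set seen" using uf False by auto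
          then have "card (fibre m - set (u # seen)) < card (fibre m - set seen)"
            using finite_fibre[OF m] by (intro psubset_card_mono) auto
          then show "((card (fibre m - set (u # seen)), length ws), (card (fibre m - set seen), length todo))
              \<in> less_than <*lex*> less_than" by simp
          show "set ws \<union> set (u # seen) \<subseteq> fibre m"
            using inv(1) Cons ws(2) uf moves_fibre[OF kset_kernel kgens(2) m uf] by auto
          show "m \<in> set ws \<union> set (u # seen)" using inv(2) Cons ws(2) by auto
          show "moves kset v \<subseteq> set ws \<union> set (u # seen)" if "v \<in> set (u # seen)" for v
            using that inv(3)[of v] Cons ws(2) by auto
        qed
        ultimately show ?thesis using exec_While2[OF guard] by blast
      qed
    qed
  qed
  obtain us where us: "run (WhileNode GoLeft closure_step) (?state [m] []) (?state [] us)" "set us = fibre m"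
    using loop[of "[m]" "[]"] fibre_self[OF m] by auto
  have "run (MkNode (MkNode GoRight MkLeaf) (MkNode MkLeaf GoLeft)) (Node enc_kgens (ee m)) (?state [m] [])"
    by simp
  then have "run closure_prog (Node enc_kgens (ee m)) (enc_exps us)"
    unfolding closure_prog_def by (rule exec_Then, intro exec_Then[OF us(1)]) simp
  with us(2) show ?thesis by blast
qed

lemma nonstd_generator:
  assumes "k \<in> exponents H"
  shows "k \<in> \<Sigma> \<longleftrightarrow> (\<exists>s\<in>set sgens. s \<le> k)"
proof
  let ?J = "{k \<in> exponents H. \<exists>s\<in>set sgens. s \<le> k}"
  have "exp_ideal H ?J"
    unfolding exp_ideal_def
  proof (intro conjI ballI)
    fix m m' assume m: "m \<in> ?J" "m' \<in> exponents H"
    then obtain s where "s \<in> set sgens" "s \<le> m" by blast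
    moreover have "m \<le> exp_add m m'" by (auto simp: exp_add_def le_fun_def)
    ultimately show "exp_add m m' \<in> ?J" using m exp_add_mem[of m H m'] by (auto intro: order_trans)
  qed auto
  moreover have "set sgens \<subseteq> ?J" using sgens(1) by auto
  ultimately have "exp_genideal H (set sgens) \<subseteq> ?J" unfolding exp_genideal_def by blast
  then show "\<exists>s\<in>set sgens. s \<le> k" if "k \<in> \<Sigma>" using that sgens(2) by auto
next
  assume "\<exists>s\<in>set sgens. s \<le> k"
  then obtain s where s: "s \<in> set sgens" "s \<le> k" by blast
  have "exp_add s (\<lambda>x. k x - s x) \<in> J" if "exp_ideal H J" "set sgens \<subseteq> J" for J
    using that s exp_diff_mem[OF assms, of s] unfolding exp_ideal_def by blast
  then have "k \<in> exp_genideal H (set sgens)"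
    unfolding exp_genideal_def exp_add_diff[OF s(2)] by blast
  then show "k \<in> \<Sigma>" using sgens(2) by simp
qed

lemma nonstd_iff:
  assumes "k \<in> exponents H"
  shows "run nonstd_prog (Node (enc_exps sgens) (ee k)) y \<longleftrightarrow> y = enc_bool (k \<notin> S)"
proof (rule exec_iff)
  have "run nonstd_prog (Node (enc_exps sgens) (ee k)) (enc_bool (\<exists>s\<in>set sgens. s \<le> k))"
    unfolding nonstd_prog_def
  proof (rule exec_fold_any[where ex = ee])
    fix s a assume "s \<in> set sgens"
    then have "s \<in> exponents H" using sgens(1) by blast
    then show "run nonstd_body
        (Node (ee s) (Node (enc_bool a) (Node (enc_exps sgens) (ee k)))) (enc_bool (s \<le> k \<or> a))"
      by (simp add: nonstd_body_def exp_le_iff)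
  qed simp_all
  then show "run nonstd_prog (Node (enc_exps sgens) (ee k)) (enc_bool (k \<notin> S))"
    using nonstd_generator[OF assms] assms by simp
qed

lemma exec_quotients:
  assumes m: "m \<in> exponents H" and us: "set us \<subseteq> exponents H"
  shows "\<exists>ks. run quotients_prog (Node (enc_exps sgens) (Node (ee m) (enc_exps us))) (enc_exps ks) \<and>
    set ks = {k. \<exists>u\<in>set us. m \<le> u \<and> k = (\<lambda>x. u x - m x) \<and> k \<in> S}"
proof -
  let ?Q = "\<lambda>T. {k. \<exists>u\<in>T. m \<le> u \<and> k = (\<lambda>x. u x - m x) \<and> k \<in> S}"
  define P where "P ys a \<longleftrightarrow> (\<exists>ks. a = enc_exps ks \<and> set ks = ?Q (set ys))" for ys :: "('a \<Rightarrow> nat) list" and a :: "'r data"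
  have "\<exists>a. run quotients_prog (Node (enc_exps sgens) (Node (ee m) (enc_exps us))) a \<and> P us a"
    unfolding quotients_prog_def
  proof (rule exec_Fold_map[where ex = ee and P = P])
    fix ys u zs a assume eq: "us = ys @ u # zs" and P: "P ys a"
    let ?env = "Node (ee u) (Node a (Node (enc_exps sgens) (Node (ee m) (enc_exps us))))"
    let ?k = "\<lambda>x. u x - m x"
    have k: "?k \<in> exponents H" using us eq by (intro exp_diff_mem) auto
    obtain ks where ks: "a = enc_exps ks" "set ks = ?Q (set ys)" using P by (auto simp: P_def)
    show "\<exists>a'. run quotients_body ?env a' \<and> P (ys @ [u]) a'"
    proof (cases "m \<le> u \<and> ?k \<in> S")
      case True
      have "run quotients_body ?env (Node (ee ?k) a)"
        using True by (simp add: quotients_body_def exp_le_iff[OF m] exec_exp_monus_iff nonstd_iff[OF k])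
      moreover have "P (ys @ [u]) (Node (ee ?k) a)"
        unfolding P_def using ks True by (intro exI[of _ "?k # ks"]) auto
      ultimately show ?thesis by blast
    next
      case False
      have "run quotients_body ?env a"
        using False by (auto simp: quotients_body_def exp_le_iff[OF m] exec_exp_monus_iff nonstd_iff[OF k])
      moreover have "P (ys @ [u]) a"
        unfolding P_def using ks False by (intro exI[of _ ks]) auto
      ultimately show ?thesis by blast
    qed
  qed (auto simp: P_def)
  then show ?thesis by (auto simp: P_def)
qed

abbreviation enc_ctx where "enc_ctx \<equiv> Node (enc_exps sgens) enc_kgens"

lemma exec_divide:
  assumes m: "m \<in> S" "m' \<in> S"
  shows "\<exists>ks. run divide_prog (Node enc_ctx (Node (ee m) (ee m'))) (enc_exps ks) \<and>
    (ks \<noteq> [] \<longleftrightarrow> dv m m') \<and>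
    (\<forall>k\<in>set ks. k \<in> S \<and> val k \<otimes> val m \<noteq> \<zero> \<and> lm (val k \<otimes> val m) = m')"
proof -
  obtain us where us: "run closure_prog (Node enc_kgens (ee m')) (enc_exps us)" "set us = fibre m'"
    using exec_closure[OF m(2)] by blast
  obtain ks where ks: "run quotients_prog (Node (enc_exps sgens) (Node (ee m) (enc_exps us))) (enc_exps ks)"
    "set ks = {k. \<exists>u\<in>fibre m'. m \<le> u \<and> k = (\<lambda>x. u x - m x) \<and> k \<in> S}"
    using exec_quotients[of m us] us(2) fibre_exponents m by auto
  have "run divide_prog (Node enc_ctx (Node (ee m) (ee m'))) (enc_exps ks)"
    unfolding divide_prog_def using us(1) ks(1) by auto
  moreover have "ks \<noteq> [] \<longleftrightarrow> dv m m'"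
  proof -
    have "set ks \<noteq> {} \<longleftrightarrow> (\<exists>u\<in>fibre m'. m \<le> u \<and> (\<lambda>x. u x - m x) \<in> S)" unfolding ks(2) by blast
    then show ?thesis unfolding dv_fibre[OF m] set_empty .
  qed
  moreover have "k \<in> S \<and> val k \<otimes> val m \<noteq> \<zero> \<and> lm (val k \<otimes> val m) = m'" if k: "k \<in> set ks" for k
  proof -
    obtain u where u: "u \<in> fibre m'" "m \<le> u" "k = (\<lambda>x. u x - m x)" "k \<in> S" using k ks(2) by blast
    show ?thesis using fibre_quotient(2,3)[OF m u(1,2,3,4)] u(4) by blast
  qed
  ultimately show ?thesis by blast
qed

end

section \<open>The reduction algorithm\<close>

text \<open> The result is \<open>Leaf\<close> or represents a multiple, by a monomial, of a basis element; its leading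
  monomial is the given one. \<close>

definition reducer_body where
  "reducer_body =
    Then (MkNode (Then item lead_prog) Skip)
      (IfLeaf GoLeft (Then GoRight acc)
        (Then (MkNode (Then (MkNode (Then GoRight (Out (Then GoLeft GoRight)))
                (MkNode (Then GoLeft GoRight) (Then GoRight (Out GoRight)))) divide_prog) Skip)
          (IfLeaf GoLeft (Then GoRight (Then GoRight acc))
            (Then (MkNode (Then GoLeft GoLeft) (Out GoLeft)) mul_prog))))"

definition reducer_prog where
  "reducer_prog = Fold (Then GoLeft GoLeft) MkLeaf reducer_body"

text \<open> The state is \<open>Node todo (Node out env)\<close>. In the inner conditional the environment is
  \<open>Node reducer (Node lead (Node todo (Node out env)))\<close>. Without a reducer, the leading term is
  subtracted from both \<open>todo\<close> and \<open>out\<close>; otherwise a multiple of the reducer is subtracted from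
  \<open>todo\<close> alone. \<close>

definition reduce_step where
  "reduce_step =
    Then (MkNode (Then GoLeft lead_prog) Skip)
      (Then (MkNode (Then (MkNode (Then GoRight (Out Skip)) (Then GoLeft GoRight)) reducer_prog) Skip)
        (let todo = Out GoLeft; out = Then GoRight (Out GoLeft); env = Out (Out Skip);
             minus_lc = Then (Then GoRight (Then GoLeft GoLeft)) FNeg;
             monomial = MkNode (MkNode FOne (Then GoRight (Then GoLeft GoRight))) MkLeaf
         in IfLeaf GoLeft
           (MkNode (Then (MkNode minus_lc (MkNode monomial todo)) axpy_prog)
             (MkNode (Then (MkNode minus_lc (MkNode monomial out)) axpy_prog) env))
           (MkNode
             (Then (MkNode (Then (MkNode minus_lc (Then (Then GoLeft (Then lead_prog GoLeft)) FInv)) FMult)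
               (MkNode GoLeft todo)) axpy_prog)
             (MkNode out env))))"

definition reduce_prog where
  "reduce_prog = (let monomial = MkNode (MkNode FOne GoRight) MkLeaf in
    Then (MkNode monomial (MkNode monomial GoLeft))
      (Then (WhileNode (Then GoLeft lead_prog) reduce_step) (Then GoRight GoLeft)))"

definition minimal_body where
  "minimal_body =
    Then (MkNode (Then item lead_prog) Skip)
      (IfLeaf GoLeft (Then GoRight acc)
        (IfLeaf (Then (MkNode (Then GoLeft GoRight) (Then GoRight (Out GoRight))) exp_eq_prog)
          (IfLeaf (Then (MkNode (Then GoRight (Out (Then GoLeft GoRight)))
              (MkNode (Then GoLeft GoRight) (Then GoRight (Out GoRight)))) divide_prog)
            (Then GoRight acc) MkLeaf)
          (Then GoRight acc)))"

definition minimal_prog where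
  "minimal_prog = Fold (Then GoLeft GoLeft) true_prog minimal_body"

text \<open> Distinct elements of the given basis may share a minimal leading monomial. They lead to
  the same element of the reduced basis, which then merely occurs repeatedly in the output list. \<close>

definition main_body where
  "main_body =
    Then (MkNode (Then item lead_prog) Skip)
          (IfLeaf GoLeft (Then GoRight acc)
            (IfLeaf (Then (MkNode (Then GoRight (Out Skip)) (Then GoLeft GoRight)) minimal_prog)
              (Then GoRight acc)
              (MkNode (Then (MkNode (Then GoRight (Out Skip)) (Then GoLeft GoRight)) reduce_prog)
                (Then GoRight acc))))"

text \<open> The description \<open>[n, sgens, K]\<close> and the basis are rearranged into \<open>Node basis (Node sgens K)\<close>, the
  environment in which the other programs run. \<close>

definition main_prog where
  "main_prog =
    Then (MkNode GoRight (MkNode (Then GoLeft (Then GoRight GoLeft)) (Then GoLeft (Out GoLeft))))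
      (Fold GoLeft MkLeaf main_body)"

context algorithm_setting
begin

lemma exec_lead_terms: "std_terms ts \<Longrightarrow> run lead_prog (et ts) y \<longleftrightarrow> y = enc_lead (tval ts)"
  by (rule exec_iff[OF exec_lead]) (auto simp: represents_elem_iff)

context
  fixes gss :: "('r \<times> ('a \<Rightarrow> nat)) list list"
  assumes gss: "\<And>ts. ts \<in> set gss \<Longrightarrow> std_terms ts"
begin

abbreviation gset where "gset \<equiv> tval ` set gss"
abbreviation enc_env where "enc_env \<equiv> Node (enc_list (map et gss)) enc_ctx"

definition is_reducer where
  "is_reducer T m d \<longleftrightarrow>
    (d = Leaf \<and> (\<forall>g\<in>T. g \<noteq> \<zero> \<longrightarrow> \<not> dv (lm g) m)) \<or>
    (d \<noteq> Leaf \<and> (\<exists>g\<in>T. \<exists>k\<in>S. g \<noteq> \<zero> \<and> dv (lm g) m \<and>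
      rep d (val k \<otimes> g) \<and> val k \<otimes> g \<noteq> \<zero> \<and> lm (val k \<otimes> g) = m))"

lemma exec_reducer:
  assumes m: "m \<in> S"
  shows "\<exists>d. run reducer_prog (Node enc_env (ee m)) d \<and> is_reducer gset m d"
proof -
  define P where "P ys = is_reducer (tval ` set ys) m" for ys
  have "\<exists>d. run reducer_prog (Node enc_env (ee m)) d \<and> P gss d"
    unfolding reducer_prog_def
  proof (rule exec_Fold_map[where ex = et and P = P])
    fix ys ts zs a assume eq: "gss = ys @ ts # zs" and P: "P ys a"
    let ?env = "Node (et ts) (Node a (Node enc_env (ee m)))"
    let ?g = "tval ts"
    have ts: "std_terms ts" using gss eq by auto
    note gc = tval_closed[OF ts]
    show "\<exists>a'. run reducer_body ?env a' \<and> P (ys @ [ts]) a'"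
    proof (cases "?g = \<zero>")
      case True
      have "run reducer_body ?env a" using True by (simp add: reducer_body_def exec_lead_terms[OF ts] enc_lead_def)
      moreover have "P (ys @ [ts]) a" using P True by (auto simp: P_def is_reducer_def)
      ultimately show ?thesis by blast
    next
      case nz: False
      obtain ks where ks: "run divide_prog (Node enc_ctx (Node (ee (lm ?g)) (ee m))) (enc_exps ks)"
        "ks \<noteq> [] \<longleftrightarrow> dv (lm ?g) m"
        "\<forall>k\<in>set ks. k \<in> S \<and> val k \<otimes> val (lm ?g) \<noteq> \<zero> \<and> lm (val k \<otimes> val (lm ?g)) = m"
        using exec_divide[OF lm_S[OF gc nz] m] by blast
      note simps = exec_lead_terms[OF ts] enc_lead_def exec_iff[OF ks(1)]
      show ?thesis
      proof (cases ks)
        case Nil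
        have "run reducer_body ?env a" using nz Nil by (simp add: reducer_body_def simps)
        moreover have "P (ys @ [ts]) a" using P ks(2) Nil by (auto simp: P_def is_reducer_def)
        ultimately show ?thesis by blast
      next
        case (Cons k ks')
        have k: "k \<in> S" "val k \<otimes> val (lm ?g) \<noteq> \<zero>" "lm (val k \<otimes> val (lm ?g)) = m"
          using ks(3) Cons by auto
        have "rep (et ts) ?g" using ts by (auto simp: represents_elem_iff)
        then obtain d where d: "run mul_prog (Node (ee k) (et ts)) d" "rep d (val k \<otimes> ?g)"
          using exec_mul[OF k(1)] by blast
        note l = lm_mult[OF gc nz k(1,2)]
        have "run reducer_body ?env d" using nz Cons by (simp add: reducer_body_def simps exec_iff[OF d(1)])
        moreover have "P (ys @ [ts]) d"
        proof -
          have "d \<noteq> Leaf" using rep_nonzero[OF d(2) l(1)] .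
          moreover have "dv (lm ?g) m" using ks(2) Cons by simp
          moreover have "?g \<in> tval ` set (ys @ [ts])" by simp
          ultimately show ?thesis using k d(2) l nz unfolding P_def is_reducer_def by metis
        qed
        ultimately show ?thesis by blast
      qed
    qed
  qed (auto simp: P_def is_reducer_def)
  then show ?thesis by (simp add: P_def)
qed

lemma exec_minimal:
  assumes m: "m \<in> S"
  shows "run minimal_prog (Node enc_env (ee m))
    (enc_bool (\<forall>g\<in>gset. g \<noteq> \<zero> \<and> dv (lm g) m \<longrightarrow> lm g = m))"
proof -
  define P where "P ys d \<longleftrightarrow> d = enc_bool (\<forall>g\<in>tval ` set ys. g \<noteq> \<zero> \<and> dv (lm g) m \<longrightarrow> lm g = m)"
    for ys and d :: "'r data"
  have "\<exists>d. run minimal_prog (Node enc_env (ee m)) d \<and> P gss d"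
    unfolding minimal_prog_def
  proof (rule exec_Fold_map[where ex = et and P = P])
    fix ys ts zs a assume eq: "gss = ys @ ts # zs" and P: "P ys a"
    let ?env = "Node (et ts) (Node a (Node enc_env (ee m)))"
    let ?g = "tval ts"
    have ts: "std_terms ts" using gss eq by auto
    note gc = tval_closed[OF ts]
    show "\<exists>a'. run minimal_body ?env a' \<and> P (ys @ [ts]) a'"
    proof (cases "?g = \<zero>")
      case True
      have "run minimal_body ?env a" using True by (simp add: minimal_body_def exec_lead_terms[OF ts] enc_lead_def)
      moreover have "P (ys @ [ts]) a" using P True by (auto simp: P_def)
      ultimately show ?thesis by blast
    next
      case nz: False
      note lS = lm_S[OF gc nz]
      obtain ks where ks: "run divide_prog (Node enc_ctx (Node (ee (lm ?g)) (ee m))) (enc_exps ks)"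
        "ks \<noteq> [] \<longleftrightarrow> dv (lm ?g) m"
        using exec_divide[OF lS m] by blast
      note simps = exec_lead_terms[OF ts] enc_lead_def exec_iff[OF ks(1)]
        exp_eq_iff[OF S_exponents[OF lS] S_exponents[OF m]]
      show ?thesis
      proof (cases "dv (lm ?g) m \<longrightarrow> lm ?g = m")
        case True
        have "run minimal_body ?env a"
        proof (cases "lm ?g = m")
          case True
          then show ?thesis
            using nz by (simp add: minimal_body_def minimal_body_def simps exp_eq_iff[OF S_exponents[OF m] S_exponents[OF m]])
        next
          case False
          then have "ks = []" using True ks(2) by blast
          then show ?thesis using nz False by (simp add: minimal_body_def simps)
        qed
        moreover have "P (ys @ [ts]) a" using P True by (auto simp: P_def)
        ultimately show ?thesis by blast
      next
        case False
        have "run minimal_body ?env Leaf" using nz False ks(2) by (simp add: minimal_body_def simps)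
        moreover have "P (ys @ [ts]) Leaf" using False nz by (auto simp: P_def)
        ultimately show ?thesis by blast
      qed
    qed
  qed (auto simp: P_def)
  then show ?thesis by (simp add: P_def)
qed

text \<open> Both \<open>todo\<close> and \<open>out\<close> start as \<open>m0\<close>, and \<open>out - todo\<close> stays in \<open>I\<close>. Irreducible leading terms accumulate
  in \<open>out\<close> with the opposite sign, and \<open>m0\<close> itself is reducible, so these terms are smaller than \<open>m0\<close>. When
  \<open>todo\<close> represents zero, \<open>out\<close> is the element of the reduced basis with leading monomial \<open>m0\<close>. \<close>

lemma exec_reduce:
  assumes I: "ideal I A" and G: "groebner_basis R A H \<Sigma> ord L I gset" and m0: "m0 \<in> min_lms I"
  shows "\<exists>d. run reduce_prog (Node enc_env (ee m0)) d \<and> (\<exists>g\<in>rgb I. lm g = m0 \<and> rep d g)"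
proof -
  interpret I: ideal I A by (rule I)
  note Ic = ideal_sub[OF I]
  have m0l: "m0 \<in> lms I" and m0S: "m0 \<in> S" using m0 lms_S[OF Ic] by (auto simp: min_lms_def)
  have GI: "gset \<subseteq> I" using G by (simp add: groebner_basis_def)
  let ?W = "WhileNode (Then GoLeft lead_prog) reduce_step"
  define good where "good r \<longleftrightarrow> below r m0 \<and> occ r \<inter> lms I = {}" for r
  define goal where "goal dt dout \<longleftrightarrow>
    (\<exists>dt' d g. run ?W (Node dt (Node dout enc_env)) (Node dt' (Node d enc_env)) \<and> g \<in> rgb I \<and> lm g = m0 \<and> rep d g)"
    for dt dout
  have finished: "goal dt dout"
    if t: "rep dt \<zero>" and out: "rep dout (val m0 \<oplus> r)" and r: "good r" and "(val m0 \<oplus> r) \<ominus> \<zero> \<in> I"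
    for dt dout r
  proof -
    have "run (Then GoLeft lead_prog) (Node dt (Node dout enc_env)) Leaf"
      using exec_lead[OF t] by (simp add: enc_lead_def)
    then have w: "run ?W (Node dt (Node dout enc_env)) (Node dt (Node dout enc_env))" by (rule exec_While1)
    have "val m0 \<oplus> r \<in> I" using that(4) r by (simp add: A.minus_eq good_def below_def)
    then have "val m0 \<oplus> r \<in> rgb I" "lm (val m0 \<oplus> r) = m0"
      using rgbI[OF m0 Ic] r by (auto simp: good_def)
    then show ?thesis using w out unfolding goal_def by blast
  qed
  have loop: "goal dt dout"
    if "m \<in> S" "(m, m0) \<in> ord" "rep dt t" "\<And>m'. m' \<in> occ t \<Longrightarrow> (m', m) \<in> ord"
      "rep dout (val m0 \<oplus> r)" "good r" "(val m0 \<oplus> r) \<ominus> t \<in> I" for m dt t dout r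
    using that
  proof (induction m arbitrary: dt t dout r rule: ord_induct)
    case (less m)
    note tc = rep_closed[OF less.prems(2)]
    have rc: "r \<in> carrier A" using less.prems(5) by (simp add: good_def below_def)
    show ?case
    proof (cases "t = \<zero>")
      case True
      then show ?thesis using finished less.prems by blast
    next
      case nz: False
      let ?m = "lm t" and ?c = "lcf t"
      note l = lm_S[OF tc nz] lcf_closed[OF tc nz]
      have mm: "(?m, m) \<in> ord" by (rule less.prems(3)[OF lm_occ[OF tc nz]])
      have mm0: "(?m, m0) \<in> ord" using mm less.prems(1) ord_trans by blast
      have guard: "run (Then GoLeft lead_prog) (Node dt (Node dout enc_env)) (Node (Scal ?c) (ee ?m))"
        using exec_lead[OF less.prems(2)] nz by (simp add: enc_lead_def)
      note lead_t = exec_iff[OF exec_lead[OF less.prems(2)]]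
      obtain d where d: "run reducer_prog (Node enc_env (ee ?m)) d"
        "is_reducer gset ?m d"
        using exec_reducer[OF l(1)] by blast
      have next_goal: "goal dt' dout'"
        if q: "q \<in> carrier A" "q \<noteq> \<zero>" "lm q = ?m" and c: "c \<in> carrier R" "c \<otimes>\<^bsub>R\<^esub> lcf q = ?c"
          and dt': "rep dt' ((\<ominus>\<^bsub>R\<^esub> c) \<odot> q \<oplus> t)" and r': "rep dout' (val m0 \<oplus> r')" "good r'"
          and mem: "(val m0 \<oplus> r') \<ominus> ((\<ominus>\<^bsub>R\<^esub> c) \<odot> q \<oplus> t) \<in> I" for q c dt' dout' r'
      proof -
        let ?t = "(\<ominus>\<^bsub>R\<^esub> c) \<odot> q \<oplus> t"
        have "?t = t \<ominus> c \<odot> q"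
          using q c tc by (simp add: A.smult_l_minus A.minus_eq A.a_comm)
        then have b: "below ?t ?m" using below_tail[OF tc nz q c] by simp
        show ?thesis
        proof (cases "?t = \<zero>")
          case True
          then show ?thesis using finished dt' r' mem by simp
        next
          case False
          note bl = below_lm[OF b False]
          have tc': "?t \<in> carrier A" using b by (simp add: below_def)
          have lt: "(lm ?t, m) \<in> ord" "lm ?t \<noteq> m" using bl mm ord_trans ord_antisym by metis+
          have "(lm ?t, m0) \<in> ord" using lt(1) less.prems(1) ord_trans by blast
          then show ?thesis
            using less.IH[OF lt _ dt' lm_max[OF tc' False] r' mem] by blast
        qed
      qed
      have advance: "goal dt dout"
        if "run reduce_step (Node dt (Node dout enc_env)) (Node dt' (Node dout' enc_env))" "goal dt' dout'"
        for dt' dout'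
        using that(2) exec_While2[OF guard _ that(1)] unfolding goal_def by blast
      from d(2) show ?thesis
        unfolding is_reducer_def
      proof (elim disjE conjE bexE)
        assume leaf: "d = Leaf" and irr: "\<forall>g\<in>gset. g \<noteq> \<zero> \<longrightarrow> \<not> dv (lm g) ?m"
        have ml: "?m \<notin> lms I" using irr lms_groebner[OF I G, of ?m] by blast
        let ?q = "\<one>\<^bsub>R\<^esub> \<odot> val ?m"
        have qd: "rep (Node (Node (Scal \<one>\<^bsub>R\<^esub>) (ee ?m)) Leaf) ?q" using l by (intro rep_term) auto
        have sc: "\<ominus>\<^bsub>R\<^esub> ?c \<in> carrier R" using l by simp
        obtain dt' where dt': "run axpy_prog (Node (Scal (\<ominus>\<^bsub>R\<^esub> ?c)) (Node (Node (Node (Scal \<one>\<^bsub>R\<^esub>) (ee ?m)) Leaf) dt)) dt'"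
          "rep dt' ((\<ominus>\<^bsub>R\<^esub> ?c) \<odot> ?q \<oplus> t)"
          using exec_axpy[OF sc qd less.prems(2)] by blast
        obtain dout' where dout': "run axpy_prog (Node (Scal (\<ominus>\<^bsub>R\<^esub> ?c)) (Node (Node (Node (Scal \<one>\<^bsub>R\<^esub>) (ee ?m)) Leaf) dout)) dout'"
          "rep dout' ((\<ominus>\<^bsub>R\<^esub> ?c) \<odot> ?q \<oplus> (val m0 \<oplus> r))"
          using exec_axpy[OF sc qd less.prems(4)] by blast
        define x where "x = (\<ominus>\<^bsub>R\<^esub> ?c) \<odot> ?q"
        have xc: "x \<in> carrier A" using sc by (simp add: x_def)
        have xo: "occ x \<subseteq> {?m}" using occ_smult[of "val ?m" "\<ominus>\<^bsub>R\<^esub> ?c"] occ_val[OF l(1)] sc by (simp add: x_def)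
        have eq1: "x \<oplus> (val m0 \<oplus> r) = val m0 \<oplus> (x \<oplus> r)"
          using xc rc by (simp add: A.a_lcomm)
        have "?m \<noteq> m0" using ml m0l by blast
        then have bx: "below x m0" using xo xc mm0 by (auto simp: below_def)
        have good': "good (x \<oplus> r)"
          using less.prems(5) bx below_add[OF bx] occ_add[OF xc rc] xo ml by (auto simp: good_def)
        have eq2: "(val m0 \<oplus> (x \<oplus> r)) \<ominus> (x \<oplus> t) = (val m0 \<oplus> r) \<ominus> t"
        proof -
          have "val m0 \<in> carrier A" by simp
          then show ?thesis using xc rc tc by algebra
        qed
        have "goal dt' dout'"
        proof (rule next_goal[of ?q ?c])
          show "?c \<otimes>\<^bsub>R\<^esub> lcf ?q = ?c"
            using l by (simp add: LC_def val_nonzero lm_val co_val single_def)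
          show "rep dout' (val m0 \<oplus> (x \<oplus> r))" using dout'(2) eq1 by (simp only: x_def)
          show "val m0 \<oplus> (x \<oplus> r) \<ominus> ((\<ominus>\<^bsub>R\<^esub> ?c) \<odot> ?q \<oplus> t) \<in> I"
            using eq2 less.prems(6) by (simp only: x_def)
        qed (use l dt' good' in \<open>auto simp: val_nonzero lm_val\<close>)
        moreover have "run reduce_step (Node dt (Node dout enc_env)) (Node dt' (Node dout' enc_env))"
          unfolding reduce_step_def Let_def
          by (simp add: lead_t enc_lead_def nz exec_iff[OF d(1)] leaf exec_iff[OF dt'(1)] exec_iff[OF dout'(1)])
        ultimately show ?thesis using advance by blast
      next
        fix g k assume dn: "d \<noteq> Leaf" and g: "g \<in> gset" "k \<in> S" and q: "rep d (val k \<otimes> g)"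
          "val k \<otimes> g \<noteq> \<zero>" "lm (val k \<otimes> g) = ?m"
        let ?q = "val k \<otimes> g"
        have gI: "g \<in> I" using g GI by blast
        have qI: "?q \<in> I" using I.I_l_closed[OF gI] by simp
        have qc: "?q \<in> carrier A" by (rule rep_closed[OF q(1)])
        note lq = lcf_closed[OF qc q(2)] lcf_nonzero[OF qc q(2)]
        have i: "inv\<^bsub>R\<^esub> (lcf ?q) \<in> carrier R" "inv\<^bsub>R\<^esub> (lcf ?q) \<otimes>\<^bsub>R\<^esub> lcf ?q = \<one>\<^bsub>R\<^esub>"
          using lq R.field_Units by auto
        define c where "c = ?c \<otimes>\<^bsub>R\<^esub> inv\<^bsub>R\<^esub> (lcf ?q)"
        have c: "c \<in> carrier R" "c \<otimes>\<^bsub>R\<^esub> lcf ?q = ?c"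
          using i l lq by (auto simp: c_def R.m_assoc)
        have s: "(\<ominus>\<^bsub>R\<^esub> ?c) \<otimes>\<^bsub>R\<^esub> inv\<^bsub>R\<^esub> (lcf ?q) = \<ominus>\<^bsub>R\<^esub> c" using l i by (simp add: c_def R.l_minus)
        have sc: "\<ominus>\<^bsub>R\<^esub> c \<in> carrier R" using c by simp
        obtain dt' where dt': "run axpy_prog (Node (Scal (\<ominus>\<^bsub>R\<^esub> c)) (Node d dt)) dt'"
          "rep dt' ((\<ominus>\<^bsub>R\<^esub> c) \<odot> ?q \<oplus> t)"
          using exec_axpy[OF sc q(1) less.prems(2)] by blast
        define x where "x = (\<ominus>\<^bsub>R\<^esub> c) \<odot> ?q"
        have xI: "x \<in> I" unfolding x_def by (rule ideal_smult[OF I qI sc])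
        have xc: "x \<in> carrier A" using xI Ic by blast
        have "(val m0 \<oplus> r) \<ominus> (x \<oplus> t) = ((val m0 \<oplus> r) \<ominus> t) \<ominus> x"
        proof -
          have "val m0 \<in> carrier A" by simp
          then show ?thesis using xc rc tc by algebra
        qed
        then have mem: "(val m0 \<oplus> r) \<ominus> (x \<oplus> t) \<in> I"
          using less.prems(6) xI I.a_closed I.a_inv_closed by (simp add: A.minus_eq)
        have "goal dt' dout"
          by (rule next_goal[OF qc q(2,3) c dt'(2) less.prems(4,5)]) (use mem in \<open>simp add: x_def\<close>)
        moreover have "run reduce_step (Node dt (Node dout enc_env)) (Node dt' (Node dout enc_env))"
          unfolding reduce_step_def Let_def
          using lq(2) by (simp add: lead_t enc_lead_def nz exec_iff[OF d(1)] dn exec_iff[OF exec_lead[OF q(1)]]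
              q(2) s exec_iff[OF dt'(1)])
        ultimately show ?thesis using advance by blast
      qed
    qed
  qed
  let ?mono = "Node (Node (Scal \<one>\<^bsub>R\<^esub>) (ee m0)) Leaf"
  have rm: "rep ?mono (val m0)" using rep_term[of "\<one>\<^bsub>R\<^esub>" m0] m0S by simp
  have "goal ?mono ?mono"
  proof (rule loop[of m0 _ "val m0" _ "\<zero>"])
    show "(val m0 \<oplus> \<zero>) \<ominus> val m0 \<in> I" by (simp add: A.minus_eq A.r_neg)
  qed (use m0S rm ord_refl[OF m0S] in \<open>auto simp: occ_val good_def below_zero occ_zero\<close>)
  then obtain dt' d g where w: "run ?W (Node ?mono (Node ?mono enc_env)) (Node dt' (Node d enc_env))"
    and g: "g \<in> rgb I" "lm g = m0" "rep d g" unfolding goal_def by blast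
  have "run reduce_prog (Node enc_env (ee m0)) d"
    unfolding reduce_prog_def Let_def
    by (rule exec_Then[where y = "Node ?mono (Node ?mono enc_env)"], simp, rule exec_Then[OF w], simp)
  then show ?thesis using g by blast
qed

lemma exec_main:
  assumes I: "ideal I A" and G: "groebner_basis R A H \<Sigma> ord L I gset"
  shows "\<exists>d ds xs. run main_prog
      (Node (Node n (Node (enc_exps sgens) (Node enc_kgens Leaf))) (enc_list (map et gss))) d \<and>
    d = enc_list ds \<and> list_all2 rep ds xs \<and> set xs = rgb I"
proof -
  let ?min = "\<lambda>m. \<forall>g\<in>gset. g \<noteq> \<zero> \<and> dv (lm g) m \<longrightarrow> lm g = m"
  define P where "P ys d \<longleftrightarrow> (\<exists>ds xs. d = enc_list ds \<and> list_all2 rep ds xs \<and> set xs \<subseteq> rgb I \<and>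
    lm ` set xs = {lm g |g. g \<in> tval ` set ys \<and> g \<noteq> \<zero> \<and> ?min (lm g)})" for ys and d :: "'r data"
  have "\<exists>d. run (Fold GoLeft MkLeaf main_body) enc_env d \<and> P gss d"
  proof (rule exec_Fold_map[where ex = et and P = P])
    fix ys ts zs a assume eq: "gss = ys @ ts # zs" and P: "P ys a"
    let ?env = "Node (et ts) (Node a enc_env)"
    let ?g = "tval ts"
    have ts: "std_terms ts" using gss eq by auto
    note gc = tval_closed[OF ts]
    have gG: "?g \<in> gset" using eq by simp
    obtain ds xs where xs: "a = enc_list ds" "list_all2 rep ds xs" "set xs \<subseteq> rgb I"
      "lm ` set xs = {lm g |g. g \<in> tval ` set ys \<and> g \<noteq> \<zero> \<and> ?min (lm g)}"
      using P unfolding P_def by blast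
    show "\<exists>a'. run main_body ?env a' \<and> P (ys @ [ts]) a'"
    proof (cases "?g \<noteq> \<zero> \<and> ?min (lm ?g)")
      case False
      have "run main_body ?env a"
      proof (cases "?g = \<zero>")
        case True
        then show ?thesis by (simp add: main_body_def exec_lead_terms[OF ts] enc_lead_def)
      next
        case nz: False
        then have nm: "\<not> ?min (lm ?g)" using False by blast
        have "?min (lm ?g) = False" using nm by blast
        then have "run minimal_prog (Node enc_env (ee (lm ?g))) (enc_bool False)"
          using exec_minimal[OF lm_S[OF gc nz]] by (simp only:)
        note m = exec_iff[OF this]
        show ?thesis using nz by (simp add: main_body_def exec_lead_terms[OF ts] enc_lead_def m)
      qed
      moreover have "{lm g |g. g \<in> tval ` set (ys @ [ts]) \<and> g \<noteq> \<zero> \<and> ?min (lm g)} =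
          {lm g |g. g \<in> tval ` set ys \<and> g \<noteq> \<zero> \<and> ?min (lm g)}"
        using False by auto
      then have "P (ys @ [ts]) a" using xs unfolding P_def by metis
      ultimately show ?thesis by blast
    next
      case True
      then have nz: "?g \<noteq> \<zero>" and mn: "?min (lm ?g)" by blast+
      have "?min (lm ?g) = True" using mn by blast
      then have "run minimal_prog (Node enc_env (ee (lm ?g))) (enc_bool True)"
        using exec_minimal[OF lm_S[OF gc nz]] by (simp only:)
      note m = exec_iff[OF this]
      have mm: "lm ?g \<in> min_lms I"
        unfolding min_lms_groebner[OF I G] using gG nz mn by blast
      obtain d h where d: "run reduce_prog (Node enc_env (ee (lm ?g))) d" "h \<in> rgb I" "lm h = lm ?g" "rep d h"
        using exec_reduce[OF I G mm] by blast
      have "run main_body ?env (Node d a)"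
        using nz by (simp add: main_body_def exec_lead_terms[OF ts] enc_lead_def m exec_iff[OF d(1)])
      moreover have "{lm g |g. g \<in> tval ` set (ys @ [ts]) \<and> g \<noteq> \<zero> \<and> ?min (lm g)} =
          insert (lm ?g) {lm g |g. g \<in> tval ` set ys \<and> g \<noteq> \<zero> \<and> ?min (lm g)}"
        using nz mn by auto
      then have "P (ys @ [ts]) (Node d a)"
        unfolding P_def using xs d by (intro exI[of _ "d # ds"] exI[of _ "h # xs"]) simp
      ultimately show ?thesis by blast
    qed
  qed (auto simp: P_def intro!: exI[of _ "[]"])
  then obtain ds xs where r: "run (Fold GoLeft MkLeaf main_body) enc_env (enc_list ds)" "list_all2 rep ds xs"
    "set xs \<subseteq> rgb I" "lm ` set xs = min_lms I"
    unfolding min_lms_groebner[OF I G] P_def by blast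
  have "rgb I \<subseteq> set xs"
  proof
    fix g assume g: "g \<in> rgb I"
    then have "lm g \<in> lm ` set xs" using r(4) by (simp add: rgb_def)
    then obtain x where x: "x \<in> set xs" "lm g = lm x" by blast
    then have "g = x" using rgb_unique[OF I g] r(3) by blast
    then show "g \<in> set xs" using x by simp
  qed
  moreover have "run main_prog (Node (Node n (Node (enc_exps sgens) (Node enc_kgens Leaf))) (enc_list (map et gss))) (enc_list ds)"
    unfolding main_prog_def by (rule exec_Then[OF _ r(1)]) simp
  ultimately show ?thesis using r(2,3) by blast
qed

end

end

lemma list_all2_represented:
  assumes "list_all2 Q ds xs" "\<And>d x. Q d x \<Longrightarrow> \<exists>t. T t \<and> d = e t \<and> x = v t"
  shows "\<exists>ts. (\<forall>t\<in>set ts. T t) \<and> ds = map e ts \<and> xs = map v ts"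
  using assms(1)
proof (induction rule: list_all2_induct)
  case Nil
  then show ?case by simp
next
  case (Cons d ds x xs)
  then obtain ts t where "\<forall>t\<in>set ts. T t" "ds = map e ts" "xs = map v ts" "T t" "d = e t" "x = v t"
    using assms(2) by blast
  then show ?case by (intro exI[of _ "t # ts"]) simp
qed

theorem theorem4p46:
  shows
    "(\<forall>(R :: 'r ring) (A :: ('r, 'a) module) H \<Sigma> ord L I.
        pseudo_asl R A H \<Sigma> \<and> term_order R A H \<Sigma> ord \<and> leading_term_algebra R A H \<Sigma> ord L \<and>
        ideal I A \<longrightarrow>
        (\<exists>!G. reduced_groebner_basis R A H \<Sigma> ord L I G))
   \<and> (\<exists>p. \<forall>(R :: 'r ring) (A :: ('r, 'a) module) H \<Sigma> ord L hs sub d dG G.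
        pseudo_asl R A H \<Sigma> \<and> term_order R A H \<Sigma> ord \<and> leading_term_algebra R A H \<Sigma> ord L \<and>
        describes R H \<Sigma> L hs d \<and> correct_subroutines R A H \<Sigma> ord L hs sub \<and>
        represents_finite_set (represents_elem R A H \<Sigma> hs) dG G \<and>
        groebner_basis R A H \<Sigma> ord L (Idl\<^bsub>A\<^esub> G) G \<longrightarrow>
        (\<exists>dG' G'. exec R sub p (Node d dG) dG' \<and>
          represents_finite_set (represents_elem R A H \<Sigma> hs) dG' G' \<and>
          reduced_groebner_basis R A H \<Sigma> ord L (Idl\<^bsub>A\<^esub> G) G'))"
proof (intro conjI allI impI)
  fix R :: "'r ring" and A :: "('r, 'a) module" and H \<Sigma> ord L I
  assume a: "pseudo_asl R A H \<Sigma> \<and> term_order R A H \<Sigma> ord \<and> leading_term_algebra R A H \<Sigma> ord L \<and> ideal I A"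
  then interpret leading_pasl R A H \<Sigma> ord L by unfold_locales auto
  show "\<exists>!G. reduced_groebner_basis R A H \<Sigma> ord L I G"
    using reduced_iff[of I] a by simp
next
  show "\<exists>p. \<forall>(R :: 'r ring) (A :: ('r, 'a) module) H \<Sigma> ord L hs sub d dG G.
        pseudo_asl R A H \<Sigma> \<and> term_order R A H \<Sigma> ord \<and> leading_term_algebra R A H \<Sigma> ord L \<and>
        describes R H \<Sigma> L hs d \<and> correct_subroutines R A H \<Sigma> ord L hs sub \<and>
        represents_finite_set (represents_elem R A H \<Sigma> hs) dG G \<and>
        groebner_basis R A H \<Sigma> ord L (Idl\<^bsub>A\<^esub> G) G \<longrightarrow>
        (\<exists>dG' G'. exec R sub p (Node d dG) dG' \<and>
          represents_finite_set (represents_elem R A H \<Sigma> hs) dG' G' \<and>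
          reduced_groebner_basis R A H \<Sigma> ord L (Idl\<^bsub>A\<^esub> G) G')"
  proof (intro exI[of _ main_prog] allI impI, elim conjE)
    fix R :: "'r ring" and A :: "('r, 'a) module" and H \<Sigma> ord L hs sub d dG G
    assume asl: "pseudo_asl R A H \<Sigma>" "term_order R A H \<Sigma> ord" "leading_term_algebra R A H \<Sigma> ord L"
      and desc: "describes R H \<Sigma> L hs d" and sub: "correct_subroutines R A H \<Sigma> ord L hs sub"
      and dG: "represents_finite_set (represents_elem R A H \<Sigma> hs) dG G"
      and G: "groebner_basis R A H \<Sigma> ord L (Idl\<^bsub>A\<^esub> G) G"
    interpret leading_pasl R A H \<Sigma> ord L using asl by unfold_locales auto
    obtain sgens dK K where hs: "set hs = H"
      and sg: "set sgens \<subseteq> exponents H" "exp_genideal H (set sgens) = \<Sigma>"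
      and K: "represents_finite_set (represents_coeffs R hs (exponents H)) dK K"
        "\<forall>p\<in>K. card {m. p m \<noteq> \<zero>\<^bsub>R\<^esub>} \<le> 2" "Idl\<^bsub>exp_poly_ring R H\<^esub> K = eval_kernel R H L"
      and d: "d = enc_list [enc_nat (length hs), enc_list (map (enc_exp hs) sgens), dK]"
      using desc unfolding describes_def by blast
    obtain kds ks where kds: "dK = enc_list kds" "list_all2 (represents_coeffs R hs (exponents H)) kds ks" "set ks = K"
      using K(1) unfolding represents_finite_set_def by blast
    obtain kgens where kg: "\<forall>ts\<in>set kgens. set ts \<subseteq> carrier R \<times> exponents H"
      "kds = map (enc_terms hs) kgens" "ks = map (terms_coeff R) kgens"
      using list_all2_represented[OF kds(2), where T = "\<lambda>ts. set ts \<subseteq> carrier R \<times> exponents H"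
          and e = "enc_terms hs" and v = "terms_coeff R"]
      unfolding represents_coeffs_def by blast
    have Kk: "K = terms_coeff R ` set kgens" using kds(3) kg(3) by auto
    interpret algorithm_setting R A H \<Sigma> ord L hs sub sgens kgens
      by unfold_locales (use hs sub sg kg(1) K(2,3) Kk in auto)
    obtain gds gs where gds: "dG = enc_list gds" "list_all2 rep gds gs" "set gs = G"
      using dG unfolding represents_finite_set_def by blast
    obtain gss where gss: "\<forall>ts\<in>set gss. std_terms ts" "gds = map et gss" "gs = map tval gss"
      using list_all2_represented[OF gds(2), where T = std_terms and e = et and v = tval]
      unfolding represents_elem_iff by blast
    have Gg: "G = tval ` set gss" using gds(3) gss(3) by auto
    have "G \<subseteq> carrier A" unfolding Gg using gss(1) tval_closed by blast
    then have I: "ideal (Idl\<^bsub>A\<^esub> G) A" by (rule A.genideal_ideal)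
    obtain d' ds xs where r: "run main_prog
        (Node (Node (enc_nat (length hs)) (Node (enc_exps sgens) (Node enc_kgens Leaf))) (enc_list (map et gss))) d'"
      "d' = enc_list ds" "list_all2 rep ds xs" "set xs = rgb (Idl\<^bsub>A\<^esub> G)"
      using exec_main[of gss "Idl\<^bsub>A\<^esub> G"] gss(1) I G unfolding Gg by blast
    have "run main_prog (Node d dG) d'"
      using r(1) d gds(1) gss(2) kds(1) kg(2) by simp
    moreover have "represents_finite_set rep d' (rgb (Idl\<^bsub>A\<^esub> G))"
      unfolding represents_finite_set_def using r(2,3,4) by blast
    ultimately show "\<exists>dG' G'. run main_prog (Node d dG) dG' \<and> represents_finite_set rep dG' G' \<and>
        reduced_groebner_basis R A H \<Sigma> ord L (Idl\<^bsub>A\<^esub> G) G'"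
      using reduced_iff[OF I] by blast
  qed
qed

end
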